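(* Let $d\ge1$, suppose that $A\in M_d(\mathbb Z)$ has nonzero determinant, put $B=A^t$, and let $\beta>\log|\det A|$. For a probability measure $\mu$ on $\mathbb T^d$ let $\psi_{\beta,\mu}$ be the KMS$_\beta$ state of $(\mathcal T(M_L),\sigma)$ such that, for $m,n\in\mathbb Z^d$ and $k,l\in\mathbb N$, $\psi_{\beta,\mu}(u_mv^kv^{*l}u_n^* )=0$ unless $k=l$ and $m-n\in B^k\mathbb Z^d$, and in that case $$\psi_{\beta,\mu}(u_mv^kv^{*l}u_n^* )=(1-|\det A|e^{-\beta})\sum_{\{j\ge k\,:\,m-n\in B^j\mathbb Z^d\}}|\det A|^{j-k}e^{-j\beta}\int_{\mathbb T^d}z^{B^{-j}(m-n)}\,d\mu(z).$$ Then the map $\mu\mapsto\psi_{\beta,\mu}$ is an affine homeomorphism of the simplex $P(\mathbb T^d)$ of probability measures onto the simplex of KMS$_\beta$ states for $(\mathcal T(M_L),\sigma)$.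
   Context: $\mathbb N=\{0,1,2,\dots\}$. $\mathbb T^d=\mathbb R^d/\mathbb Z^d$, with points written $e^{2\pi ix}=(e^{2\pi ix_1},\dots,e^{2\pi ix_d})$; $\gamma_m(z)=z^m=\prod_i z_i^{m_i}$ for $m\in\mathbb Z^d$. The covering $\sigma_A:\mathbb T^d\to\mathbb T^d$ is $\sigma_A(e^{2\pi ix})=e^{2\pi iAx}$; $\alpha_A(f)=f\circ\sigma_A$; $L(f)(z)=\frac1{|\det A|}\sum_{\sigma_A(w)=z}f(w)$. The right-Hilbert bimodule $M_L$ over $C(\mathbb T^d)$ has underlying space $C(\mathbb T^d)$, actions $f\cdot m\cdot g=fm\alpha_A(g)$ and inner product $\langle m,n\rangle=L(m^*n)$. The Toeplitz algebra $\mathcal T(M_L)$ is generated by a universal representation $(i_{M_L},i_{C(\mathbb T^d)})$ of $M_L$, where a representation $(\psi,\pi)$ consists of a linear map $\psi$ on $M_L$ and a unital $*$-homomorphism $\pi$ of $C(\mathbb T^d)$ with $\psi(f\cdot m\cdot g)=\pi(f)\psi(m)\pi(g)$ and $\pi(\langle m,n\rangle)=\psi(m)^*\psi(n)$. Write $u_m=i_{C(\mathbb T^d)}(\gamma_m)$ and $v=i_{M_L}(1)$; $u$ is a unitary representation of $\mathbb Z^d$ and $v$ an isometry. (Equivalently, $\mathcal T(M_L)$ is the universal $C^*$-algebra generated by such $u,v$ with $vu_m=u_{Bm}v$, and $v^*u_mv=u_{B^{-1}m}$ if $m\in B\mathbb Z^d$, $v^*u_mv=0$ otherwise.) The closed linear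 span of the elements $u_mv^kv^{*l}u_n^*$ is $\mathcal T(M_L)$, and a KMS$_\beta$ state $\psi_{\beta,\mu}$ with the stated values exists. The dynamics $\sigma:\mathbb R\to\operatorname{Aut}\mathcal T(M_L)$ is characterised by $\sigma_t(u_m)=u_m$, $\sigma_t(v)=e^{it}v$. An element $c$ is analytic if $t\mapsto\sigma_t(c)$ extends to an entire function. For $\beta\in(0,\infty)$, a state $\phi$ is a KMS$_\beta$ state if $\phi(dc)=\phi(c\,\sigma_{i\beta}(d))$ for all analytic $c,d$. Sets of states and $P(\mathbb T^d)$ (Borel probability measures) carry the weak* topology. *)

theory Defs
  imports "HOL-Probability.Probability" "HOL-Algebra.Ring"
begin

section \<open>Unital C*-algebras\<close>

class cstar_algebra = real_normed_algebra_1 + banach +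
  fixes scaleC :: "complex \<Rightarrow> 'a \<Rightarrow> 'a"  (infixr \<open>*\<^sub>C\<close> 75)
    and star :: "'a \<Rightarrow> 'a"
  assumes scaleC_of_real: "complex_of_real r *\<^sub>C x = r *\<^sub>R x"
    and scaleC_add_right: "a *\<^sub>C (x + y) = a *\<^sub>C x + a *\<^sub>C y"
    and scaleC_add_left: "(a + b) *\<^sub>C x = a *\<^sub>C x + b *\<^sub>C x"
    and scaleC_scaleC: "a *\<^sub>C (b *\<^sub>C x) = (a * b) *\<^sub>C x"
    and mult_scaleC_left: "(a *\<^sub>C x) * y = a *\<^sub>C (x * y)"
    and mult_scaleC_right: "x * (a *\<^sub>C y) = a *\<^sub>C (x * y)"
    and norm_scaleC: "norm (a *\<^sub>C x) = cmod a * norm x"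
    and star_star: "star (star x) = x"
    and star_add: "star (x + y) = star x + star y"
    and star_scaleC: "star (a *\<^sub>C x) = cnj a *\<^sub>C star x"
    and star_mult: "star (x * y) = star y * star x"
    and cstar_identity: "norm (star x * x) = (norm x)\<^sup>2"

text \<open>
  The type class cannot be quantified over inside a formula. For the universal property of the
  Toeplitz algebra, the same notion is also needed for structures on a carrier set.
\<close>

record 'a cstar_struct = "'a ring" +
  cscale :: "complex \<Rightarrow> 'a \<Rightarrow> 'a"
  cstar :: "'a \<Rightarrow> 'a"
  cnorm :: "'a \<Rightarrow> real"

locale unital_cstar_algebra = ring S for S :: "'a cstar_struct" (structure) +
  assumes cscale_closed: "x \<in> carrier S \<Longrightarrow> cscale S a x \<in> carrier S"
    and cscale_one: "x \<in> carrier S \<Longrightarrow> cscale S 1 x = x"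
    and cscale_add_right: "x \<in> carrier S \<Longrightarrow> y \<in> carrier S \<Longrightarrow>
      cscale S a (x \<oplus> y) = cscale S a x \<oplus> cscale S a y"
    and cscale_add_left: "x \<in> carrier S \<Longrightarrow> cscale S (a + b) x = cscale S a x \<oplus> cscale S b x"
    and cscale_cscale: "x \<in> carrier S \<Longrightarrow> cscale S a (cscale S b x) = cscale S (a * b) x"
    and mult_cscale_left: "x \<in> carrier S \<Longrightarrow> y \<in> carrier S \<Longrightarrow>
      cscale S a x \<otimes> y = cscale S a (x \<otimes> y)"
    and mult_cscale_right: "x \<in> carrier S \<Longrightarrow> y \<in> carrier S \<Longrightarrow>
      x \<otimes> cscale S a y = cscale S a (x \<otimes> y)"
    and cstar_closed: "x \<in> carrier S \<Longrightarrow> cstar S x \<in> carrier S"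
    and cstar_cstar: "x \<in> carrier S \<Longrightarrow> cstar S (cstar S x) = x"
    and cstar_add: "x \<in> carrier S \<Longrightarrow> y \<in> carrier S \<Longrightarrow>
      cstar S (x \<oplus> y) = cstar S x \<oplus> cstar S y"
    and cstar_cscale: "x \<in> carrier S \<Longrightarrow> cstar S (cscale S a x) = cscale S (cnj a) (cstar S x)"
    and cstar_mult: "x \<in> carrier S \<Longrightarrow> y \<in> carrier S \<Longrightarrow>
      cstar S (x \<otimes> y) = cstar S y \<otimes> cstar S x"
    and cnorm_eq_zero: "x \<in> carrier S \<Longrightarrow> cnorm S x = 0 \<longleftrightarrow> x = \<zero>"
    and cnorm_triangle: "x \<in> carrier S \<Longrightarrow> y \<in> carrier S \<Longrightarrow>
      cnorm S (x \<oplus> y) \<le> cnorm S x + cnorm S y"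
    and cnorm_cscale: "x \<in> carrier S \<Longrightarrow> cnorm S (cscale S a x) = cmod a * cnorm S x"
    and cnorm_mult: "x \<in> carrier S \<Longrightarrow> y \<in> carrier S \<Longrightarrow>
      cnorm S (x \<otimes> y) \<le> cnorm S x * cnorm S y"
    and cnorm_cstar_identity: "x \<in> carrier S \<Longrightarrow> cnorm S (cstar S x \<otimes> x) = (cnorm S x)\<^sup>2"
    and cnorm_complete: "(\<forall>i::nat. X i \<in> carrier S) \<Longrightarrow>
      (\<forall>e>0. \<exists>N. \<forall>i\<ge>N. \<forall>j\<ge>N. cnorm S (X i \<ominus> X j) < e) \<Longrightarrow>
      \<exists>x\<in>carrier S. (\<lambda>i. cnorm S (X i \<ominus> x)) \<longlonglongrightarrow> 0"

definition type_cstar :: "'a::cstar_algebra cstar_struct" where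
  "type_cstar = \<lparr>carrier = UNIV, mult = (*), one = 1, zero = 0, add = (+),
     cscale = scaleC, cstar = star, cnorm = norm\<rparr>"

definition star_hom :: "'a cstar_struct \<Rightarrow> 'b cstar_struct \<Rightarrow> ('a \<Rightarrow> 'b) \<Rightarrow> bool" where
  "star_hom R S h \<longleftrightarrow> h \<in> ring_hom R S \<and>
     (\<forall>x\<in>carrier R. (\<forall>a. h (cscale R a x) = cscale S a (h x)) \<and> h (cstar R x) = cstar S (h x))"

lemma type_cstar_simps [simp]:
  "carrier type_cstar = UNIV" "x \<otimes>\<^bsub>type_cstar\<^esub> y = x * y" "\<one>\<^bsub>type_cstar\<^esub> = 1"
  "\<zero>\<^bsub>type_cstar\<^esub> = 0" "x \<oplus>\<^bsub>type_cstar\<^esub> y = x + y"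
  "cscale type_cstar = scaleC" "cstar type_cstar = star" "cnorm type_cstar = norm"
  by (simp_all add: type_cstar_def)

lemma ring_type_cstar: "ring (type_cstar :: 'a::cstar_algebra cstar_struct)"
  by (rule ringI, rule abelian_groupI)
    (auto simp: algebra_simps intro!: monoid.intro exI[of _ "- x" for x] 
      intro: add.left_inverse)

lemma type_cstar_minus [simp]: "x \<ominus>\<^bsub>type_cstar\<^esub> y = x - (y :: 'a::cstar_algebra)"
proof -
  interpret ring "type_cstar :: 'a cstar_struct" by (rule ring_type_cstar)
  have "\<ominus>\<^bsub>type_cstar\<^esub> y = - y"
    by (rule minus_equality) auto
  then show ?thesis by (simp add: a_minus_def)
qed

lemma unital_cstar_algebra_type_cstar:
  "unital_cstar_algebra (type_cstar :: 'a::cstar_algebra cstar_struct)"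
proof -
  have one: "1 *\<^sub>C x = x" for x :: 'a using scaleC_of_real[of 1 x] by simp
  have complete: "\<exists>x. (\<lambda>i. norm (X i - x)) \<longlonglongrightarrow> 0"
    if "\<forall>e>0. \<exists>N. \<forall>i\<ge>N. \<forall>j\<ge>N. norm (X i - X j) < e" for X :: "nat \<Rightarrow> 'a"
  proof -
    have "Cauchy X" using that by (simp add: Cauchy_def dist_norm)
    then obtain x where "X \<longlonglongrightarrow> x" using Cauchy_convergent convergent_def by blast
    then have "(\<lambda>i. norm (X i - x)) \<longlonglongrightarrow> 0"
      by (simp add: LIM_zero_iff tendsto_norm_zero_iff)
    then show ?thesis by blast
  qed
  show ?thesis
    by (intro unital_cstar_algebra.intro ring_type_cstar unital_cstar_algebra_axioms.intro)
      (auto simp: one scaleC_add_right scaleC_add_left scaleC_scaleC mult_scaleC_left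
        mult_scaleC_right norm_scaleC star_star star_add star_scaleC star_mult cstar_identity
        norm_triangle_ineq norm_mult_ineq complete)
qed

section \<open>The torus and the bimodule\<close>

typedef 'n torus = "{z :: complex ^ 'n. \<forall>i. cmod (z $ i) = 1}"
  by (rule exI[of _ "\<chi> i. 1"]) simp

instantiation torus :: (finite) metric_space
begin

definition dist_torus :: "'a torus \<Rightarrow> 'a torus \<Rightarrow> real" where
  "dist_torus z w = dist (Rep_torus z) (Rep_torus w)"

definition uniformity_torus :: "('a torus \<times> 'a torus) filter" where
  "uniformity_torus = (INF e\<in>{0<..}. principal {(x, y). dist x y < e})"

definition open_torus :: "'a torus set \<Rightarrow> bool" where
  "open_torus U = (\<forall>x\<in>U. eventually (\<lambda>(x', y). x' = x \<longrightarrow> y \<in> U) uniformity)"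

instance
  by standard
    (auto simp: uniformity_torus_def open_torus_def dist_torus_def Rep_torus_inject
      dist_triangle2)

end

text \<open>The point \<open>e\<^bsup>2\<pi>ix\<^esup>\<close>.\<close>

definition torus_exp :: "real ^ 'n \<Rightarrow> 'n::finite torus" where
  "torus_exp x = Abs_torus (\<chi> i. cis (2 * pi * x $ i))"

definition torus_char :: "int ^ 'n \<Rightarrow> 'n::finite torus \<Rightarrow> complex" where
  "torus_char m z = (\<Prod>i\<in>UNIV. (Rep_torus z $ i) powi (m $ i))"

definition covering :: "int ^ 'n ^ 'n \<Rightarrow> 'n::finite torus \<Rightarrow> 'n torus" where
  "covering A z = Abs_torus (\<chi> i. torus_char (A $ i) z)"

definition transfer_op ::
    "int ^ 'n ^ 'n \<Rightarrow> ('n::finite torus \<Rightarrow> complex) \<Rightarrow> 'n torus \<Rightarrow> complex" where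
  "transfer_op A f z = (\<Sum>w\<in>{w. covering A w = z}. f w) / of_int \<bar>det A\<bar>"

definition C_torus :: "('n::finite torus \<Rightarrow> complex) cstar_struct" where
  "C_torus = \<lparr>carrier = {f. continuous_on UNIV f}, mult = (\<lambda>f g z. f z * g z), one = (\<lambda>_. 1),
     zero = (\<lambda>_. 0), add = (\<lambda>f g z. f z + g z), cscale = (\<lambda>a f z. a * f z),
     cstar = (\<lambda>f z. cnj (f z)), cnorm = (\<lambda>f. SUP z. cmod (f z))\<rparr>"

lemma Rep_torus_exp: "Rep_torus (torus_exp x) $ i = cis (2 * pi * x $ i)"
  by (simp add: torus_exp_def Abs_torus_inverse)

lemma torus_exp_surj: "\<exists>x. torus_exp x = z"
proof -
  have "torus_exp (\<chi> i. Arg (Rep_torus z $ i) / (2 * pi)) = z"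
  proof (rule Rep_torus_inject[THEN iffD1], rule vec_eq_iff[THEN iffD2], rule allI)
    fix i
    have "cmod (Rep_torus z $ i) = 1" using Rep_torus[of z] by simp
    then show "Rep_torus (torus_exp (\<chi> i. Arg (Rep_torus z $ i) / (2 * pi))) $ i = Rep_torus z $ i"
      using rcis_cmod_Arg[of "Rep_torus z $ i"] by (simp add: Rep_torus_exp rcis_def)
  qed
  then show ?thesis ..
qed

lemma torus_char_exp: "torus_char m (torus_exp x) = cis (2 * pi * (\<Sum>i\<in>UNIV. of_int (m $ i) * x $ i))"
proof -
  have "torus_char m (torus_exp x) = (\<Prod>i\<in>UNIV. cis (2 * pi * (of_int (m $ i) * x $ i)))"
    by (simp add: torus_char_def Rep_torus_exp cis_power_int mult.assoc mult.left_commute)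
  also have "\<dots> = cis (\<Sum>i\<in>UNIV. 2 * pi * (of_int (m $ i) * x $ i))"
    by (simp add: cis_conv_exp exp_sum sum_distrib_left)
  finally show ?thesis by (simp add: sum_distrib_left)
qed

text \<open>The defining property of the covering; it determines \<open>covering A\<close> by
  \<open>torus_exp_surj\<close>.\<close>

lemma covering_exp:
  "covering A (torus_exp x) = torus_exp ((\<chi> i j. of_int (A $ i $ j)) *v x)"
  by (simp add: covering_def torus_char_exp) (simp add: torus_exp_def matrix_vector_mult_def)

lemma compact_torus: "compact (UNIV :: 'n::finite torus set)"
proof -
  let ?K = "{z :: complex ^ 'n. \<forall>i. cmod (z $ i) = 1}"
  have "closed ?K"
    by (intro closed_Collect_all closed_Collect_eq continuous_intros)
  moreover have "bounded ?K"
    by (rule boundedI[of _ "sqrt (real CARD('n))"]) (simp add: norm_vec_def L2_set_def)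
  ultimately have "compact ?K" by (simp add: compact_eq_bounded_closed)
  moreover have "continuous_on ?K Abs_torus"
    by (auto simp: continuous_on_iff dist_torus_def Abs_torus_inverse)
  ultimately have "compact (Abs_torus ` ?K)" using compact_continuous_image by blast
  moreover have "Abs_torus ` ?K = UNIV"
    by (rule type_definition.Abs_image[OF type_definition_torus])
  ultimately show ?thesis by simp
qed

lemma ring_C_torus: "ring (C_torus :: ('n::finite torus \<Rightarrow> complex) cstar_struct)"
proof (rule ringI, rule abelian_groupI)
  fix f :: "'n torus \<Rightarrow> complex" assume "f \<in> carrier C_torus"
  then show "\<exists>g\<in>carrier C_torus. g \<oplus>\<^bsub>C_torus\<^esub> f = \<zero>\<^bsub>C_torus\<^esub>"
    by (intro bexI[of _ "\<lambda>z. - f z"]) (auto simp: C_torus_def intro: continuous_intros)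
qed (auto simp: C_torus_def algebra_simps intro!: monoid.intro continuous_intros)

lemma C_torus_minus:
  assumes "f \<in> carrier C_torus" "g \<in> carrier C_torus"
  shows "f \<ominus>\<^bsub>C_torus\<^esub> g = (\<lambda>z. f z - g z)"
proof -
  interpret ring "C_torus :: ('a torus \<Rightarrow> complex) cstar_struct" by (rule ring_C_torus)
  have "\<ominus>\<^bsub>C_torus\<^esub> g = (\<lambda>z. - g z)"
    by (rule minus_equality)
      (use assms in \<open>auto simp: C_torus_def intro: continuous_intros\<close>)
  then show ?thesis by (simp add: a_minus_def) (simp add: C_torus_def)
qed

lemma unital_cstar_algebra_C_torus:
  "unital_cstar_algebra (C_torus :: ('n::finite torus \<Rightarrow> complex) cstar_struct)"
proof -
  let ?C = "C_torus :: ('n torus \<Rightarrow> complex) cstar_struct"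
  have cont: "f \<in> carrier ?C \<longleftrightarrow> continuous_on UNIV f" for f by (simp add: C_torus_def)
  have bcont: "f \<in> bcontfun" if "f \<in> carrier ?C" for f
    using that compact_continuous_image[OF _ compact_torus, of f]
    by (auto simp: bcontfun_def cont compact_imp_bounded)
  have app: "apply_bcontfun (Bcontfun f) = f" if "f \<in> carrier ?C" for f
    using bcont[OF that] by (rule Bcontfun_inverse)
  have nrm: "cnorm ?C f = norm (Bcontfun f)" if "f \<in> carrier ?C" for f
    using app[OF that] by (simp add: C_torus_def norm_bcontfun_def dist_bcontfun_def)
  have le: "cmod (f z) \<le> cnorm ?C f" if "f \<in> carrier ?C" for f z
    using norm_bounded[of "Bcontfun f" z] app[OF that] nrm[OF that] by simp
  have bound: "cnorm ?C f \<le> b" if "f \<in> carrier ?C" "\<And>z. cmod (f z) \<le> b" for f b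
    using that(2) unfolding C_torus_def by (auto intro: cSUP_least)
  have nonneg: "0 \<le> cnorm ?C f" if "f \<in> carrier ?C" for f
    using nrm[OF that] by simp
  have sum: "(\<lambda>z. f z + g z) \<in> carrier ?C" "(\<lambda>z. f z * g z) \<in> carrier ?C"
    "(\<lambda>z. a * f z) \<in> carrier ?C" "(\<lambda>z. f z - g z) \<in> carrier ?C" "(\<lambda>z. cnj (f z)) \<in> carrier ?C"
    if "f \<in> carrier ?C" "g \<in> carrier ?C" for f g a
    using that by (auto simp: cont intro: continuous_intros)
  have zero: "cnorm ?C f = 0 \<longleftrightarrow> f = (\<lambda>_. 0)" if "f \<in> carrier ?C" for f
    using le[OF that] bound[OF that, of 0] nonneg[OF that] by fastforce
  have tri: "cnorm ?C (\<lambda>z. f z + g z) \<le> cnorm ?C f + cnorm ?C g"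
    if "f \<in> carrier ?C" "g \<in> carrier ?C" for f g
    using that by (intro bound sum order.trans[OF norm_triangle_ineq] add_mono le)
  have prod: "cnorm ?C (\<lambda>z. f z * g z) \<le> cnorm ?C f * cnorm ?C g"
    if "f \<in> carrier ?C" "g \<in> carrier ?C" for f g
    using that by (intro bound sum) (auto simp: norm_mult intro!: mult_mono le nonneg)
  have scale_le: "cnorm ?C (\<lambda>z. a * f z) \<le> cmod a * cnorm ?C f" if "f \<in> carrier ?C" for f a
    using that by (intro bound sum(3)) (auto simp: norm_mult intro!: mult_left_mono le)
  have scale: "cnorm ?C (\<lambda>z. a * f z) = cmod a * cnorm ?C f" if f: "f \<in> carrier ?C" for f a
  proof (cases "a = 0")
    case True
    then show ?thesis using zero[of "\<lambda>_. 0"] by (simp add: cont)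
  next
    case False
    have "cnorm ?C (\<lambda>z. inverse a * (a * f z)) \<le> cmod (inverse a) * cnorm ?C (\<lambda>z. a * f z)"
      by (rule scale_le[OF sum(3)[OF f f]])
    moreover have "(\<lambda>z. inverse a * (a * f z)) = f" using False by auto
    ultimately show ?thesis using scale_le[OF f, of a] False
      by (simp add: norm_divide field_simps)
  qed
  have star: "cnorm ?C (\<lambda>z. cnj (f z) * f z) = (cnorm ?C f)\<^sup>2" if f: "f \<in> carrier ?C" for f
  proof (rule antisym)
    have mem: "(\<lambda>z. cnj (f z) * f z) \<in> carrier ?C" by (intro sum(2) sum(5)[OF f f] f)
    show "cnorm ?C (\<lambda>z. cnj (f z) * f z) \<le> (cnorm ?C f)\<^sup>2"
      using le[OF f] nonneg[OF f]
      by (intro bound mem) (auto simp: norm_mult power2_eq_square intro!: mult_mono)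
    have "cmod (f z) \<le> sqrt (cnorm ?C (\<lambda>z. cnj (f z) * f z))" for z
      using le[OF mem, of z] by (intro real_le_rsqrt) (simp add: norm_mult power2_eq_square)
    then have "cnorm ?C f \<le> sqrt (cnorm ?C (\<lambda>z. cnj (f z) * f z))" by (intro bound f)
    then have "(cnorm ?C f)\<^sup>2 \<le> (sqrt (cnorm ?C (\<lambda>z. cnj (f z) * f z)))\<^sup>2"
      by (intro power_mono nonneg f)
    then show "(cnorm ?C f)\<^sup>2 \<le> cnorm ?C (\<lambda>z. cnj (f z) * f z)"
      using nonneg[OF mem] by simp
  qed
  have diff: "cnorm ?C (f \<ominus>\<^bsub>?C\<^esub> g) = dist (Bcontfun f) (Bcontfun g)"
    if "f \<in> carrier ?C" "g \<in> carrier ?C" for f g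
    using that app by (simp add: C_torus_minus) (simp add: C_torus_def dist_bcontfun_def dist_norm)
  have complete: "\<exists>x\<in>carrier ?C. (\<lambda>i. cnorm ?C (X i \<ominus>\<^bsub>?C\<^esub> x)) \<longlonglongrightarrow> 0"
    if X: "\<forall>i::nat. X i \<in> carrier ?C"
      and "\<forall>e>0. \<exists>N. \<forall>i\<ge>N. \<forall>j\<ge>N. cnorm ?C (X i \<ominus>\<^bsub>?C\<^esub> X j) < e" for X
  proof -
    have "Cauchy (\<lambda>i. Bcontfun (X i))" using that diff unfolding Cauchy_def by simp
    then obtain x where x: "(\<lambda>i. Bcontfun (X i)) \<longlonglongrightarrow> x"
      using Cauchy_convergent convergent_def by blast
    have mem: "apply_bcontfun x \<in> carrier ?C" using apply_bcontfun[of x] by (simp add: cont bcontfun_def)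
    have "(\<lambda>i. dist (Bcontfun (X i)) x) \<longlonglongrightarrow> 0" using x by (rule tendsto_dist_iff[THEN iffD1])
    then have "(\<lambda>i. cnorm ?C (X i \<ominus>\<^bsub>?C\<^esub> apply_bcontfun x)) \<longlonglongrightarrow> 0"
      using diff[OF _ mem] X by (simp add: apply_bcontfun_inverse)
    then show ?thesis using mem by blast
  qed
  show ?thesis
  proof (intro unital_cstar_algebra.intro ring_C_torus unital_cstar_algebra_axioms.intro)
    show "cnorm ?C f = 0 \<longleftrightarrow> f = \<zero>\<^bsub>?C\<^esub>" if "f \<in> carrier ?C" for f
      using zero[OF that] by (simp add: C_torus_def)
    show "cnorm ?C (f \<oplus>\<^bsub>?C\<^esub> g) \<le> cnorm ?C f + cnorm ?C g"
      if "f \<in> carrier ?C" "g \<in> carrier ?C" for f g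
      using tri[OF that] by (simp add: C_torus_def)
    show "cnorm ?C (f \<otimes>\<^bsub>?C\<^esub> g) \<le> cnorm ?C f * cnorm ?C g"
      if "f \<in> carrier ?C" "g \<in> carrier ?C" for f g
      using prod[OF that] by (simp add: C_torus_def)
    show "cnorm ?C (cscale ?C a f) = cmod a * cnorm ?C f" if "f \<in> carrier ?C" for a f
      using scale[OF that] by (simp add: C_torus_def)
    show "cnorm ?C (cstar ?C f \<otimes>\<^bsub>?C\<^esub> f) = (cnorm ?C f)\<^sup>2" if "f \<in> carrier ?C" for f
      using star[OF that] by (simp add: C_torus_def)
    show "\<exists>x\<in>carrier ?C. (\<lambda>i. cnorm ?C (X i \<ominus>\<^bsub>?C\<^esub> x)) \<longlonglongrightarrow> 0"
      if "\<forall>i::nat. X i \<in> carrier ?C"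
        and "\<forall>e>0. \<exists>N. \<forall>i\<ge>N. \<forall>j\<ge>N. cnorm ?C (X i \<ominus>\<^bsub>?C\<^esub> X j) < e" for X
      using that by (rule complete)
    show "cscale ?C a f \<in> carrier ?C" "cstar ?C f \<in> carrier ?C" if "f \<in> carrier ?C" for a f
      using sum(3,5)[OF that that] by (simp_all add: C_torus_def)
  qed (simp_all add: C_torus_def distrib_left distrib_right mult_ac)
qed

section \<open>The Toeplitz algebra\<close>

definition bimodule_rep :: "int ^ 'n ^ 'n \<Rightarrow> 'b cstar_struct \<Rightarrow>
    (('n::finite torus \<Rightarrow> complex) \<Rightarrow> 'b) \<Rightarrow> (('n torus \<Rightarrow> complex) \<Rightarrow> 'b) \<Rightarrow> bool" where
  "bimodule_rep A S \<psi> \<pi> \<longleftrightarrow>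
     star_hom C_torus S \<pi> \<and>
     \<psi> \<in> carrier C_torus \<rightarrow> carrier S \<and>
     (\<forall>x\<in>carrier C_torus. \<forall>y\<in>carrier C_torus. \<psi> (\<lambda>z. x z + y z) = \<psi> x \<oplus>\<^bsub>S\<^esub> \<psi> y) \<and>
     (\<forall>a. \<forall>x\<in>carrier C_torus. \<psi> (\<lambda>z. a * x z) = cscale S a (\<psi> x)) \<and>
     (\<forall>f\<in>carrier C_torus. \<forall>x\<in>carrier C_torus. \<forall>g\<in>carrier C_torus.
        \<psi> (\<lambda>z. f z * x z * g (covering A z)) = \<pi> f \<otimes>\<^bsub>S\<^esub> \<psi> x \<otimes>\<^bsub>S\<^esub> \<pi> g) \<and>
     (\<forall>x\<in>carrier C_torus. \<forall>y\<in>carrier C_torus.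
        \<pi> (transfer_op A (\<lambda>z. cnj (x z) * y z)) = cstar S (\<psi> x) \<otimes>\<^bsub>S\<^esub> \<psi> y)"

definition generates_cstar :: "'a::cstar_algebra set \<Rightarrow> bool" where
  "generates_cstar G \<longleftrightarrow>
     (\<forall>X. closed X \<and> G \<subseteq> X \<and>
        (\<forall>x\<in>X. \<forall>y\<in>X. x + y \<in> X \<and> x * y \<in> X) \<and>
        (\<forall>x\<in>X. star x \<in> X \<and> (\<forall>a. a *\<^sub>C x \<in> X)) \<longrightarrow> X = UNIV)"

text \<open>
  The type \<open>'a\<close>, with \<open>iM\<close> and \<open>iC\<close>, is the Toeplitz algebra of the bimodule. The universal property
  is stated for C*-algebras whose carrier is a subset of \<open>'a\<close>. This loses no generality. The
  C*-algebra generated by a representation of the bimodule is separable, hence has at most the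
  cardinality of the continuum, while \<open>'a\<close> is a nonzero complex vector space; so a copy of that
  algebra lives on a subset of \<open>'a\<close>. The homomorphism is unique because \<open>iM\<close> and \<open>iC\<close> generate.
\<close>

definition toeplitz_algebra :: "int ^ 'n ^ 'n \<Rightarrow>
    (('n::finite torus \<Rightarrow> complex) \<Rightarrow> 'a::cstar_algebra) \<Rightarrow> (('n torus \<Rightarrow> complex) \<Rightarrow> 'a) \<Rightarrow> bool" where
  "toeplitz_algebra A iM iC \<longleftrightarrow>
     bimodule_rep A type_cstar iM iC \<and>
     generates_cstar (iM ` carrier C_torus \<union> iC ` carrier C_torus) \<and>
     (\<forall>(S :: 'a cstar_struct) \<psi> \<pi>. unital_cstar_algebra S \<and> bimodule_rep A S \<psi> \<pi> \<longrightarrow>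
        (\<exists>h. star_hom type_cstar S h \<and>
           (\<forall>f\<in>carrier C_torus. h (iM f) = \<psi> f \<and> h (iC f) = \<pi> f)))"

section \<open>Dynamics and KMS states\<close>

definition cstar_dynamics :: "(real \<Rightarrow> 'a::cstar_algebra \<Rightarrow> 'a) \<Rightarrow> bool" where
  "cstar_dynamics \<sigma> \<longleftrightarrow>
     (\<forall>t. star_hom type_cstar type_cstar (\<sigma> t) \<and> bij (\<sigma> t)) \<and>
     (\<forall>s t. \<sigma> (s + t) = \<sigma> s \<circ> \<sigma> t) \<and>
     (\<forall>c. continuous_on UNIV (\<lambda>t. \<sigma> t c))"

definition toeplitz_dynamics :: "(('n::finite torus \<Rightarrow> complex) \<Rightarrow> 'a::cstar_algebra) \<Rightarrow>
    (('n torus \<Rightarrow> complex) \<Rightarrow> 'a) \<Rightarrow> (real \<Rightarrow> 'a \<Rightarrow> 'a) \<Rightarrow> bool" where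
  "toeplitz_dynamics iM iC \<sigma> \<longleftrightarrow> cstar_dynamics \<sigma> \<and>
     (\<forall>t. (\<forall>m. \<sigma> t (iC (torus_char m)) = iC (torus_char m)) \<and>
          \<sigma> t (iM (\<lambda>_. 1)) = cis t *\<^sub>C iM (\<lambda>_. 1))"

definition entire :: "(complex \<Rightarrow> 'a::cstar_algebra) \<Rightarrow> bool" where
  "entire F \<longleftrightarrow> (\<forall>z. \<exists>D. ((\<lambda>h. inverse h *\<^sub>C (F (z + h) - F z)) \<longlongrightarrow> D) (at 0))"

definition entire_extension ::
    "(real \<Rightarrow> 'a::cstar_algebra \<Rightarrow> 'a) \<Rightarrow> 'a \<Rightarrow> (complex \<Rightarrow> 'a) \<Rightarrow> bool" where
  "entire_extension \<sigma> c F \<longleftrightarrow> entire F \<and> (\<forall>t. F (complex_of_real t) = \<sigma> t c)"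

definition analytic_element :: "(real \<Rightarrow> 'a::cstar_algebra \<Rightarrow> 'a) \<Rightarrow> 'a \<Rightarrow> bool" where
  "analytic_element \<sigma> c \<longleftrightarrow> (\<exists>F. entire_extension \<sigma> c F)"

definition cstar_state :: "('a::cstar_algebra \<Rightarrow> complex) \<Rightarrow> bool" where
  "cstar_state \<phi> \<longleftrightarrow> bounded_linear \<phi> \<and> (\<forall>a x. \<phi> (a *\<^sub>C x) = a * \<phi> x) \<and>
     (\<forall>x. \<phi> (star x * x) \<in> \<real>\<^sub>\<ge>\<^sub>0) \<and> onorm \<phi> = 1"

text \<open>Here \<open>F (\<i>\<beta>)\<close> is \<open>\<sigma>\<^bsub>i\<beta>\<^esub>(d)\<close>; the entire extension \<open>F\<close> of \<open>t \<mapsto> \<sigma>\<^sub>t(d)\<close> is unique.\<close>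

definition KMS_states ::
    "(real \<Rightarrow> 'a::cstar_algebra \<Rightarrow> 'a) \<Rightarrow> real \<Rightarrow> ('a \<Rightarrow> complex) set" where
  "KMS_states \<sigma> \<beta> = {\<phi>. cstar_state \<phi> \<and>
     (\<forall>c d F. analytic_element \<sigma> c \<and> entire_extension \<sigma> d F \<longrightarrow>
        \<phi> (d * c) = \<phi> (c * F (\<i> * complex_of_real \<beta>)))}"

definition KMS_topology ::
    "(real \<Rightarrow> 'a::cstar_algebra \<Rightarrow> 'a) \<Rightarrow> real \<Rightarrow> ('a \<Rightarrow> complex) topology" where
  "KMS_topology \<sigma> \<beta> = subtopology (product_topology (\<lambda>_. euclidean) UNIV) (KMS_states \<sigma> \<beta>)"

section \<open>Probability measures\<close>

definition prob_measures :: "'n::finite torus measure set" where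
  "prob_measures = {\<mu>. prob_space \<mu> \<and> sets \<mu> = sets borel}"

definition prob_topology :: "'n::finite torus measure topology" where
  "prob_topology = pullback_topology prob_measures
     (\<lambda>\<mu>. \<lambda>f\<in>carrier C_torus. LINT z|\<mu>. f z)
     (product_topology (\<lambda>_. euclidean :: complex topology) (carrier C_torus))"

definition mixture ::
    "real \<Rightarrow> 'n::finite torus measure \<Rightarrow> 'n torus measure \<Rightarrow> 'n torus measure" where
  "mixture t \<mu> \<nu> = measure_of UNIV (sets borel)
     (\<lambda>E. ennreal t * emeasure \<mu> E + ennreal (1 - t) * emeasure \<nu> E)"

lemma sets_mixture: "sets (mixture t \<mu> \<nu>) = sets borel"
  using sets.sigma_sets_eq[of "borel :: 'a torus measure"] by (simp add: mixture_def)

lemma emeasure_mixture: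
  assumes "\<mu> \<in> prob_measures" "\<nu> \<in> prob_measures" "E \<in> sets borel"
  shows "emeasure (mixture t \<mu> \<nu>) E = ennreal t * emeasure \<mu> E + ennreal (1 - t) * emeasure \<nu> E"
  supply sets_mixture [simp]
proof (rule emeasure_measure_of[OF mixture_def])
  have sets: "sets \<mu> = sets borel" "sets \<nu> = sets borel"
    using assms by (auto simp: prob_measures_def)
  show "countably_additive (sets (mixture t \<mu> \<nu>))
      (\<lambda>E. ennreal t * emeasure \<mu> E + ennreal (1 - t) * emeasure \<nu> E)"
  proof (rule countably_additiveI)
    fix F :: "nat \<Rightarrow> 'a torus set"
    assume F: "range F \<subseteq> sets (mixture t \<mu> \<nu>)" "disjoint_family F"
    then have "range F \<subseteq> sets \<mu>" "range F \<subseteq> sets \<nu>"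
      by (simp_all add: sets)
    then show "(\<Sum>i. ennreal t * emeasure \<mu> (F i) + ennreal (1 - t) * emeasure \<nu> (F i)) =
        ennreal t * emeasure \<mu> (\<Union>i. F i) + ennreal (1 - t) * emeasure \<nu> (\<Union>i. F i)"
      using F(2) by (simp add: suminf_emeasure suminf_add[symmetric])
  qed
qed (use assms in \<open>simp_all add: positive_def\<close>)

text \<open>The map \<open>m \<mapsto> B\<^sup>jm\<close> on \<open>\<int>\<^sup>d\<close>, where \<open>B\<close> is the transpose of \<open>A\<close>.\<close>

definition dual_pow :: "int ^ 'n ^ 'n \<Rightarrow> nat \<Rightarrow> int ^ 'n \<Rightarrow> int ^ 'n::finite" where
  "dual_pow A j = ((\<lambda>m. transpose A *v m) ^^ j)"

end

theory Submission
  imports Defs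
begin

text \<open>
  Write \<open>u\<close>, \<open>v\<close> for the canonical elements of the algebra (below \<open>U\<close>, \<open>V\<close>), \<open>B\<close> for the transpose
  of \<open>A\<close>, and \<open>r = \<bar>det A\<bar> exp (- \<beta>)\<close>, so that \<open>0 < r < 1\<close>. The KMS condition for \<open>d = u\<^sub>m v\<^sup>k\<close>
  and \<open>c = v\<^sup>*\<^sup>l u\<^sub>n\<^sup>*\<close> shows that a KMS functional \<open>\<phi>\<close> vanishes on \<open>u\<^sub>m v\<^sup>k v\<^sup>*\<^sup>l u\<^sub>n\<^sup>*\<close> unless \<open>k = l\<close>, and
  that otherwise its value is a multiple of \<open>\<phi>(u\<^sub>q)\<close> with \<open>m - n = B\<^sup>k q\<close>, or \<open>0\<close> if there is no such \<open>q\<close>.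
  These products span a dense subspace (\<open>polys_dense\<close>), so \<open>\<phi>\<close> is known from the numbers \<open>\<phi>(u\<^sub>p)\<close>.

  The key quantity is
    \<open>fourier \<phi> p = (\<phi>(u\<^sub>p) - r \<phi>(u\<^bsub>B\<^sup>-\<^sup>1p\<^esub>)) / (1 - r)\<close>,
  where the second term is dropped if \<open>p\<close> is not in the range of \<open>B\<close>. Three facts about it carry the
  proof.
  First, it determines \<open>\<phi>\<close>: the difference of two functionals with the same \<open>fourier\<close> shrinks by the
  factor \<open>r\<close> at each application of \<open>B\<^sup>-\<^sup>1\<close> and is bounded, hence is zero (\<open>KMS_eqI_fourier\<close>).
  Secondly, for \<open>\<psi>\<^sub>\<mu>\<close> it is the sequence of Fourier coefficients of \<open>\<mu>\<close>, because the series for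
  \<open>\<psi>\<^sub>\<mu>(u\<^bsub>Bq\<^esub>)\<close> is its term of index \<open>0\<close> plus \<open>r\<close> times the series for \<open>\<psi>\<^sub>\<mu>(u\<^sub>q)\<close>.
  Thirdly, for every positive \<open>\<phi>\<close> it is the sequence of Fourier coefficients of some measure
  (\<open>KMS_fourier_measure\<close>): if \<open>q\<close> runs through representatives of the cosets of \<open>B \<int>\<^sup>d\<close>, the elements
  \<open>u\<^sub>q v v\<^sup>* u\<^sub>q\<^sup>*\<close> are mutually orthogonal projections, and with \<open>Q\<close> the complement of their sum the KMS
  condition gives \<open>\<phi>(Q u\<^sub>p Q) = (1 - r) fourier \<phi> p\<close>. The functional \<open>f \<mapsto> \<phi>(Q f Q)\<close> on \<open>C(\<T>\<^sup>d)\<close> is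
  positive, and the Riesz representation theorem, proved here for compact metric spaces, applies.

  Injectivity, surjectivity and affinity follow at once. The inverse map is continuous since
  \<open>fourier \<phi> p\<close> is a combination of two values of \<open>\<phi>\<close> and trigonometric polynomials are dense in
  \<open>C(\<T>\<^sup>d)\<close>; the map itself is continuous since, after \<open>k\<close> steps of the recursion that defines
  \<open>fourier\<close>, the remainder of \<open>\<psi>\<^sub>\<mu>(u\<^sub>p)\<close> is at most \<open>r\<^sup>k\<close>, uniformly in \<open>\<mu>\<close>.
\<close>

section \<open>Positive functionals on continuous functions\<close>

lemma compact_increasing_cover:
  fixes G :: "nat \<Rightarrow> 'a::topological_space set"
  assumes "compact K" "\<And>n. open (G n)" "mono G" "K \<subseteq> (\<Union>n. G n)"
  shows "\<exists>n. K \<subseteq> G n"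
proof -
  obtain F where F: "finite F" "K \<subseteq> (\<Union>n\<in>F. G n)"
    by (rule compactE_image[of K UNIV G]) (use assms in auto)
  have "G n \<subseteq> G (Max F)" if "n \<in> F" for n
    using F(1) that by (intro monoD[OF assms(3)]) simp
  with F show ?thesis by blast
qed

text \<open>
  Multiples of the distance to the complement, cut off at \<open>1\<close>, increase to the indicator of an open
  set and reach it at each point after finitely many steps.
\<close>

lemma metric_indicator_approximation:
  fixes U :: "'a::metric_space set"
  assumes "open U"
  obtains h :: "nat \<Rightarrow> 'a \<Rightarrow> real" where
    "\<And>n. continuous_on UNIV (h n)" "\<And>n x. 0 \<le> h n x" "\<And>n x. h n x \<le> indicator U x"
    "\<And>x. mono (\<lambda>n. h n x)" "\<And>x. eventually (\<lambda>n. h n x = indicator U x) sequentially"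
proof (cases "U = UNIV")
  case True
  show ?thesis by (rule that[of "\<lambda>_ _. 1"]) (use True in \<open>auto simp: mono_def\<close>)
next
  case False
  define h where "h n x = min 1 (real n * infdist x (- U))" for n x
  have cl: "closed (- U)" "- U \<noteq> {}" using assms False by auto
  have z: "infdist x (- U) = 0" if "x \<notin> U" for x using that by auto
  have p: "infdist x (- U) > 0" if "x \<in> U" for x
    using that cl infdist_pos_not_in_closed[of "- U" x] by auto
  show ?thesis
  proof (rule that[of h])
    show "continuous_on UNIV (h n)" for n unfolding h_def by (intro continuous_intros)
    show "0 \<le> h n x" for n x by (simp add: h_def infdist_nonneg)
    show "h n x \<le> indicator U x" for n x by (auto simp: h_def z indicator_def)
    show "mono (\<lambda>n. h n x)" for x
      unfolding h_def mono_def using infdist_nonneg[of x "- U"]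
      by (intro allI impI min.mono mult_right_mono) auto
    show "eventually (\<lambda>n. h n x = indicator U x) sequentially" for x
    proof (cases "x \<in> U")
      case True
      obtain N :: nat where "1 / infdist x (- U) < N" using reals_Archimedean2 by blast
      then have "1 \<le> real n * infdist x (- U)" if "n \<ge> N" for n
        using p[OF True] that by (simp add: divide_less_eq)
          (smt (verit) of_nat_mono mult_right_mono)
      then have "min 1 (real n * infdist x (- U)) = 1" if "n \<ge> N" for n
        using that by (simp add: min_absorb1)
      then show ?thesis using True by (auto simp: h_def eventually_sequentially)
    qed (simp add: h_def z)
  qed
qed

text \<open>
  The integrals determine the measure of each open set, by dominated convergence; open sets are
  closed under intersection and generate the Borel sets.
\<close>

lemma borel_measure_eqI_integral:
  fixes \<mu> \<nu> :: "'a::metric_space measure"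
  assumes "finite_measure \<mu>" "finite_measure \<nu>" "sets \<mu> = sets borel" "sets \<nu> = sets borel"
    and eq: "\<And>f :: 'a \<Rightarrow> real. continuous_on UNIV f \<Longrightarrow> (\<And>x. 0 \<le> f x \<and> f x \<le> 1) \<Longrightarrow>
      integral\<^sup>L \<mu> f = integral\<^sup>L \<nu> f"
  shows "\<mu> = \<nu>"
proof -
  interpret \<mu>: finite_measure \<mu> by fact
  interpret \<nu>: finite_measure \<nu> by fact
  have "emeasure \<mu> U = emeasure \<nu> U" if U: "open U" for U
  proof -
    obtain h :: "nat \<Rightarrow> 'a \<Rightarrow> real" where h:
      "\<And>n. continuous_on UNIV (h n)" "\<And>n x. 0 \<le> h n x" "\<And>n x. h n x \<le> indicator U x"
      "\<And>x. eventually (\<lambda>n. h n x = indicator U x) sequentially"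
      using metric_indicator_approximation[OF U] by metis
    have lim: "(\<lambda>n. integral\<^sup>L \<rho> (h n)) \<longlonglongrightarrow> measure \<rho> U"
      if "finite_measure \<rho>" "sets \<rho> = sets borel" for \<rho>
    proof -
      interpret \<rho>: finite_measure \<rho> by fact
      have b: "h n x \<le> 1" for n x using h(3)[of n x] by (cases "x \<in> U") auto
      have "(\<lambda>n. integral\<^sup>L \<rho> (h n)) \<longlonglongrightarrow> integral\<^sup>L \<rho> (indicator U)"
      proof (rule integral_dominated_convergence[where w="\<lambda>_. 1"])
        show "h n \<in> borel_measurable \<rho>" for n
          using borel_measurable_continuous_onI[OF h(1)] measurable_cong_sets[OF that(2) refl] by blast
        show "indicator U \<in> borel_measurable \<rho>" using U that(2) by (intro borel_measurable_indicator) simp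
      qed (use h(2,4) b in \<open>auto intro!: tendsto_eventually\<close>)
      then show ?thesis using U that(2) by simp
    qed
    have "integral\<^sup>L \<mu> (h n) = integral\<^sup>L \<nu> (h n)" for n
    proof (rule eq)
      show "0 \<le> h n x \<and> h n x \<le> 1" for x
        using h(2,3)[of n x] by (cases "x \<in> U") auto
    qed fact
    then have "measure \<mu> U = measure \<nu> U"
      using lim[of \<mu>] lim[of \<nu>] assms LIMSEQ_unique by simp
    then show ?thesis by (simp add: \<mu>.emeasure_eq_measure \<nu>.emeasure_eq_measure)
  qed
  then show ?thesis
    using assms
    by (intro measure_eqI_generator_eq[where E="{U. open U}" and \<Omega>=UNIV and A="\<lambda>_. UNIV"])
      (auto simp: Int_stable_def borel_def)
qed

text \<open>
  The Riesz representation theorem. The measure of an open set is the supremum of the functional over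
  the continuous functions below its indicator; Caratheodory's construction extends it.
\<close>

locale positive_functional =
  fixes M :: "('a::metric_space \<Rightarrow> real) \<Rightarrow> real"
  assumes compact: "compact (UNIV :: 'a set)"
    and add: "continuous_on UNIV f \<Longrightarrow> continuous_on UNIV g \<Longrightarrow> M (\<lambda>x. f x + g x) = M f + M g"
    and scale: "continuous_on UNIV f \<Longrightarrow> M (\<lambda>x. c * f x) = c * M f"
    and nonneg: "continuous_on UNIV f \<Longrightarrow> (\<And>x. 0 \<le> f x) \<Longrightarrow> 0 \<le> M f"
begin

lemma diff: "continuous_on UNIV f \<Longrightarrow> continuous_on UNIV g \<Longrightarrow> M (\<lambda>x. f x - g x) = M f - M g"
  using add[of f "\<lambda>x. - 1 * g x"] scale[of g "- 1"] by (simp add: continuous_on_minus)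

lemma monotone:
  assumes "continuous_on UNIV f" "continuous_on UNIV g" "\<And>x. f x \<le> g x"
  shows "M f \<le> M g"
  using diff[OF assms(2,1)] nonneg[of "\<lambda>x. g x - f x"] assms by (simp add: continuous_on_diff)

lemma zero: "M (\<lambda>_. 0) = 0"
  using scale[of "\<lambda>_. 0" 0] by simp

lemma sum:
  assumes "finite I" "\<And>i. i \<in> I \<Longrightarrow> continuous_on UNIV (f i)"
  shows "M (\<lambda>x. \<Sum>i\<in>I. f i x) = (\<Sum>i\<in>I. M (f i))"
  using assms
proof (induction I rule: finite_induct)
  case (insert i I)
  then have "continuous_on UNIV (\<lambda>x. \<Sum>i\<in>I. f i x)" by (intro continuous_on_sum) auto
  with insert show ?case by (simp add: add)
qed (simp add: zero)

lemma add_const: "continuous_on UNIV f \<Longrightarrow> M (\<lambda>x. f x + c) = M f + c * M (\<lambda>_. 1)"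
  using add[of f "\<lambda>_. c * 1"] scale[of "\<lambda>_. 1" c] by simp

lemma one_nonneg: "0 \<le> M (\<lambda>_. 1)" by (rule nonneg) auto

text \<open>
  Vanishing off \<open>U\<close> replaces the usual compact support in \<open>U\<close>: on a compact space, subtracting a small
  constant from \<open>f\<close> and cutting off at \<open>0\<close> turns the former into the latter.
\<close>

definition below :: "'a set \<Rightarrow> ('a \<Rightarrow> real) set" where
  "below U = {f. continuous_on UNIV f \<and> (\<forall>x. 0 \<le> f x \<and> f x \<le> indicator U x)}"

definition content :: "'a set \<Rightarrow> ennreal" where
  "content U = (SUP f\<in>below U. ennreal (M f))"

definition outer :: "'a set \<Rightarrow> ennreal" where
  "outer E = (INF U\<in>{U. open U \<and> E \<subseteq> U}. content U)"

lemma content_upper: "f \<in> below U \<Longrightarrow> ennreal (M f) \<le> content U"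
  unfolding content_def by (rule SUP_upper)

lemma zero_below: "(\<lambda>_. 0) \<in> below U" by (auto simp: below_def)

lemma content_mono: "U \<subseteq> V \<Longrightarrow> content U \<le> content V"
  unfolding content_def below_def
  by (intro SUP_subset_mono) (auto simp: indicator_def split: if_splits, force+)

lemma content_le_one: "content U \<le> ennreal (M (\<lambda>_. 1))"
  unfolding content_def below_def
  by (auto intro!: SUP_least ennreal_leI monotone) (metis indicator_le_1 order.trans)

lemma content_finite: "content U \<noteq> \<infinity>"
  using content_le_one[of U] by (auto simp: top_unique)

lemma content_empty: "content {} = 0"
proof -
  have "below {} = {\<lambda>_. 0}" by (auto simp: below_def fun_eq_iff intro: antisym)
  then show ?thesis by (simp add: content_def zero)
qed

lemma content_approx:
  assumes "0 < e"
  obtains f where "f \<in> below U" "content U \<le> ennreal (M f + e)"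
proof -
  have "\<exists>f\<in>below U. content U \<le> ennreal (M f + e)"
  proof (rule ccontr)
    assume *: "\<not> ?thesis"
    have ge: "0 \<le> M f" if "f \<in> below U" for f using that by (auto simp: below_def intro: nonneg)
    from * have "ennreal (M f) + ennreal e \<le> content U" if "f \<in> below U" for f
      using that assms ge[OF that] by (auto simp: ennreal_plus[symmetric] not_le simp del: ennreal_plus)
    then have "(SUP f\<in>below U. ennreal (M f) + ennreal e) \<le> content U" by (intro SUP_least)
    then have "content U + ennreal e \<le> content U"
      using zero_below[of U] unfolding content_def by (subst (asm) ennreal_SUP_add_left) auto
    then show False using assms content_finite[of U]
      by (cases "content U") (auto simp: ennreal_plus[symmetric] simp del: ennreal_plus)
  qed
  then show ?thesis using that by blast
qed

text \<open>
  A Dini argument: the partial sums of approximations to the indicators of the \<open>U i\<close> eventually exceed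
  \<open>f - e\<close> at each point, hence, by compactness, everywhere at the same stage.
\<close>

lemma content_Union_le:
  assumes "\<And>i::nat. open (U i)"
  shows "content (\<Union>i. U i) \<le> (\<Sum>i. content (U i))"
  unfolding content_def[of "\<Union>i. U i"]
proof (rule SUP_least)
  fix f assume f: "f \<in> below (\<Union>i. U i)"
  have "\<exists>h. (\<forall>n. continuous_on UNIV (h n)) \<and> (\<forall>n x. 0 \<le> h n x) \<and> (\<forall>n x. h n x \<le> indicator (U i) x) \<and>
      (\<forall>x. incseq (\<lambda>n. h n x)) \<and> (\<forall>x. eventually (\<lambda>n. h n x = (indicator (U i) x :: real)) sequentially)" for i
    using metric_indicator_approximation[OF assms[of i]] by metis
  then obtain h :: "nat \<Rightarrow> nat \<Rightarrow> 'a \<Rightarrow> real" where h: "\<And>i n. continuous_on UNIV (h i n)" "\<And>i n x. 0 \<le> h i n x"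
      "\<And>i n x. h i n x \<le> indicator (U i) x" "\<And>i x. incseq (\<lambda>n. h i n x)"
      "\<And>i x. eventually (\<lambda>n. h i n x = indicator (U i) x) sequentially"
    by metis
  define G where "G n x = (\<Sum>i<n. h i n x)" for n x
  have Gc: "continuous_on UNIV (G n)" for n unfolding G_def by (intro continuous_on_sum h)
  have Gm: "G m x \<le> G n x" if "m \<le> n" for m n x
  proof -
    have "G m x \<le> (\<Sum>i<m. h i n x)" unfolding G_def using h(4) that by (intro sum_mono) (auto simp: mono_def)
    also have "\<dots> \<le> G n x" unfolding G_def using h(2) that by (intro sum_mono2) auto
    finally show ?thesis .
  qed
  have fc: "continuous_on UNIV f" and f01: "0 \<le> f x" "f x \<le> indicator (\<Union>i. U i) x" for x
    using f by (auto simp: below_def)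
  show "ennreal (M f) \<le> (\<Sum>i. content (U i))"
  proof (rule ennreal_le_epsilon)
    fix e :: real assume e: "0 < e"
    \<comment> \<open>The functional changes by at most \<open>e\<close> if the constant \<open>?e\<close> is added.\<close>
    let ?e = "e / (M (\<lambda>_. 1) + 1)"
    have e': "?e > 0" "?e * M (\<lambda>_. 1) \<le> e" using e one_nonneg by (auto simp: divide_simps)
    have "\<exists>n. UNIV \<subseteq> {x. f x - ?e < G n x}"
    proof (rule compact_increasing_cover[OF compact])
      show "open {x. f x - ?e < G n x}" for n
        by (intro open_Collect_less continuous_intros fc Gc)
      show "incseq (\<lambda>n. {x. f x - ?e < G n x})"
        by (rule monoI) (use Gm in \<open>auto intro: less_le_trans\<close>)
      show "UNIV \<subseteq> (\<Union>n. {x. f x - ?e < G n x})"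
      proof (intro subsetI)
        fix x
        show "x \<in> (\<Union>n. {x. f x - ?e < G n x})"
        proof (cases "x \<in> (\<Union>i. U i)")
          case True
          then obtain i where i: "x \<in> U i" by auto
          have "eventually (\<lambda>n. h i n x = 1 \<and> n > i) sequentially"
            using h(5)[of i x] eventually_gt_at_top[of i] by eventually_elim (use i in auto)
          then obtain n where n: "h i n x = 1" "n > i" using eventually_happens'[OF sequentially_bot] by blast
          have "h i n x \<le> G n x" unfolding G_def using n h(2) by (intro member_le_sum) auto
          then have "f x - ?e < G n x" using n f01(2)[of x] True e' by simp
          then show ?thesis by blast
        next
          case False
          then have "f x = 0" using f01[of x] by simp
          then have "f x - ?e < G 0 x" using e' by (simp add: G_def)
          then show ?thesis by blast
        qed
      qed
    qed
    then obtain n where n: "\<And>x. f x \<le> G n x + ?e" by (auto simp: subset_eq less_eq_real_def diff_less_eq)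
    have "M f \<le> M (\<lambda>x. G n x + ?e)" by (intro monotone fc continuous_intros Gc n)
    also have "\<dots> \<le> M (G n) + e" using e' by (simp add: add_const Gc)
    also have "M (G n) = (\<Sum>i<n. M (h i n))" unfolding G_def using h(1) by (intro sum) auto
    finally have le: "M f \<le> (\<Sum>i<n. M (h i n)) + e" .
    have hn: "0 \<le> M (h i n)" for i using h by (intro nonneg)
    have "ennreal (M f) \<le> ennreal ((\<Sum>i<n. M (h i n)) + e)" using le by (rule ennreal_leI)
    also have "\<dots> = (\<Sum>i<n. ennreal (M (h i n))) + ennreal e"
      using e hn by (simp add: ennreal_plus sum_nonneg sum_ennreal)
    also have "(\<Sum>i<n. ennreal (M (h i n))) \<le> (\<Sum>i<n. content (U i))"
      using h by (intro sum_mono content_upper) (auto simp: below_def)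
    also have "\<dots> \<le> (\<Sum>i. content (U i))" by (intro sum_le_suminf) auto
    finally show "ennreal (M f) \<le> (\<Sum>i. content (U i)) + ennreal e" by (simp add: add_right_mono)
  qed
qed

lemma outer_open: "open U \<Longrightarrow> outer U = content U"
  unfolding outer_def by (intro antisym INF_lower2[of U] INF_greatest content_mono) auto

lemma outer_mono: "E \<subseteq> F \<Longrightarrow> outer E \<le> outer F"
  unfolding outer_def by (intro INF_superset_mono) auto

lemma outer_approx:
  assumes "0 < e"
  obtains U where "open U" "E \<subseteq> U" "content U \<le> outer E + ennreal e"
proof -
  have fin: "outer E \<noteq> \<infinity>"
    using outer_mono[of E UNIV] content_finite[of UNIV] by (auto simp: outer_open top_unique)
  have "outer E < outer E + ennreal e" using assms fin
    by (cases "outer E") (auto simp: ennreal_plus[symmetric] ennreal_less_iff simp del: ennreal_plus)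
  then obtain U where "open U" "E \<subseteq> U" "content U < outer E + ennreal e"
    unfolding outer_def[of E] INF_less_iff by auto
  then show ?thesis using that by (metis less_imp_le)
qed

lemma outer_Union_le: "outer (\<Union>i::nat. E i) \<le> (\<Sum>i. outer (E i))"
proof (rule ennreal_le_epsilon)
  fix e :: real assume e: "0 < e"
  have "\<exists>U. open U \<and> E i \<subseteq> U \<and> content U \<le> outer (E i) + ennreal (e * (1/2) ^ Suc i)" for i
    using outer_approx[of "e * (1/2) ^ Suc i" "E i"] e by (metis half_gt_zero_iff mult_pos_pos zero_less_divide_1_iff zero_less_numeral zero_less_power)
  then obtain U where U: "\<And>i. open (U i)" "\<And>i. E i \<subseteq> U i"
    "\<And>i. content (U i) \<le> outer (E i) + ennreal (e * (1/2) ^ Suc i)" by metis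
  have "outer (\<Union>i. E i) \<le> outer (\<Union>i. U i)" using U by (intro outer_mono) blast
  also have "\<dots> = content (\<Union>i. U i)" using U by (intro outer_open) auto
  also have "\<dots> \<le> (\<Sum>i. content (U i))" using U by (intro content_Union_le)
  also have "\<dots> \<le> (\<Sum>i. outer (E i) + ennreal (e * (1/2) ^ Suc i))" by (intro suminf_le U) auto
  also have "\<dots> = (\<Sum>i. outer (E i)) + (\<Sum>i. ennreal (e * (1/2) ^ Suc i))" by (intro suminf_add[symmetric]) auto
  also have "(\<Sum>i. ennreal (e * (1/2) ^ Suc i)) = ennreal e"
    using sums_mult[OF power_half_series, of e] e by (intro suminf_ennreal_eq) auto
  finally show "outer (\<Union>i. E i) \<le> (\<Sum>i. outer (E i)) + ennreal e" .
qed

text \<open>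
  If \<open>f\<close> nearly attains the content of \<open>V \<inter> U\<close>, then \<open>V - U\<close> lies in the open set \<open>W\<close> where \<open>f < a\<close>, and
  cutting \<open>f\<close> off below \<open>a\<close> makes room for any function below \<open>W\<close>.
\<close>

lemma content_split:
  assumes "open U" "open V"
  shows "content (V \<inter> U) + outer (V - U) \<le> content V"
proof (rule ennreal_le_epsilon)
  fix e :: real assume e: "0 < e"
  \<comment> \<open>The loss is \<open>a\<close> for each of the two near-optimal functions and \<open>a M(1)\<close> for the cut-off.\<close>
  define a where "a = e / (M (\<lambda>_. 1) + 2)"
  have a: "0 < a" "a * (M (\<lambda>_. 1) + 2) = e" using e one_nonneg by (auto simp: a_def)
  obtain f where f: "f \<in> below (V \<inter> U)" "content (V \<inter> U) \<le> ennreal (M f + a)"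
    using content_approx a by blast
  have fc: "continuous_on UNIV f" and f01: "\<And>x. 0 \<le> f x \<and> f x \<le> indicator (V \<inter> U) x"
    using f by (auto simp: below_def)
  define W where "W = V \<inter> {x. f x < a}"
  have W: "open W" unfolding W_def using fc assms by (intro open_Int open_Collect_less continuous_intros)
  have "f x = 0" if "x \<in> V - U" for x using f01[of x] that by simp
  then have sub: "V - U \<subseteq> W" using a by (auto simp: W_def)
  obtain g where g: "g \<in> below W" "content W \<le> ennreal (M g + a)" using content_approx a by blast
  have gc: "continuous_on UNIV g" and g01: "\<And>x. 0 \<le> g x \<and> g x \<le> indicator W x"
    using g by (auto simp: below_def)
  define f' where "f' x = max 0 (f x - a)" for x
  have f'c: "continuous_on UNIV f'" unfolding f'_def by (intro continuous_intros fc)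
  have "(\<lambda>x. f' x + g x) \<in> below V"
  proof -
    have "f' x + g x \<le> indicator V x \<and> 0 \<le> f' x + g x" for x
    proof -
      have "indicator (V \<inter> U) x \<le> (indicator V x :: real)" "indicator W x \<le> (indicator V x :: real)"
        by (auto simp: W_def indicator_def)
      moreover have "f x < a \<or> g x = 0" using g01[of x] by (cases "f x < a") (auto simp: W_def)
      ultimately show ?thesis using f01[of x] g01[of x] a unfolding f'_def by linarith
    qed
    then show ?thesis using f'c gc by (auto simp: below_def intro: continuous_intros)
  qed
  then have fg: "ennreal (M f' + M g) \<le> content V" using content_upper[of "\<lambda>x. f' x + g x" V] add[OF f'c gc] by simp
  have "M f \<le> M (\<lambda>x. f' x + a)" by (intro monotone fc continuous_intros f'c) (simp add: f'_def)
  then have Mf: "M f \<le> M f' + a * M (\<lambda>_. 1)" by (simp add: add_const f'c)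
  have pos: "0 \<le> M f" "0 \<le> M g" "0 \<le> M f'"
    using f01 g01 fc gc f'c by (auto intro!: nonneg simp: f'_def)
  have "outer (V - U) \<le> content W" using outer_mono[OF sub] outer_open[OF W] by simp
  then have "content (V \<inter> U) + outer (V - U) \<le> ennreal (M f + a) + ennreal (M g + a)"
    using f(2) g(2) by (intro add_mono) auto
  also have "\<dots> = ennreal ((M f + a) + (M g + a))" using pos a by (intro ennreal_plus[symmetric]) auto
  also have "\<dots> \<le> ennreal ((M f' + M g) + e)"
    using Mf a by (intro ennreal_leI) (auto simp: algebra_simps)
  also have "\<dots> = ennreal (M f' + M g) + ennreal e" using pos e by (intro ennreal_plus) auto
  finally show "content (V \<inter> U) + outer (V - U) \<le> content V + ennreal e"
    using fg by (meson add_right_mono order.trans)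
qed

lemma outer_split:
  assumes "open U"
  shows "outer (E \<inter> U) + outer (E - U) = outer E"
proof (rule antisym)
  show "outer (E \<inter> U) + outer (E - U) \<le> outer E"
    unfolding outer_def[of E]
  proof (rule INF_greatest)
    fix V assume V: "V \<in> {V. open V \<and> E \<subseteq> V}"
    have "outer (E \<inter> U) \<le> content (V \<inter> U)"
      using V assms outer_mono[of "E \<inter> U" "V \<inter> U"] outer_open[of "V \<inter> U"]
      by (metis Int_mono mem_Collect_eq open_Int order_refl)
    moreover have "outer (E - U) \<le> outer (V - U)" using V by (intro outer_mono) auto
    ultimately have "outer (E \<inter> U) + outer (E - U) \<le> content (V \<inter> U) + outer (V - U)" by (rule add_mono)
    also have "\<dots> \<le> content V" using V assms by (intro content_split) auto
    finally show "outer (E \<inter> U) + outer (E - U) \<le> content V" .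
  qed
  have "outer (\<Union>i. binaryset (E \<inter> U) (E - U) i) \<le> (\<Sum>i. outer (binaryset (E \<inter> U) (E - U) i))"
    by (rule outer_Union_le)
  moreover have "outer {} = 0" using outer_open[of "{}"] content_empty by simp
  ultimately show "outer E \<le> outer (E \<inter> U) + outer (E - U)"
    by (simp add: UN_binaryset_eq suminf_binaryset_eq Int_Diff_Un)
qed

definition rep_measure :: "'a measure" where
  "rep_measure = measure_of UNIV (sets borel) outer"

lemma measure_space_outer: "measure_space UNIV (sets borel) outer"
proof -
  interpret P: sigma_algebra UNIV "Pow UNIV :: 'a set set" by (rule sigma_algebra_Pow)
  let ?L = "lambda_system UNIV (Pow UNIV) outer"
  have e: "outer {} = 0" using outer_open[of "{}"] content_empty by simp
  have "outer_measure_space (Pow UNIV) outer"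
    unfolding outer_measure_space_def countably_subadditive_def increasing_def positive_def
    using outer_mono outer_Union_le e by auto
  then have L: "measure_space UNIV ?L outer" by (rule P.caratheodory_lemma)
  then have "sigma_algebra UNIV ?L" by (simp add: measure_space_def)
  moreover have "{S. open S} \<subseteq> ?L" using outer_split unfolding P.lambda_system_eq by auto
  ultimately have "sigma_sets UNIV {S :: 'a set. open S} \<subseteq> ?L" by (rule sigma_algebra.sigma_sets_subset)
  then have "sets (borel :: 'a measure) \<subseteq> ?L" by (simp add: borel_def)
  from measure_down[OF L _ this] show ?thesis using sets.sigma_algebra_axioms[of "borel :: 'a measure"] by simp
qed

lemma sets_rep: "sets rep_measure = sets borel"
  using sets.sigma_sets_eq[of "borel :: 'a measure"] by (simp add: rep_measure_def)

lemma emeasure_rep: "E \<in> sets borel \<Longrightarrow> emeasure rep_measure E = outer E"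
  using measure_space_outer sets.sigma_sets_eq[of "borel :: 'a measure"]
  unfolding rep_measure_def measure_space_def
  by (intro emeasure_measure_of_sigma) auto

lemma finite_rep: "finite_measure rep_measure"
proof (rule finite_measureI)
  have "space rep_measure = UNIV" using sets_eq_imp_space_eq[OF sets_rep] by simp
  then show "emeasure rep_measure (space rep_measure) \<noteq> \<infinity>"
    using content_finite by (simp add: emeasure_rep outer_open)
qed

lemma measure_rep_open:
  assumes "open U" shows "ennreal (measure rep_measure U) = content U"
  using finite_measure.emeasure_eq_measure[OF finite_rep, of U] emeasure_rep[of U] outer_open[OF assms] assms
  by simp

lemma measurable_rep: "continuous_on UNIV f \<Longrightarrow> (f :: 'a \<Rightarrow> real) \<in> borel_measurable rep_measure"
  using borel_measurable_continuous_onI[of f] measurable_cong_sets[OF sets_rep refl] by blast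

lemma integrable_rep:
  assumes "continuous_on UNIV (f :: 'a \<Rightarrow> real)"
  shows "integrable rep_measure f"
proof -
  have "bounded (f ` UNIV)" using assms compact by (intro compact_imp_bounded compact_continuous_image) auto
  then obtain B where "\<And>x. norm (f x) \<le> B" by (auto simp: bounded_iff)
  then show ?thesis
    using measurable_rep[OF assms]
    by (intro finite_measure.integrable_const_bound[OF finite_rep, where B=B]) auto
qed

text \<open>
  Slice \<open>f\<close> horizontally into \<open>N\<close> layers of height \<open>1 / N\<close>. Multiplied by \<open>N\<close>, layer \<open>i\<close> lies between the
  indicators of \<open>{f > (i + 1) / N}\<close> and \<open>{f > i / N}\<close>; shifting the index by one costs a total of
  \<open>\<mu>(UNIV) / N\<close>.
\<close>

lemma le_integral_unit:
  assumes f: "continuous_on UNIV f" and f01: "\<And>x. 0 \<le> f x \<and> f x \<le> 1"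
  shows "M f \<le> integral\<^sup>L rep_measure f"
proof (rule field_le_epsilon)
  interpret finite_measure rep_measure by (rule finite_rep)
  let ?m = "measure rep_measure"
  fix e :: real assume e: "0 < e"
  obtain N0 :: nat where N0: "?m UNIV / e < N0" using reals_Archimedean2 by blast
  define N where "N = Suc N0"
  have N: "0 < N" "?m UNIV / N \<le> e"
  proof -
    have "?m UNIV < N0 * e" using N0 e by (simp add: divide_less_eq)
    also have "\<dots> \<le> N * e" using e by (intro mult_right_mono) (auto simp: N_def)
    finally show "?m UNIV / N \<le> e" by (simp add: N_def divide_le_eq mult.commute)
  qed (simp add: N_def)
  define V where "V i = {x. real i / N < f x}" for i
  have V: "open (V i)" for i unfolding V_def by (intro open_Collect_less continuous_intros f)
  have Vb: "V i \<in> sets rep_measure" for i using V sets_rep by simp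
  define g where "g i x = max 0 (min 1 (N * f x - real i))" for i x
  have gc: "continuous_on UNIV (g i)" for i unfolding g_def by (intro continuous_intros f)
  have gle: "g i x \<le> indicator (V i) x" "indicator (V (Suc i)) x \<le> g i x" "0 \<le> g i x" for i x
    using N by (auto simp: g_def V_def indicator_def divide_less_eq mult.commute)
  have fsum: "(\<Sum>i<n. g i x) = min n (N * f x)" for n x
  proof (induction n)
    case (Suc n)
    then show ?case using f01[of x] N by (auto simp: g_def min_def max_def)
  qed (use f01[of x] N in auto)
  have fN: "f x = (1 / N) * (\<Sum>i<N. g i x)" for x
    using f01[of x] N by (simp add: fsum min_def)
  have "M (g i) \<le> ?m (V i)" for i
  proof -
    have "g i \<in> below (V i)" using gc gle by (auto simp: below_def)
    from content_upper[OF this] show ?thesis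
      using measure_rep_open[OF V, of i] by (metis ennreal_le_iff measure_nonneg)
  qed
  moreover have "M f = (1 / N) * (\<Sum>i<N. M (g i))"
  proof -
    have "M f = M (\<lambda>x. (1 / N) * (\<Sum>i<N. g i x))" using fN by presburger
    also have "\<dots> = (1 / N) * M (\<lambda>x. \<Sum>i<N. g i x)" by (intro scale continuous_on_sum gc)
    finally show ?thesis using gc by (simp add: sum)
  qed
  ultimately have "M f \<le> (1 / N) * (\<Sum>i<N. ?m (V i))"
    by (auto intro!: divide_right_mono sum_mono)
  also have "(\<Sum>i<N. ?m (V i)) \<le> ?m UNIV + (\<Sum>i<N. ?m (V (Suc i)))"
  proof -
    have "(\<Sum>i<N. ?m (V i)) \<le> (\<Sum>i<Suc N. ?m (V i))" by simp
    also have "\<dots> = ?m (V 0) + (\<Sum>i<N. ?m (V (Suc i)))" by (rule sum.lessThan_Suc_shift)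
    also have "?m (V 0) \<le> ?m UNIV" using sets_rep by (intro finite_measure_mono) auto
    finally show ?thesis by simp
  qed
  also have "(\<Sum>i<N. ?m (V (Suc i))) \<le> (\<Sum>i<N. integral\<^sup>L rep_measure (g i))"
  proof (rule sum_mono)
    fix i
    have "?m (V (Suc i)) = integral\<^sup>L rep_measure (indicator (V (Suc i)))" using Vb by simp
    also have "\<dots> \<le> integral\<^sup>L rep_measure (g i)"
      using Vb gle by (intro integral_mono integrable_rep[OF gc])
        (auto simp: integrable_indicator_iff less_top[symmetric])
    finally show "?m (V (Suc i)) \<le> integral\<^sup>L rep_measure (g i)" .
  qed
  also have "(1 / N) * (?m UNIV + (\<Sum>i<N. integral\<^sup>L rep_measure (g i))) =
      ?m UNIV / N + integral\<^sup>L rep_measure (\<lambda>x. (1 / N) * (\<Sum>i<N. g i x))"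
    using integrable_rep[OF gc] by (simp add: algebra_simps add_divide_distrib)
  also have "\<dots> = ?m UNIV / N + integral\<^sup>L rep_measure f" using fN by presburger
  finally show "M f \<le> integral\<^sup>L rep_measure f + e"
    using N by (simp add: divide_right_mono)
qed

lemma measure_rep_UNIV: "measure rep_measure UNIV = M (\<lambda>_. 1)"
proof -
  have "content UNIV = ennreal (M (\<lambda>_. 1))"
    using content_le_one content_upper[of "\<lambda>_. 1" UNIV] by (intro antisym) (auto simp: below_def)
  then show ?thesis using measure_rep_open[of UNIV] one_nonneg by simp
qed

text \<open>
  One inequality suffices, since it can be applied to \<open>f\<close> and to \<open>- f\<close>.
\<close>

theorem integral_rep:
  assumes f: "continuous_on UNIV f"
  shows "integral\<^sup>L rep_measure f = M f"
proof -
  interpret finite_measure rep_measure by (rule finite_rep)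
  have sp: "space rep_measure = UNIV" using sets_eq_imp_space_eq[OF sets_rep] by simp
  have le: "M f \<le> integral\<^sup>L rep_measure f" if f: "continuous_on UNIV f" for f
  proof -
    have "bounded (f ` UNIV)" using f compact by (intro compact_imp_bounded compact_continuous_image) auto
    then obtain B0 where B0: "\<And>x. \<bar>f x\<bar> \<le> B0" by (auto simp: bounded_iff)
    define B where "B = max 1 B0"
    have B: "0 < B" "\<bar>f x\<bar> \<le> B" for x using B0[of x] by (auto simp: B_def)
    \<comment> \<open>An affine change of scale reduces to values in the unit interval.\<close>
    let ?g = "\<lambda>x. (1 / (2 * B)) * (f x + B)"
    have fB: "continuous_on UNIV (\<lambda>x. f x + B)" by (intro continuous_intros f)
    have "M ?g \<le> integral\<^sup>L rep_measure ?g"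
    proof (rule le_integral_unit)
      show "0 \<le> ?g x \<and> ?g x \<le> 1" for x using B(1) B(2)[of x] by (auto simp: divide_simps abs_le_iff)
    qed (intro continuous_intros f)
    then have "(1 / (2 * B)) * M (\<lambda>x. f x + B) \<le> (1 / (2 * B)) * integral\<^sup>L rep_measure (\<lambda>x. f x + B)"
      unfolding scale[OF fB] by simp
    then have "M (\<lambda>x. f x + B) \<le> integral\<^sup>L rep_measure (\<lambda>x. f x + B)"
      using B(1) by (simp add: divide_le_cancel)
    then show ?thesis using integrable_rep[OF f] f by (simp add: add_const measure_rep_UNIV sp)
  qed
  have "M (\<lambda>x. - 1 * f x) \<le> integral\<^sup>L rep_measure (\<lambda>x. - 1 * f x)"
    using f by (intro le continuous_intros)
  then show ?thesis using le[OF f] scale[OF f, of "- 1"] by simp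
qed

end

section \<open>Characters of the torus\<close>

lemma norm_Rep_torus [simp]: "cmod (Rep_torus z $ i) = 1"
  using Rep_torus[of z] by simp

lemma Rep_torus_nonzero [simp]: "Rep_torus z $ i \<noteq> 0"
  using norm_Rep_torus[of z i] by (metis norm_zero zero_neq_one)

lemma torus_eqI: "(\<And>i. Rep_torus z $ i = Rep_torus w $ i) \<Longrightarrow> z = w"
  by (simp add: Rep_torus_inject[symmetric] vec_eq_iff)

definition torus_mult :: "'n::finite torus \<Rightarrow> 'n torus \<Rightarrow> 'n torus" where
  "torus_mult z w = Abs_torus (\<chi> i. Rep_torus z $ i * Rep_torus w $ i)"

definition torus_one :: "'n::finite torus" where
  "torus_one = Abs_torus (\<chi> i. 1)"

definition torus_inv :: "'n::finite torus \<Rightarrow> 'n torus" where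
  "torus_inv z = Abs_torus (\<chi> i. cnj (Rep_torus z $ i))"

lemma Rep_torus_mult: "Rep_torus (torus_mult z w) $ i = Rep_torus z $ i * Rep_torus w $ i"
  by (simp add: torus_mult_def Abs_torus_inverse norm_mult)

lemma Rep_torus_one: "Rep_torus torus_one $ i = 1"
  by (simp add: torus_one_def Abs_torus_inverse)

lemma Rep_torus_inv: "Rep_torus (torus_inv z) $ i = cnj (Rep_torus z $ i)"
  by (simp add: torus_inv_def Abs_torus_inverse)

lemma Rep_torus_cnj_mult: "cnj (Rep_torus z $ i) * Rep_torus z $ i = 1"
  using complex_norm_square[of "Rep_torus z $ i"] by (simp add: mult.commute)

lemma torus_mult_inv_cancel:
  "torus_mult (torus_inv z) (torus_mult z w) = w" "torus_mult z (torus_mult (torus_inv z) w) = w"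
  by (rule torus_eqI; simp add: Rep_torus_mult Rep_torus_inv Rep_torus_cnj_mult
      mult.assoc[symmetric] mult.commute[of _ "cnj _"])+

lemma torus_mult_inv: "torus_mult (torus_inv z) z = torus_one"
  by (rule torus_eqI) (simp add: Rep_torus_mult Rep_torus_inv Rep_torus_one Rep_torus_cnj_mult)

lemma torus_char_mult: "torus_char m (torus_mult z w) = torus_char m z * torus_char m w"
  by (simp add: torus_char_def Rep_torus_mult power_int_mult_distrib prod.distrib)

lemma torus_char_one: "torus_char m torus_one = 1"
  by (simp add: torus_char_def Rep_torus_one)

lemma torus_char_zero: "torus_char 0 z = 1"
  by (simp add: torus_char_def)

lemma torus_char_add: "torus_char (m + n) z = torus_char m z * torus_char n z"
  by (simp add: torus_char_def power_int_add prod.distrib)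

lemma norm_torus_char [simp]: "cmod (torus_char m z) = 1"
  by (simp add: torus_char_def prod_norm[symmetric] norm_power_int)

lemma torus_char_cnj_mult: "cnj (torus_char m z) * torus_char m z = 1"
  using complex_norm_square[of "torus_char m z"] by (simp add: mult.commute)

lemma torus_char_uminus: "torus_char (- m) z = cnj (torus_char m z)"
proof -
  have "torus_char (- m) z * torus_char m z = cnj (torus_char m z) * torus_char m z"
    using torus_char_add[of "- m" m z] by (simp add: torus_char_zero torus_char_cnj_mult)
  moreover have "torus_char m z \<noteq> 0" using norm_torus_char[of m z] by (metis norm_zero zero_neq_one)
  ultimately show ?thesis by simp
qed

lemma torus_char_diff: "torus_char (m - n) z = torus_char m z * cnj (torus_char n z)"
  using torus_char_add[of m "- n" z] by (simp add: torus_char_uminus)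

lemma torus_char_axis: "torus_char (axis i 1) z = Rep_torus z $ i"
proof -
  have "torus_char (axis i 1) z = (\<Prod>j\<in>UNIV. if j = i then Rep_torus z $ i else 1)"
    unfolding torus_char_def by (intro prod.cong) (auto simp: axis_def)
  then show ?thesis by simp
qed

lemma continuous_Rep_torus: "continuous_on UNIV (\<lambda>z. Rep_torus z $ i)"
proof -
  have "continuous_on UNIV (Rep_torus :: 'a torus \<Rightarrow> _)"
    by (auto simp: continuous_on_iff dist_torus_def)
  then show ?thesis by (intro continuous_intros)
qed

lemma continuous_torus_char: "continuous_on UNIV (torus_char m)"
  unfolding torus_char_def by (intro continuous_intros continuous_Rep_torus) auto

lemma Rep_covering: "Rep_torus (covering A z) $ i = torus_char (A $ i) z"
  by (simp add: covering_def Abs_torus_inverse)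

lemma covering_mult: "covering A (torus_mult z w) = torus_mult (covering A z) (covering A w)"
  by (rule torus_eqI) (simp add: Rep_covering Rep_torus_mult torus_char_mult)

lemma covering_one: "covering A torus_one = torus_one"
  by (rule torus_eqI) (simp add: Rep_covering torus_char_one Rep_torus_one)

lemma covering_inv: "covering A (torus_inv z) = torus_inv (covering A z)"
  by (rule torus_eqI) (simp add: Rep_covering Rep_torus_inv torus_char_def)

lemma torus_inv_one: "torus_inv torus_one = torus_one"
  by (rule torus_eqI) (simp add: Rep_torus_one Rep_torus_inv)

lemma continuous_covering: "continuous_on UNIV (covering A)"
proof -
  have "continuous_on UNIV (\<lambda>z. Rep_torus (covering A z))"
    by (subst continuous_on_componentwise)
      (auto simp: Basis_vec_def inner_axis Rep_covering intro!: continuous_intros continuous_torus_char)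
  then show ?thesis by (simp add: continuous_on_iff dist_torus_def)
qed

section \<open>The action on the dual lattice\<close>

abbreviation dual :: "int ^ 'n ^ 'n \<Rightarrow> int ^ 'n \<Rightarrow> int ^ 'n::finite" where
  "dual A m \<equiv> transpose A *v m"

lemma dual_nth: "(dual A m) $ i = (\<Sum>j\<in>UNIV. A $ j $ i * m $ j)"
  by (simp only: matrix_vector_mult_def transpose_def) (simp add: mult.commute)

lemma dual_pow_simps:
  "dual_pow A 0 m = m" "dual_pow A (Suc j) m = dual A (dual_pow A j m)"
  by (simp_all add: dual_pow_def fun_eq_iff del: transpose_matrix_vector)

lemma dual_pow_Suc_right: "dual_pow A (Suc j) m = dual_pow A j (dual A m)"
  by (simp only: dual_pow_def funpow_Suc_right o_def)

lemma dual_add: "dual A (m + n) = dual A m + dual A n"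
  by (simp only: matrix_vector_right_distrib)

lemma dual_minus: "dual A (- m) = - dual A m"
  by (simp only: vec_eq_iff dual_nth vector_uminus_component) (simp add: sum_negf)

lemma dual_diff: "dual A (m - n) = dual A m - dual A n"
  using dual_add[of A m "- n"] by (simp only: dual_minus) simp

lemma dual_zero: "dual A 0 = 0" by (simp only: matrix_vector_mult_0_right)

lemma dual_pow_zero: "dual_pow A j 0 = 0"
  by (induction j) (simp_all only: dual_pow_simps dual_zero)

lemma range_dual_sub:
  assumes "m \<in> range (dual A)" "n \<in> range (dual A)"
  shows "m + n \<in> range (dual A)" "m - n \<in> range (dual A)"
proof -
  obtain a b where "m = dual A a" "n = dual A b" using assms by blast
  then have "m + n = dual A (a + b)" "m - n = dual A (a - b)"
    by (simp_all only: dual_add dual_diff)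
  then show "m + n \<in> range (dual A)" "m - n \<in> range (dual A)"
    by (blast intro: range_eqI)+
qed

text \<open>
  In coordinates, \<open>m \<cdot> (A x) = (B m) \<cdot> x\<close>.
\<close>

lemma torus_char_covering: "torus_char m (covering A z) = torus_char (dual A m) z"
proof -
  obtain x where x: "torus_exp x = z" using torus_exp_surj by blast
  have "(\<Sum>i\<in>UNIV. of_int (m $ i) * ((\<chi> i j. real_of_int (A $ i $ j)) *v x) $ i) =
      (\<Sum>i\<in>UNIV. \<Sum>j\<in>UNIV. of_int (A $ i $ j * m $ i) * x $ j)"
    by (simp add: matrix_vector_mult_def sum_distrib_left mult_ac)
  also have "\<dots> = (\<Sum>j\<in>UNIV. \<Sum>i\<in>UNIV. of_int (A $ i $ j * m $ i) * x $ j)" by (rule sum.swap)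
  also have "\<dots> = (\<Sum>j\<in>UNIV. of_int (dual A m $ j) * x $ j)"
    by (simp only: dual_nth of_int_sum sum_distrib_right)
  finally show ?thesis by (simp only: x[symmetric] covering_exp torus_char_exp)
qed

definition real_mat :: "int ^ 'n ^ 'n \<Rightarrow> real ^ 'n ^ 'n" where
  "real_mat A = (\<chi> i j. of_int (A $ i $ j))"

definition real_vec :: "int ^ 'n \<Rightarrow> real ^ 'n" where
  "real_vec m = (\<chi> i. of_int (m $ i))"

lemma real_vec_inject: "real_vec m = real_vec n \<longleftrightarrow> m = n"
  by (simp add: real_vec_def vec_eq_iff)

lemma real_mat_dual: "transpose (real_mat A) *v real_vec m = real_vec (dual A m)"
  by (simp only: vec_eq_iff real_vec_def vec_lambda_beta dual_nth)
    (simp add: matrix_vector_mult_def vector_matrix_mult_def transpose_def real_mat_def mult.commute)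

lemma invertible_real_mat:
  fixes A :: "int ^ 'n ^ 'n::finite"
  assumes "det A \<noteq> 0" shows "invertible (real_mat A)"
proof -
  have "det (real_mat A) = of_int (det A)"
    by (simp add: det_def real_mat_def)
  then show ?thesis using assms by (simp add: invertible_det_nz)
qed

lemma real_mat_inverse:
  fixes A :: "int ^ 'n ^ 'n::finite"
  assumes "det A \<noteq> 0"
  obtains R where "real_mat A ** R = mat 1" "R ** real_mat A = mat 1"
  using invertible_real_mat[OF assms] unfolding invertible_def by blast

lemma inj_dual:
  fixes A :: "int ^ 'n ^ 'n::finite"
  assumes "det A \<noteq> 0" shows "inj (dual A)"
proof (rule injI)
  fix m n assume "dual A m = dual A n"
  then have "transpose (real_mat A) *v real_vec m = transpose (real_mat A) *v real_vec n"
    by (simp only: real_mat_dual)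
  moreover have "invertible (transpose (real_mat A))"
    using invertible_real_mat[OF assms] transpose_invertible by blast
  ultimately show "m = n"
    using inj_matrix_vector_mult[of "transpose (real_mat A)"] by (simp only: real_vec_inject inj_eq)
qed

lemma inj_dual_pow: "det A \<noteq> 0 \<Longrightarrow> inj (dual_pow A j)"
  unfolding dual_pow_def using inj_dual by (rule inj_fn)

lemma surj_covering:
  fixes A :: "int ^ 'n ^ 'n::finite"
  assumes "det A \<noteq> 0" shows "\<exists>w. covering A w = z"
proof -
  obtain x where x: "torus_exp x = z" using torus_exp_surj by blast
  obtain R where "real_mat A ** R = mat 1" using real_mat_inverse[OF assms] by blast
  then have "real_mat A *v (R *v x) = x"
    by (simp add: matrix_vector_mul_assoc)
  then show ?thesis using covering_exp[of A "R *v x"] x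
    by (auto simp: real_mat_def)
qed

lemma cis_2pi_eq_1: "cis (2 * pi * x) = 1 \<Longrightarrow> \<exists>n. x = of_int n"
proof -
  assume "cis (2 * pi * x) = 1"
  then have "cos (2 * pi * x) = 1" by (simp add: complex_eq_iff)
  then obtain n :: int where "2 * pi * x = real_of_int n * 2 * pi" using cos_one_2pi_int by blast
  then show ?thesis by (intro exI[of _ n]) simp
qed

text \<open>
  The columns \<open>x\<close> of the inverse matrix of \<open>A\<close> represent kernel points, so \<open>m \<cdot> x\<close> is an integer for
  each of them. These integers form the vector \<open>p\<close> with \<open>B p = m\<close>.
\<close>

lemma dual_range_if_trivial_on_kernel:
  fixes A :: "int ^ 'n ^ 'n::finite"
  assumes det: "det A \<noteq> 0" and triv: "\<And>k. covering A k = torus_one \<Longrightarrow> torus_char m k = 1"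
  shows "m \<in> range (dual A)"
proof -
  obtain R where inv: "real_mat A ** R = mat 1" "R ** real_mat A = mat 1"
    using real_mat_inverse[OF det] by blast
  have "\<exists>n. (real_vec m v* R) $ j = of_int n" for j
  proof -
    let ?x = "R *v axis j 1"
    have "real_mat A *v ?x = axis j 1" using inv(1) by (simp add: matrix_vector_mul_assoc)
    then have "covering A (torus_exp ?x) = torus_exp (axis j 1)"
      using covering_exp[of A ?x] by (simp add: real_mat_def)
    also have "\<dots> = torus_one"
      by (rule torus_eqI) (simp add: Rep_torus_exp Rep_torus_one axis_def)
    finally have "torus_char m (torus_exp ?x) = 1" by (rule triv)
    then obtain n where n: "(\<Sum>i\<in>UNIV. of_int (m $ i) * ?x $ i) = of_int n"
      unfolding torus_char_exp using cis_2pi_eq_1 by blast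
    have "(\<Sum>i\<in>UNIV. of_int (m $ i) * ?x $ i) = (real_vec m v* R) $ j"
      by (simp add: vector_matrix_mult_def real_vec_def matrix_vector_mult_basis column_def mult.commute)
    with n show ?thesis by auto
  qed
  then obtain p where p: "\<And>j. (real_vec m v* R) $ j = of_int (p j)" by metis
  have "real_vec m v* R = real_vec (\<chi> j. p j)" by (simp add: vec_eq_iff p) (simp add: real_vec_def)
  then have "transpose (real_mat A) *v real_vec (\<chi> j. p j) =
      transpose (real_mat A) *v (transpose R *v real_vec m)" by simp
  also have "\<dots> = transpose (R ** real_mat A) *v real_vec m"
    by (simp only: matrix_vector_mul_assoc matrix_transpose_mul)
  also have "\<dots> = real_vec m" by (simp only: inv transpose_mat matrix_vector_mul_lid)
  finally have "real_vec m = transpose (real_mat A) *v real_vec (\<chi> j. p j)" ..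
  then have "m = dual A (\<chi> j. p j)" by (simp only: real_mat_dual real_vec_inject)
  then show ?thesis by (rule range_eqI)
qed

section \<open>The kernel of the covering and its dual group\<close>

definition covering_kernel :: "int ^ 'n ^ 'n \<Rightarrow> 'n::finite torus set" where
  "covering_kernel A = {k. covering A k = torus_one}"

lemma fibre_eq_coset:
  assumes "covering A w = z"
  shows "bij_betw (torus_mult w) (covering_kernel A) {x. covering A x = z}"
proof (rule bij_betwI[where g="torus_mult (torus_inv w)"])
  have z: "torus_mult (torus_inv z) z = torus_one" by (rule torus_mult_inv)
  have i: "covering A (torus_inv w) = torus_inv z"
    using assms by (simp add: covering_inv)
  show "torus_mult w \<in> covering_kernel A \<rightarrow> {x. covering A x = z}"
    using assms by (auto simp: covering_kernel_def covering_mult intro!: torus_eqI simp: Rep_torus_mult Rep_torus_one)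
  show "torus_mult (torus_inv w) \<in> {x. covering A x = z} \<rightarrow> covering_kernel A"
    using z i by (auto simp: covering_kernel_def covering_mult)
qed (auto simp: torus_mult_inv_cancel)

text \<open>
  A fibre is a coset of the kernel. A character from the range of \<open>B\<close> is constant on it; any other
  character takes a value \<open>\<noteq> 1\<close> at some kernel point, and translation by that point multiplies the sum
  by this value.
\<close>

lemma fibre_char_sum:
  fixes A :: "int ^ 'n ^ 'n::finite"
  assumes det: "det A \<noteq> 0"
  shows "(\<Sum>w\<in>{w. covering A w = z}. torus_char (dual A p) w) =
      of_nat (card (covering_kernel A)) * torus_char p z"
    and "m \<notin> range (dual A) \<Longrightarrow> (\<Sum>w\<in>{w. covering A w = z}. torus_char m w) = 0"
proof -
  obtain w0 where w0: "covering A w0 = z" using surj_covering[OF det] by blast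
  note bij = fibre_eq_coset[OF w0]
  have "(\<Sum>w\<in>{w. covering A w = z}. torus_char (dual A p) w) =
      (\<Sum>w\<in>{w. covering A w = z}. torus_char p z)"
    by (intro sum.cong) (auto simp: torus_char_covering[symmetric] simp del: transpose_matrix_vector)
  then show "(\<Sum>w\<in>{w. covering A w = z}. torus_char (dual A p) w) =
      of_nat (card (covering_kernel A)) * torus_char p z"
    using bij_betw_same_card[OF bij] by simp
  show "(\<Sum>w\<in>{w. covering A w = z}. torus_char m w) = 0" if m: "m \<notin> range (dual A)"
  proof -
    obtain k where k: "covering A k = torus_one" "torus_char m k \<noteq> 1"
      using dual_range_if_trivial_on_kernel[OF det] m by blast
    have ki: "covering A (torus_inv k) = torus_one"
      by (simp add: covering_inv k torus_inv_one)
    let ?F = "{w. covering A w = z}"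
    have one: "torus_mult torus_one x = x" for x :: "'n torus"
      by (rule torus_eqI) (simp add: Rep_torus_mult Rep_torus_one)
    have "bij_betw (torus_mult k) ?F ?F"
      by (rule bij_betwI[where g="torus_mult (torus_inv k)"])
        (auto simp: covering_mult k ki one torus_mult_inv_cancel)
    then have "(\<Sum>w\<in>?F. torus_char m w) = (\<Sum>w\<in>?F. torus_char m (torus_mult k w))"
      by (rule sum.reindex_bij_betw[symmetric])
    also have "\<dots> = torus_char m k * (\<Sum>w\<in>?F. torus_char m w)"
      by (simp add: torus_char_mult sum_distrib_left)
    finally show ?thesis using k(2) by simp
  qed
qed

lemma transfer_op_char:
  fixes A :: "int ^ 'n ^ 'n::finite"
  assumes "det A \<noteq> 0"
  shows "transfer_op A (torus_char (dual A p)) =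
      (\<lambda>z. of_nat (card (covering_kernel A)) / of_int \<bar>det A\<bar> * torus_char p z)"
    and "m \<notin> range (dual A) \<Longrightarrow> transfer_op A (torus_char m) = (\<lambda>_. 0)"
  unfolding transfer_op_def using fibre_char_sum[OF assms] by (auto simp: fun_eq_iff)

lemma kernel_char_eq:
  assumes "p - q \<in> range (dual A)" "k \<in> covering_kernel A"
  shows "torus_char p k = torus_char q k"
proof -
  obtain r where r: "p - q = dual A r" using assms(1) by blast
  have "torus_char p k = torus_char (dual A r) k * torus_char q k"
    using torus_char_add[of "p - q" q k] unfolding r[symmetric] by simp
  also have "torus_char (dual A r) k = 1"
    using assms(2) by (simp add: torus_char_covering[symmetric] covering_kernel_def torus_char_one
        del: transpose_matrix_vector)
  finally show ?thesis by simp
qed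

lemma kernel_char_sum:
  fixes A :: "int ^ 'n ^ 'n::finite"
  assumes "det A \<noteq> 0"
  shows "(\<Sum>k\<in>covering_kernel A. torus_char m k) =
      (if m \<in> range (dual A) then of_nat (card (covering_kernel A)) else 0)"
  using fibre_char_sum[OF assms, where z=torus_one]
  by (auto simp: covering_kernel_def[symmetric] torus_char_one simp del: transpose_matrix_vector)

text \<open>
  Characters at distinct representatives are orthogonal on the kernel. Comparing the square of their
  sum at the trivial point with its sum over the kernel (Bessel's inequality) bounds the number of
  cosets, and summing all values of all these characters in both orders then shows that there are as
  many cosets as kernel points.
\<close>

theorem coset_representatives:
  fixes A :: "int ^ 'n ^ 'n::finite"
  assumes det: "det A \<noteq> 0" and fin: "finite (covering_kernel A)"
  obtains R where "finite R" "card R = card (covering_kernel A)"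
    "\<And>p q. p \<in> R \<Longrightarrow> q \<in> R \<Longrightarrow> p - q \<in> range (dual A) \<Longrightarrow> p = q"
proof -
  let ?B = "range (dual A)" and ?K = "covering_kernel A"
  have zero: "0 \<in> ?B" using dual_zero[of A] by (metis rangeI)
  define rep where "rep m = (SOME m'. m' - m \<in> ?B)" for m
  have rep: "rep m - m \<in> ?B" for m unfolding rep_def by (rule someI[of _ m]) (use zero in simp)
  have rep_eq: "rep m = rep n" if "m - n \<in> ?B" for m n
  proof -
    have "m' - m \<in> ?B \<longleftrightarrow> m' - n \<in> ?B" for m'
      using range_dual_sub(1)[of "m' - m" A "m - n"] range_dual_sub(2)[of "m' - n" A "m - n"] that
      by (auto simp del: transpose_matrix_vector)
    then show ?thesis by (simp only: rep_def)
  qed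
  define R where "R = range rep"
  have repR: "rep p = p" if "p \<in> R" for p
    using that rep_eq[OF rep] by (auto simp: R_def)
  have R: "p = q" if "p \<in> R" "q \<in> R" "p - q \<in> ?B" for p q
    using rep_eq[OF that(3)] repR that by metis
  have bound: "card F \<le> card ?K" if F: "finite F" "F \<subseteq> R" for F
  proof -
    have "(\<Sum>k\<in>?K. (\<Sum>p\<in>F. torus_char p k) * cnj (\<Sum>q\<in>F. torus_char q k)) =
        (\<Sum>k\<in>?K. \<Sum>p\<in>F. \<Sum>q\<in>F. torus_char (p - q) k)"
      by (simp add: sum_product torus_char_diff cnj_sum)
    also have "\<dots> = (\<Sum>p\<in>F. \<Sum>k\<in>?K. \<Sum>q\<in>F. torus_char (p - q) k)" by (rule sum.swap)
    also have "\<dots> = (\<Sum>p\<in>F. \<Sum>q\<in>F. \<Sum>k\<in>?K. torus_char (p - q) k)"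
      by (intro sum.cong refl sum.swap)
    also have "\<dots> = (\<Sum>p\<in>F. \<Sum>q\<in>F. if q = p then of_nat (card ?K) else 0)"
    proof (intro sum.cong refl)
      fix p q assume "p \<in> F" "q \<in> F"
      then have "p - q \<in> ?B \<longleftrightarrow> q = p" using R F zero by (auto simp del: transpose_matrix_vector)
      then show "(\<Sum>k\<in>?K. torus_char (p - q) k) = (if q = p then of_nat (card ?K) else 0)"
        by (simp only: kernel_char_sum[OF det])
    qed
    also have "\<dots> = of_nat (card F * card ?K)" using F by simp
    finally have "(\<Sum>k\<in>?K. complex_of_real ((cmod (\<Sum>p\<in>F. torus_char p k))\<^sup>2)) = of_nat (card F * card ?K)"
      by (simp only: complex_norm_square)
    then have "complex_of_real (\<Sum>k\<in>?K. (cmod (\<Sum>p\<in>F. torus_char p k))\<^sup>2) = complex_of_real (card F * card ?K)"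
      by simp
    then have eq: "(\<Sum>k\<in>?K. (cmod (\<Sum>p\<in>F. torus_char p k))\<^sup>2) = card F * card ?K"
      by (simp only: of_real_eq_iff)
    have "torus_one \<in> ?K" by (simp add: covering_kernel_def covering_one)
    then have "(cmod (\<Sum>p\<in>F. torus_char p torus_one))\<^sup>2 \<le> (\<Sum>k\<in>?K. (cmod (\<Sum>p\<in>F. torus_char p k))\<^sup>2)"
      using fin by (intro member_le_sum) auto
    then have "real (card F) * real (card F) \<le> real (card F) * real (card ?K)"
      unfolding eq by (simp add: torus_char_one power2_eq_square)
    then show ?thesis by (cases "card F = 0") auto
  qed
  have finR: "finite R"
    using finite_if_finite_subsets_card_bdd[of R "card ?K"] bound by blast
  have "of_nat (card R) = (\<Sum>k\<in>?K. if k = torus_one then of_nat (card R) else (0::complex))"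
    using fin by (simp add: covering_kernel_def covering_one)
  also have "\<dots> = (\<Sum>k\<in>?K. \<Sum>p\<in>R. torus_char p k)"
  proof (intro sum.cong refl)
    fix k assume k: "k \<in> ?K"
    show "(if k = torus_one then of_nat (card R) else 0) = (\<Sum>p\<in>R. torus_char p k)"
    proof (cases "k = torus_one")
      case False
      then obtain i where i: "torus_char (axis i 1) k \<noteq> 1"
        using torus_eqI[of k torus_one] by (auto simp: torus_char_axis Rep_torus_one)
      \<comment> \<open>Translation by \<open>axis i 1\<close> permutes the cosets and multiplies the sum by a number \<open>\<noteq> 1\<close>.\<close>
      let ?t = "\<lambda>p. rep (p + axis i 1)"
      have "inj_on ?t R"
      proof (rule inj_onI)
        fix p q assume pq: "p \<in> R" "q \<in> R" "?t p = ?t q"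
        have "?t p - (q + axis i 1) \<in> ?B" unfolding pq(3) by (rule rep)
        from range_dual_sub(2)[OF this rep[of "p + axis i 1"]]
        have "p - q \<in> ?B" by (simp del: transpose_matrix_vector)
        then show "p = q" using R pq by blast
      qed
      moreover have "?t ` R \<subseteq> R" by (auto simp: R_def)
      ultimately have "bij_betw ?t R R"
        using finR by (simp add: bij_betw_def endo_inj_surj)
      then have "(\<Sum>p\<in>R. torus_char p k) = (\<Sum>p\<in>R. torus_char (?t p) k)"
        by (rule sum.reindex_bij_betw[symmetric])
      also have "\<dots> = (\<Sum>p\<in>R. torus_char (p + axis i 1) k)"
        by (intro sum.cong refl kernel_char_eq[OF rep k])
      also have "\<dots> = (\<Sum>p\<in>R. torus_char p k) * torus_char (axis i 1) k"
        by (simp add: torus_char_add sum_distrib_right)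
      finally show ?thesis using i False by simp
    qed (simp add: torus_char_one)
  qed
  also have "\<dots> = (\<Sum>p\<in>R. \<Sum>k\<in>?K. torus_char p k)" by (rule sum.swap)
  also have "\<dots> = (\<Sum>p\<in>R. if p = rep 0 then of_nat (card ?K) else 0)"
  proof (intro sum.cong refl)
    fix p assume p: "p \<in> R"
    have "p \<in> ?B \<longleftrightarrow> p = rep 0"
      using rep[of 0] rep_eq[of p 0] repR[OF p] by (auto simp del: transpose_matrix_vector)
    then show "(\<Sum>k\<in>?K. torus_char p k) = (if p = rep 0 then of_nat (card ?K) else 0)"
      by (simp only: kernel_char_sum[OF det])
  qed
  also have "\<dots> = of_nat (card ?K)" using finR by (simp add: R_def)
  finally have "card R = card ?K" by simp
  with finR R that show ?thesis by blast
qed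

section \<open>Trigonometric polynomials\<close>

text \<open>
  An inductive definition, because statements about trigonometric polynomials are proved one character
  at a time.
\<close>

inductive_set trig_polys :: "('n::finite torus \<Rightarrow> complex) set" where
  char: "torus_char m \<in> trig_polys"
| add: "f \<in> trig_polys \<Longrightarrow> g \<in> trig_polys \<Longrightarrow> (\<lambda>z. f z + g z) \<in> trig_polys"
| scale: "f \<in> trig_polys \<Longrightarrow> (\<lambda>z. c * f z) \<in> trig_polys"

lemma trig_polys_const: "(\<lambda>_. c) \<in> trig_polys"
  using trig_polys.scale[OF trig_polys.char[of 0], of c] by (simp add: torus_char_zero)

lemma trig_polys_continuous: "f \<in> trig_polys \<Longrightarrow> continuous_on UNIV f"
  by (induction rule: trig_polys.induct) (auto intro!: continuous_intros continuous_torus_char)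

lemma trig_polys_mult:
  assumes "f \<in> trig_polys" "g \<in> trig_polys" shows "(\<lambda>z. f z * g z) \<in> trig_polys"
  using assms(1)
proof induction
  case (char m)
  from assms(2) show ?case
  proof induction
    case (char n)
    have "torus_char (m + n) = (\<lambda>z. torus_char m z * torus_char n z)" by (rule ext) (rule torus_char_add)
    then show ?case using trig_polys.char[of "m + n"] by simp
  qed (auto simp: distrib_left mult.left_commute intro: trig_polys.intros)
qed (auto simp: distrib_right mult.assoc intro: trig_polys.intros)

lemma trig_polys_cnj: "f \<in> trig_polys \<Longrightarrow> (\<lambda>z. cnj (f z)) \<in> trig_polys"
proof (induction rule: trig_polys.induct)
  case (char m)
  have "torus_char (- m) = (\<lambda>z. cnj (torus_char m z))" by (rule ext) (rule torus_char_uminus)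
  then show ?case using trig_polys.char[of "- m"] by simp
qed (auto intro: trig_polys.intros)

text \<open>
  The Stone-Weierstrass theorem for the real-valued trigonometric polynomials, which separate points
  because the real and imaginary parts of the coordinates are among them.
\<close>

lemma trig_polys_dense_real:
  fixes f :: "'n::finite torus \<Rightarrow> real"
  assumes "continuous_on UNIV f" "0 < e"
  shows "\<exists>g\<in>trig_polys. \<forall>z. cmod (of_real (f z) - g z) < e"
proof -
  let ?R = "{f :: 'n torus \<Rightarrow> real. (\<lambda>z. complex_of_real (f z)) \<in> trig_polys}"
  have Re_mem: "(\<lambda>z. Re (f z)) \<in> ?R" if "f \<in> trig_polys" for f :: "'n torus \<Rightarrow> complex"
  proof -
    have "(\<lambda>z. (1/2) * (f z + cnj (f z))) \<in> trig_polys"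
      using that by (intro trig_polys.intros trig_polys_cnj)
    also have "(\<lambda>z. (1/2) * (f z + cnj (f z))) = (\<lambda>z. complex_of_real (Re (f z)))"
      by (simp add: complex_add_cnj fun_eq_iff)
    finally show ?thesis by simp
  qed
  interpret function_ring_on ?R UNIV
  proof
    show "continuous_on UNIV f" if "f \<in> ?R" for f
      using trig_polys_continuous[of "\<lambda>z. complex_of_real (f z)"] that continuous_on_Re by fastforce
    show "\<exists>f\<in>?R. f x \<noteq> f y" if xy: "x \<noteq> y" for x y :: "'n torus"
    proof -
      obtain i where "Rep_torus x $ i \<noteq> Rep_torus y $ i" using torus_eqI xy by blast
      then consider "Re (Rep_torus x $ i) \<noteq> Re (Rep_torus y $ i)" | "Im (Rep_torus x $ i) \<noteq> Im (Rep_torus y $ i)"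
        using complex_eqI by blast
      then show ?thesis
      proof cases
        case 1
        then show ?thesis using Re_mem[OF trig_polys.char[of "axis i 1"]]
          by (intro bexI[of _ "\<lambda>z. Re (torus_char (axis i 1) z)"]) (auto simp: torus_char_axis)
      next
        case 2
        then show ?thesis using Re_mem[OF trig_polys.scale[OF trig_polys.char[of "axis i 1"], of \<i>]]
          by (intro bexI[of _ "\<lambda>z. Re (\<i> * torus_char (axis i 1) z)"]) (auto simp: torus_char_axis)
      qed
    qed
  qed (auto intro: trig_polys.add trig_polys_mult trig_polys_const compact_torus)
  obtain g where g: "g \<in> ?R" "\<And>z. \<bar>f z - g z\<bar> < e"
    using Stone_Weierstrass_basic[OF assms] by auto
  then show ?thesis
    by (intro bexI[of _ "\<lambda>z. complex_of_real (g z)"]) (auto simp: of_real_diff[symmetric] simp del: of_real_diff)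
qed

theorem trig_polys_dense:
  assumes "continuous_on UNIV f" "0 < e"
  obtains g where "g \<in> trig_polys" "\<And>z. cmod (f z - g z) < e"
proof -
  obtain g where g: "g \<in> trig_polys" "\<And>z. cmod (of_real (Re (f z)) - g z) < e/2"
    using trig_polys_dense_real[of "\<lambda>z. Re (f z)" "e/2"] assms by (auto intro: continuous_intros)
  obtain h where h: "h \<in> trig_polys" "\<And>z. cmod (of_real (Im (f z)) - h z) < e/2"
    using trig_polys_dense_real[of "\<lambda>z. Im (f z)" "e/2"] assms by (auto intro: continuous_intros)
  have "cmod (f z - (g z + \<i> * h z)) < e" for z
  proof -
    have "f z - (g z + \<i> * h z) = (of_real (Re (f z)) - g z) + \<i> * (of_real (Im (f z)) - h z)"
      by (subst complex_eq[of "f z"]) (simp add: algebra_simps)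
    also have "cmod \<dots> \<le> cmod (of_real (Re (f z)) - g z) + cmod (of_real (Im (f z)) - h z)"
      by (rule order.trans[OF norm_triangle_ineq]) (simp add: norm_mult)
    also have "\<dots> < e" using g(2)[of z] h(2)[of z] by simp
    finally show ?thesis .
  qed
  then show ?thesis using g h by (intro that[of "\<lambda>z. g z + \<i> * h z"]) (auto intro: trig_polys.intros)
qed

section \<open>Elementary facts on C*-algebras\<close>

lemma scaleC_one [simp]: "1 *\<^sub>C x = (x :: 'a::cstar_algebra)"
  using scaleC_of_real[of 1 x] by simp

lemma scaleC_zero_left [simp]: "0 *\<^sub>C x = (0 :: 'a::cstar_algebra)"
  using scaleC_of_real[of 0 x] by simp

lemma scaleC_zero_right [simp]: "c *\<^sub>C 0 = (0 :: 'a::cstar_algebra)"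
  using scaleC_add_right[of c 0 "0 :: 'a"] by simp

lemma scaleC_minus_one: "(- 1) *\<^sub>C x = - (x :: 'a::cstar_algebra)"
  using scaleC_of_real[of "- 1" x] by simp

lemma star_one [simp]: "star 1 = (1 :: 'a::cstar_algebra)"
  using star_mult[of "star 1" "1 :: 'a"] by (simp add: star_star)

lemma star_minus: "star (- x) = - star (x :: 'a::cstar_algebra)"
  using star_scaleC[of "- 1" x] by (simp add: scaleC_minus_one)

lemma star_diff: "star (x - y) = star x - star (y :: 'a::cstar_algebra)"
  using star_add[of x "- y"] by (simp add: star_minus)

lemma star_zero [simp]: "star 0 = (0 :: 'a::cstar_algebra)"
  using star_diff[of 0 "0 :: 'a"] by simp

lemma star_sum: "star (\<Sum>i\<in>I. f i) = (\<Sum>i\<in>I. star (f i :: 'a::cstar_algebra))"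
  by (induction I rule: infinite_finite_induct) (simp_all add: star_add)

lemma star_power: "star (x ^ n) = star (x :: 'a::cstar_algebra) ^ n"
  by (induction n) (simp_all add: star_mult power_commutes)

lemma norm_star: "norm (star x) = norm (x :: 'a::cstar_algebra)"
proof -
  have le: "norm y \<le> norm (star y)" for y :: 'a
  proof (cases "y = 0")
    case False
    have "norm y * norm y \<le> norm (star y) * norm y"
      using cstar_identity[of y] norm_mult_ineq[of "star y" y] by (simp add: power2_eq_square)
    then show ?thesis using False by simp
  qed simp
  show ?thesis using le[of x] le[of "star x"] by (simp add: star_star)
qed

lemma bounded_linear_star: "bounded_linear (star :: 'a::cstar_algebra \<Rightarrow> 'a)"
  by (rule bounded_linear_intro[where K=1])
    (auto simp: star_add norm_star scaleC_of_real[symmetric] star_scaleC)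

lemma bounded_linear_scaleC: "bounded_linear (\<lambda>x :: 'a::cstar_algebra. c *\<^sub>C x)"
  by (rule bounded_linear_intro[where K="cmod c"])
    (auto simp: scaleC_add_right scaleC_of_real[symmetric] scaleC_scaleC norm_scaleC mult.commute)

lemma bounded_linear_scaleC_left: "bounded_linear (\<lambda>c. c *\<^sub>C (x :: 'a::cstar_algebra))"
  by (rule bounded_linear_intro[where K="norm x"])
    (auto simp: scaleC_add_left scaleC_of_real[symmetric] scaleC_scaleC norm_scaleC scaleR_conv_of_real)

lemma closure_closed_under:
  fixes op :: "'a::cstar_algebra \<Rightarrow> 'a \<Rightarrow> 'a"
  assumes S: "\<And>x y. x \<in> S \<Longrightarrow> y \<in> S \<Longrightarrow> op x y \<in> S"
    and lim: "\<And>X Y x y. X \<longlonglongrightarrow> x \<Longrightarrow> Y \<longlonglongrightarrow> y \<Longrightarrow> (\<lambda>n. op (X n) (Y n)) \<longlonglongrightarrow> op x y"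
    and "x \<in> closure S" "y \<in> closure S"
  shows "op x y \<in> closure S"
proof -
  obtain X where X: "\<And>n. X n \<in> S" "X \<longlonglongrightarrow> x" using assms(3) unfolding closure_sequential by blast
  obtain Y where Y: "\<And>n. Y n \<in> S" "Y \<longlonglongrightarrow> y" using assms(4) unfolding closure_sequential by blast
  show ?thesis unfolding closure_sequential
    by (rule exI[of _ "\<lambda>n. op (X n) (Y n)"]) (use S X(1) Y(1) lim[OF X(2) Y(2)] in simp)
qed

text \<open>
  The normal element \<open>z = x + \<i> y\<close> satisfies \<open>z\<^sup>* z = x\<^sup>2 + y\<^sup>2\<close>, so the right side is \<open>(norm z)\<^sup>2\<close>; and
  \<open>x\<close>, the mean of \<open>z\<close> and \<open>z\<^sup>*\<close>, has norm at most \<open>norm z\<close>.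
\<close>

lemma norm_square_le_sum_of_squares:
  fixes x y :: "'a::cstar_algebra"
  assumes x: "star x = x" and y: "star y = y" and xy: "x * y = y * x"
  shows "norm (x * x) \<le> norm (x * x + y * y)"
proof -
  define z where "z = x + \<i> *\<^sub>C y"
  have sz: "star z = x + (- \<i>) *\<^sub>C y" by (simp add: z_def star_add star_scaleC x y)
  have "star z * z = x * x + y * y"
  proof -
    have "star z * z = (x + (- \<i>) *\<^sub>C y) * (x + \<i> *\<^sub>C y)" by (simp only: sz) (simp only: z_def)
    also have "\<dots> = x * x + y * y + (\<i> *\<^sub>C (y * x) + (- \<i>) *\<^sub>C (y * x))"
      by (simp add: distrib_left distrib_right mult_scaleC_left mult_scaleC_right scaleC_scaleC scaleC_add_right xy add_ac)
    finally show ?thesis by (simp add: scaleC_add_left[symmetric])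
  qed
  then have nz: "norm (x * x + y * y) = (norm z)\<^sup>2" using cstar_identity[of z] by simp
  have "z + star z = 2 *\<^sub>R x"
  proof -
    have "z + star z = 2 *\<^sub>R x + (\<i> *\<^sub>C y + (- \<i>) *\<^sub>C y)"
      by (simp only: sz) (simp add: z_def scaleR_2 add_ac)
    then show ?thesis by (simp add: scaleC_add_left[symmetric])
  qed
  then have "2 * norm x \<le> norm z + norm (star z)" using norm_triangle_ineq[of z "star z"] by simp
  then have "norm x \<le> norm z" by (simp add: norm_star)
  then have "(norm x)\<^sup>2 \<le> (norm z)\<^sup>2" by (intro power_mono) auto
  then show ?thesis using cstar_identity[of x] x nz by simp
qed

section \<open>Representations of the bimodule\<close>

lemma carrier_C_torus: "f \<in> carrier C_torus \<longleftrightarrow> continuous_on UNIV f"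
  by (simp add: C_torus_def)

locale bimodule_representation =
  fixes A :: "int ^ 'n ^ 'n::finite"
    and iM iC :: "('n torus \<Rightarrow> complex) \<Rightarrow> 'a::cstar_algebra"
  assumes det: "det A \<noteq> 0"
    and rep: "bimodule_rep A type_cstar iM iC"
begin

definition U :: "int ^ 'n \<Rightarrow> 'a" where "U m = iC (torus_char m)"
definition V :: 'a where "V = iM (\<lambda>_. 1)"

lemma iC_hom: "star_hom C_torus type_cstar iC"
  using rep by (simp add: bimodule_rep_def)

lemma iC_add: "continuous_on UNIV f \<Longrightarrow> continuous_on UNIV g \<Longrightarrow> iC (\<lambda>z. f z + g z) = iC f + iC g"
  using iC_hom by (auto simp: star_hom_def ring_hom_def C_torus_def)

lemma iC_mult: "continuous_on UNIV f \<Longrightarrow> continuous_on UNIV g \<Longrightarrow> iC (\<lambda>z. f z * g z) = iC f * iC g"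
  using iC_hom by (auto simp: star_hom_def ring_hom_def C_torus_def)

lemma iC_one: "iC (\<lambda>_. 1) = 1"
  using iC_hom by (auto simp: star_hom_def ring_hom_def C_torus_def)

lemma iC_scale: "continuous_on UNIV f \<Longrightarrow> iC (\<lambda>z. c * f z) = c *\<^sub>C iC f"
  using iC_hom by (auto simp: star_hom_def ring_hom_def C_torus_def)

lemma iC_star: "continuous_on UNIV f \<Longrightarrow> iC (\<lambda>z. cnj (f z)) = star (iC f)"
  using iC_hom by (auto simp: star_hom_def ring_hom_def C_torus_def)

lemma iC_const: "iC (\<lambda>_. c) = c *\<^sub>C 1"
  using iC_scale[of "\<lambda>_. 1" c] by (simp add: iC_one)

lemma iC_diff: "continuous_on UNIV f \<Longrightarrow> continuous_on UNIV g \<Longrightarrow> iC (\<lambda>z. f z - g z) = iC f - iC g"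
  using iC_add[of f "\<lambda>z. - 1 * g z"] iC_scale[of g "- 1"]
  by (simp add: continuous_on_minus scaleC_minus_one)

lemma iM_bimodule:
  assumes "continuous_on UNIV f" "continuous_on UNIV x" "continuous_on UNIV g"
  shows "iM (\<lambda>z. f z * x z * g (covering A z)) = iC f * iM x * iC g"
  using rep assms by (simp add: bimodule_rep_def carrier_C_torus)

lemma iM_inner:
  assumes "continuous_on UNIV x" "continuous_on UNIV y"
  shows "iC (transfer_op A (\<lambda>z. cnj (x z) * y z)) = star (iM x) * iM y"
  using rep assms by (simp add: bimodule_rep_def carrier_C_torus)

lemma iM_eq: "continuous_on UNIV f \<Longrightarrow> iM f = iC f * V"
  using iM_bimodule[of f "\<lambda>_. 1" "\<lambda>_. 1"] by (simp add: V_def iC_one)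

lemma V_iC:
  assumes "continuous_on UNIV g"
  shows "V * iC g = iC (\<lambda>z. g (covering A z)) * V"
proof -
  have "continuous_on UNIV (\<lambda>z. g (covering A z))"
    using continuous_on_compose2[OF assms continuous_covering] by auto
  then have "iM (\<lambda>z. g (covering A z)) = iC (\<lambda>z. g (covering A z)) * V" by (rule iM_eq)
  moreover have "iM (\<lambda>z. g (covering A z)) = V * iC g"
    using iM_bimodule[of "\<lambda>_. 1" "\<lambda>_. 1" g] assms by (simp add: V_def iC_one)
  ultimately show ?thesis by simp
qed

lemma star_V_iC_V:
  assumes "continuous_on UNIV f" shows "star V * iC f * V = iC (transfer_op A f)"
  using iM_inner[of "\<lambda>_. 1" f] assms iM_eq[OF assms] by (simp add: V_def mult.assoc)

text \<open>
  If \<open>\<bar>f\<bar> \<le> 1\<close>, then \<open>1 = g\<^sup>2 + h\<^sup>2\<close> with \<open>g = \<bar>f\<bar>\<close> and \<open>h = sqrt (1 - g\<^sup>2)\<close>, so the image of \<open>g\<^sup>2\<close> has norm at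
  most \<open>1\<close>; it is \<open>x\<^sup>* x\<close> for the image \<open>x\<close> of \<open>f\<close>.
\<close>

lemma norm_iC_le:
  assumes f: "continuous_on UNIV f" and b: "\<And>z. cmod (f z) \<le> b"
  shows "norm (iC f) \<le> b"
proof -
  have le: "norm (iC f) \<le> 1" if f: "continuous_on UNIV f" and b: "\<And>z. cmod (f z) \<le> 1" for f
  proof -
    define g h where "g = (\<lambda>z. complex_of_real (cmod (f z)))"
      and "h = (\<lambda>z. complex_of_real (sqrt (1 - (cmod (f z))\<^sup>2)))"
    have g: "continuous_on UNIV g" and h: "continuous_on UNIV h"
      unfolding g_def h_def by (intro continuous_intros f)+
    have gh: "continuous_on UNIV (\<lambda>z. g z * g z)" "continuous_on UNIV (\<lambda>z. h z * h z)"
      by (intro continuous_intros g h)+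
    have "star (iC g) = iC g" "star (iC h) = iC h"
      using iC_star[OF g] iC_star[OF h] by (simp_all add: g_def h_def)
    moreover have "iC g * iC h = iC h * iC g"
      using iC_mult[OF g h] iC_mult[OF h g] by (simp add: mult.commute)
    ultimately have "norm (iC g * iC g) \<le> norm (iC g * iC g + iC h * iC h)"
      by (rule norm_square_le_sum_of_squares)
    also have "iC g * iC g + iC h * iC h = iC (\<lambda>z. g z * g z + h z * h z)"
      by (simp only: iC_add[OF gh] iC_mult[OF g g] iC_mult[OF h h])
    also have "(\<lambda>z. g z * g z + h z * h z) = (\<lambda>_. 1)"
    proof
      fix z
      have "(cmod (f z))\<^sup>2 \<le> 1" using b[of z] by (simp add: power_le_one)
      then have "(sqrt (1 - (cmod (f z))\<^sup>2))\<^sup>2 = 1 - (cmod (f z))\<^sup>2" by simp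
      then show "g z * g z + h z * h z = 1"
        by (simp add: g_def h_def power2_eq_square of_real_mult[symmetric] of_real_add[symmetric]
            del: of_real_mult of_real_add)
    qed
    also have "norm (iC (\<lambda>_. 1)) = 1" by (simp add: iC_one)
    also have "iC g * iC g = star (iC f) * iC f"
    proof -
      have "(\<lambda>z. g z * g z) = (\<lambda>z. cnj (f z) * f z)"
        by (simp add: g_def fun_eq_iff complex_norm_square[symmetric] mult.commute[of "cnj _"]
            power2_eq_square[symmetric] of_real_power[symmetric] del: of_real_power)
      then have "iC g * iC g = iC (\<lambda>z. cnj (f z) * f z)" by (simp only: iC_mult[OF g g, symmetric])
      also have "\<dots> = iC (\<lambda>z. cnj (f z)) * iC f" by (intro iC_mult continuous_intros f)
      finally show ?thesis by (simp only: iC_star[OF f])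
    qed
    finally have "(norm (iC f))\<^sup>2 \<le> 1" by (simp only: cstar_identity)
    then show ?thesis by (simp add: power_le_one_iff abs_square_le_1)
  qed
  have b0: "0 \<le> b" using b[of torus_one] norm_ge_zero order.trans by blast
  show ?thesis
  proof (rule field_le_epsilon)
    fix e :: real assume e: "0 < e"
    let ?c = "complex_of_real (1 / (b + e))"
    have c: "cmod ?c = 1 / (b + e)" using b0 e by (simp only: norm_of_real) simp
    have "norm (iC (\<lambda>z. ?c * f z)) \<le> 1"
    proof (rule le)
      show "cmod (?c * f z) \<le> 1" for z
        using b[of z] b0 e by (simp only: norm_mult c) (simp add: divide_le_eq)
    qed (intro continuous_intros f)
    then show "norm (iC f) \<le> b + e" using b0 e
      by (simp only: iC_scale[OF f] norm_scaleC c) (simp add: divide_le_eq)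
  qed
qed

lemma U_add: "U (m + n) = U m * U n"
proof -
  have "torus_char (m + n) = (\<lambda>z. torus_char m z * torus_char n z)" by (rule ext) (rule torus_char_add)
  then show ?thesis unfolding U_def using iC_mult[OF continuous_torus_char continuous_torus_char] by simp
qed

lemma U_zero: "U 0 = 1"
proof -
  have "torus_char (0 :: int ^ 'n) = (\<lambda>_. 1)" by (rule ext) (rule torus_char_zero)
  then show ?thesis by (simp add: U_def iC_one)
qed

lemma star_U: "star (U m) = U (- m)"
proof -
  have "torus_char (- m) = (\<lambda>z. cnj (torus_char m z))" by (rule ext) (rule torus_char_uminus)
  then show ?thesis by (simp add: U_def iC_star[OF continuous_torus_char])
qed

lemma V_U: "V * U m = U (dual A m) * V"
proof -
  have "torus_char (dual A m) = (\<lambda>z. torus_char m (covering A z))"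
    by (rule ext) (rule torus_char_covering[symmetric])
  then show ?thesis unfolding U_def V_iC[OF continuous_torus_char] by (simp only:)
qed

lemma star_V_U: "star V * U (dual A m) = U m * star V"
  using arg_cong[OF V_U[of "- m"], of star]
  by (simp add: star_mult star_U dual_minus del: transpose_matrix_vector)

text \<open>
  The transfer operator averages over fibres with weight \<open>1 / \<bar>det A\<bar>\<close>, so \<open>V\<close> is an isometry exactly if
  the covering has degree \<open>\<bar>det A\<bar>\<close>.
\<close>

lemma star_V_V: "star V * V = (of_nat (card (covering_kernel A)) / of_int \<bar>det A\<bar>) *\<^sub>C 1"
proof -
  have "star V * V = star V * iC (torus_char (dual A 0)) * V"
    using U_zero by (simp only: U_def dual_zero) simp
  also have "\<dots> = iC (\<lambda>z. of_nat (card (covering_kernel A)) / of_int \<bar>det A\<bar> * torus_char 0 z)"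
    unfolding star_V_iC_V[OF continuous_torus_char] transfer_op_char(1)[OF det] ..
  finally show ?thesis by (simp only: torus_char_zero mult_1_right iC_const)
qed

lemma star_V_U_V_zero: "m \<notin> range (dual A) \<Longrightarrow> star V * U m * V = 0"
  unfolding U_def star_V_iC_V[OF continuous_torus_char] transfer_op_char(2)[OF det]
  using iC_const[of 0] by simp

lemma norm_U: "norm (U m) \<le> 1"
  unfolding U_def by (rule norm_iC_le[OF continuous_torus_char]) simp

end

text \<open>
  The degree of the covering is a hypothesis here; \<open>card_covering_kernel\<close> below derives it from the
  normalisation of the KMS states.
\<close>

locale isometric_representation = bimodule_representation A iM iC
  for A :: "int ^ 'n ^ 'n::finite" and iM iC :: "('n torus \<Rightarrow> complex) \<Rightarrow> 'a::cstar_algebra" +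
  assumes degree: "of_nat (card (covering_kernel A)) = \<bar>det A\<bar>"
begin

lemma isometry: "star V * V = 1"
proof -
  have "complex_of_nat (card (covering_kernel A)) = of_int \<bar>det A\<bar>"
    using arg_cong[OF degree, of complex_of_int] by simp
  then show ?thesis using det by (simp add: star_V_V)
qed

lemma isometry_pow: "star V ^ k * V ^ k = 1"
proof (induction k)
  case (Suc k)
  have "star V ^ Suc k * V ^ Suc k = star V ^ k * (star V * V) * V ^ k"
    by (simp add: mult.assoc power_Suc2[of "star V"] del: power_Suc)
      (simp add: mult.assoc)
  with Suc show ?case by (simp add: isometry)
qed simp

lemma V_pow_U: "V ^ k * U m = U (dual_pow A k m) * V ^ k"
proof (induction k)
  case (Suc k)
  have "V ^ Suc k * U m = V * (V ^ k * U m)" by (simp add: mult.assoc)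
  also have "\<dots> = V * U (dual_pow A k m) * V ^ k" by (simp only: Suc mult.assoc)
  also have "\<dots> = U (dual_pow A (Suc k) m) * V ^ Suc k" by (simp only: V_U dual_pow_simps power_Suc mult.assoc)
  finally show ?case .
qed (simp add: dual_pow_simps)

lemma star_V_pow_U: "star V ^ k * U (dual_pow A k m) = U m * star V ^ k"
proof (induction k arbitrary: m)
  case (Suc k)
  have "star V ^ Suc k * U (dual_pow A (Suc k) m) = star V ^ k * (star V * U (dual A (dual_pow A k m)))"
    by (simp only: dual_pow_simps power_Suc2 mult.assoc)
  also have "\<dots> = star V ^ k * U (dual_pow A k m) * star V" by (simp only: star_V_U mult.assoc)
  also have "\<dots> = U m * star V ^ Suc k" by (simp only: Suc power_Suc2 mult.assoc)
  finally show ?case .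
qed (simp add: dual_pow_simps)

lemma compress_U: "star V ^ k * U (dual_pow A k m) * V ^ k = U m"
  by (simp add: star_V_pow_U mult.assoc isometry_pow)

lemma compress_U_zero: "m \<notin> range (dual_pow A k) \<Longrightarrow> star V ^ k * U m * V ^ k = 0"
proof (induction k)
  case (Suc k)
  have eq: "star V ^ Suc k * U m * V ^ Suc k = star V * (star V ^ k * U m * V ^ k) * V"
    by (simp add: mult.assoc power_Suc2[of V] del: power_Suc) (simp add: mult.assoc)
  show ?case
  proof (cases "m \<in> range (dual_pow A k)")
    case True
    then obtain q where q: "m = dual_pow A k q" by blast
    have "q \<notin> range (dual A)"
    proof
      assume "q \<in> range (dual A)"
      then obtain s where "q = dual A s" by blast
      then have "m = dual_pow A (Suc k) s" by (simp only: q dual_pow_Suc_right)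
      with Suc.prems show False by blast
    qed
    then show ?thesis unfolding eq unfolding q compress_U by (rule star_V_U_V_zero)
  qed (simp add: eq Suc.IH del: power_Suc)
qed (simp add: dual_pow_simps)

definition monomial :: "int ^ 'n \<Rightarrow> nat \<Rightarrow> nat \<Rightarrow> int ^ 'n \<Rightarrow> 'a" where
  "monomial m k l n = U m * V ^ k * star V ^ l * star (U n)"

lemma star_monomial: "star (monomial m k l n) = monomial n l k m"
  by (simp add: monomial_def star_mult star_star star_power mult.assoc)

text \<open>
  The inner factor \<open>V\<^sup>*\<^sup>l U p V\<^sup>k\<close> collapses to a character, or to \<open>0\<close>, times the surplus power of \<open>V\<close> or
  \<open>V\<^sup>*\<close>; the character is then moved outwards with the commutation relations.
\<close>

lemma monomial_mult:
  "monomial m k l n * monomial m' k' l' n' = 0 \<or>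
   (\<exists>a b c d. monomial m k l n * monomial m' k' l' n' = monomial a b c d)"
proof -
  define p where "p = m' - n"
  have prod: "monomial m k l n * monomial m' k' l' n' =
      U m * V ^ k * (star V ^ l * U p * V ^ k') * star V ^ l' * star (U n')"
    using U_add[of "- n" m'] by (simp add: monomial_def star_U p_def mult.assoc)
  show ?thesis
  proof (cases "k' \<le> l")
    case True
    then obtain a where l: "l = a + k'" using le_Suc_ex[of k' l] by (auto simp: add.commute)
    have mid: "star V ^ l * U p * V ^ k' = star V ^ a * (star V ^ k' * U p * V ^ k')"
      by (simp add: l power_add mult.assoc)
    show ?thesis
    proof (cases "p \<in> range (dual_pow A k')")
      case True
      then obtain q where q: "p = dual_pow A k' q" by blast
      have "monomial m k l n * monomial m' k' l' n' =
          U m * V ^ k * star V ^ a * (U q * star V ^ l') * star (U n')"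
        unfolding prod mid unfolding q compress_U by (simp add: mult.assoc)
      also have "\<dots> = U m * V ^ k * star V ^ (a + l') * (U (dual_pow A l' q) * U (- n'))"
        unfolding star_V_pow_U[symmetric] by (simp add: mult.assoc power_add star_U)
      also have "\<dots> = monomial m k (a + l') (n' - dual_pow A l' q)"
        by (simp add: monomial_def star_U U_add[symmetric])
      finally show ?thesis by blast
    qed (simp add: prod mid compress_U_zero)
  next
    case False
    then obtain a where k': "k' = l + a" using le_Suc_ex[of l k'] by auto
    have mid: "star V ^ l * U p * V ^ k' = (star V ^ l * U p * V ^ l) * V ^ a"
      by (simp add: k' power_add mult.assoc)
    show ?thesis
    proof (cases "p \<in> range (dual_pow A l)")
      case True
      then obtain q where q: "p = dual_pow A l q" by blast
      have "monomial m k l n * monomial m' k' l' n' =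
          U m * (V ^ k * U q) * V ^ a * star V ^ l' * star (U n')"
        unfolding prod mid unfolding q compress_U by (simp add: mult.assoc)
      also have "\<dots> = monomial (m + dual_pow A k q) (k + a) l' n'"
        unfolding V_pow_U by (simp add: monomial_def U_add power_add mult.assoc)
      finally show ?thesis by blast
    qed (simp add: prod mid compress_U_zero)
  qed
qed

inductive_set polys :: "'a set" where
  monomial: "monomial m k l n \<in> polys"
| add: "x \<in> polys \<Longrightarrow> y \<in> polys \<Longrightarrow> x + y \<in> polys"
| scale: "x \<in> polys \<Longrightarrow> c *\<^sub>C x \<in> polys"

lemma polys_zero: "0 \<in> polys"
  using polys.scale[OF polys.monomial, of 0] by simp

lemma polys_star: "x \<in> polys \<Longrightarrow> star x \<in> polys"
  by (induction rule: polys.induct) (auto simp: star_monomial star_add star_scaleC intro: polys.intros)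

lemma polys_mult:
  assumes "x \<in> polys" "y \<in> polys" shows "x * y \<in> polys"
  using assms(1)
proof induction
  case (monomial m k l n)
  from assms(2) show ?case
  proof induction
    case (monomial m' k' l' n')
    show ?case using monomial_mult[of m k l n m' k' l' n'] polys_zero polys.monomial by metis
  qed (auto simp: distrib_left mult_scaleC_right intro: polys.intros)
qed (auto simp: distrib_right mult_scaleC_left intro: polys.intros)

lemma iC_trig_poly: "f \<in> trig_polys \<Longrightarrow> iC f \<in> polys"
proof (induction rule: trig_polys.induct)
  case (char m)
  show ?case using polys.monomial[of m 0 0 0] by (simp add: monomial_def U_zero U_def[symmetric])
qed (auto simp: iC_add iC_scale trig_polys_continuous intro: polys.intros)

lemma iC_in_closure:
  assumes f: "continuous_on UNIV f" shows "iC f \<in> closure polys"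
  unfolding closure_approachable
proof (intro allI impI)
  fix e :: real assume e: "0 < e"
  obtain g where g: "g \<in> trig_polys" "\<And>z. cmod (f z - g z) < e / 2"
    using trig_polys_dense[OF f, of "e / 2"] e by auto
  have "norm (iC (\<lambda>z. f z - g z)) \<le> e / 2"
    using g by (intro norm_iC_le continuous_intros f trig_polys_continuous) (auto intro: less_imp_le)
  then have "dist (iC g) (iC f) < e"
    using e by (simp add: iC_diff f g trig_polys_continuous dist_norm norm_minus_commute)
  then show "\<exists>y\<in>polys. dist y (iC f) < e" using iC_trig_poly[OF g(1)] by blast
qed

lemma closure_polys_mult: "x \<in> closure polys \<Longrightarrow> y \<in> closure polys \<Longrightarrow> x * y \<in> closure polys"
  by (intro closure_closed_under[where op="\<lambda>x y. x * y"] polys_mult tendsto_mult)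

text \<open>
  Approximating continuous functions uniformly by trigonometric polynomials puts the generators into the
  closure, since \<open>iC\<close> is contractive and \<open>iM f = iC f * V\<close>; the closure is a C*-subalgebra because
  products of monomials are monomials or \<open>0\<close>.
\<close>

theorem polys_dense:
  assumes "generates_cstar (iM ` carrier C_torus \<union> iC ` carrier C_torus)"
  shows "closure polys = UNIV"
proof -
  have V: "V \<in> closure polys"
    using polys.monomial[of 0 1 0 0] closure_subset[of polys] by (auto simp: monomial_def U_zero)
  have "closed (closure polys)" by simp
  moreover have "iM ` carrier C_torus \<union> iC ` carrier C_torus \<subseteq> closure polys"
    using iC_in_closure closure_polys_mult V by (auto simp: carrier_C_torus iM_eq)
  moreover have "x + y \<in> closure polys" if "x \<in> closure polys" "y \<in> closure polys" for x y
    using that by (intro closure_closed_under[where op="\<lambda>x y. x + y"] polys.add tendsto_add)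
  moreover have "star x \<in> closure polys" if "x \<in> closure polys" for x
    using polys_star bounded_linear.tendsto[OF bounded_linear_star]
    by (intro closure_closed_under[where op="\<lambda>x y. star x", OF _ _ that that])
  moreover have "c *\<^sub>C x \<in> closure polys" if "x \<in> closure polys" for x c
    using polys.scale bounded_linear.tendsto[OF bounded_linear_scaleC]
    by (intro closure_closed_under[where op="\<lambda>x y. c *\<^sub>C x", OF _ _ that that])
  ultimately show ?thesis
    using closure_polys_mult
    by (intro assms[unfolded generates_cstar_def, rule_format, of "closure polys"]) auto
qed

end

section \<open>KMS functionals\<close>

text \<open>
  Compared with KMS states, positivity and normalisation are left out, so that linear combinations are
  allowed.
\<close>

definition KMS_functional ::
    "(real \<Rightarrow> 'a::cstar_algebra \<Rightarrow> 'a) \<Rightarrow> real \<Rightarrow> ('a \<Rightarrow> complex) \<Rightarrow> bool" where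
  "KMS_functional \<sigma> \<beta> \<phi> \<longleftrightarrow> bounded_linear \<phi> \<and> (\<forall>a x. \<phi> (a *\<^sub>C x) = a * \<phi> x) \<and>
     (\<forall>c d F. analytic_element \<sigma> c \<and> entire_extension \<sigma> d F \<longrightarrow>
        \<phi> (d * c) = \<phi> (c * F (\<i> * complex_of_real \<beta>)))"

lemma KMS_states_functional: "\<phi> \<in> KMS_states \<sigma> \<beta> \<Longrightarrow> KMS_functional \<sigma> \<beta> \<phi>"
  by (simp add: KMS_states_def KMS_functional_def cstar_state_def)

lemma KMS_functional_bounded_linear: "KMS_functional \<sigma> \<beta> \<phi> \<Longrightarrow> bounded_linear \<phi>"
  by (simp add: KMS_functional_def)

lemma KMS_functional_scaleC: "KMS_functional \<sigma> \<beta> \<phi> \<Longrightarrow> \<phi> (a *\<^sub>C x) = a * \<phi> x"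
  by (simp add: KMS_functional_def)

lemma KMS_functional_linear:
  assumes "KMS_functional \<sigma> \<beta> \<phi>"
  shows "\<phi> (x + y) = \<phi> x + \<phi> y" "\<phi> (x - y) = \<phi> x - \<phi> y" "\<phi> 0 = 0"
    "\<phi> (\<Sum>i\<in>I. f i) = (\<Sum>i\<in>I. \<phi> (f i))"
proof -
  interpret bounded_linear \<phi> by (rule KMS_functional_bounded_linear[OF assms])
  show "\<phi> (x + y) = \<phi> x + \<phi> y" "\<phi> (x - y) = \<phi> x - \<phi> y" "\<phi> 0 = 0"
    "\<phi> (\<Sum>i\<in>I. f i) = (\<Sum>i\<in>I. \<phi> (f i))" by (simp_all add: add diff zero sum)
qed

lemma KMS_functional_combination:
  assumes "KMS_functional \<sigma> \<beta> \<phi>" "KMS_functional \<sigma> \<beta> \<phi>'"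
  shows "KMS_functional \<sigma> \<beta> (\<lambda>x. a * \<phi> x + b * \<phi>' x)"
  using assms unfolding KMS_functional_def
  by (auto intro!: bounded_linear_add bounded_linear_const_mult simp: algebra_simps)

lemma entire_exponential: "entire (\<lambda>z. exp (\<i> * a * z) *\<^sub>C c)"
  unfolding entire_def
proof (intro allI exI)
  fix z
  have "((\<lambda>z. exp (\<i> * a * z)) has_field_derivative \<i> * a * exp (\<i> * a * z)) (at z)"
    by (auto intro!: derivative_eq_intros)
  then have "((\<lambda>h. (exp (\<i> * a * (z + h)) - exp (\<i> * a * z)) / h) \<longlongrightarrow> \<i> * a * exp (\<i> * a * z)) (at 0)"
    by (simp add: DERIV_def)
  then have "((\<lambda>h. ((exp (\<i> * a * (z + h)) - exp (\<i> * a * z)) / h) *\<^sub>C c) \<longlongrightarrow>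
      (\<i> * a * exp (\<i> * a * z)) *\<^sub>C c) (at 0)"
    by (rule bounded_linear.tendsto[OF bounded_linear_scaleC_left])
  moreover have "((exp (\<i> * a * (z + h)) - exp (\<i> * a * z)) / h) *\<^sub>C c =
      inverse h *\<^sub>C (exp (\<i> * a * (z + h)) *\<^sub>C c - exp (\<i> * a * z) *\<^sub>C c)" for h
  proof -
    have "exp (\<i> * a * (z + h)) *\<^sub>C c - exp (\<i> * a * z) *\<^sub>C c =
        (exp (\<i> * a * (z + h)) - exp (\<i> * a * z)) *\<^sub>C c"
      using scaleC_add_left[of "exp (\<i> * a * (z + h)) - exp (\<i> * a * z)" "exp (\<i> * a * z)" c] by simp
    then show ?thesis by (simp add: scaleC_scaleC divide_inverse mult.commute)
  qed
  ultimately show "((\<lambda>h. inverse h *\<^sub>C (exp (\<i> * a * (z + h)) *\<^sub>C c - exp (\<i> * a * z) *\<^sub>C c))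
      \<longlongrightarrow> (\<i> * a * exp (\<i> * a * z)) *\<^sub>C c) (at 0)" by simp
qed

definition geometric_ratio :: "int ^ 'n ^ 'n \<Rightarrow> real \<Rightarrow> real" where
  "geometric_ratio A \<beta> = real_of_int \<bar>det A\<bar> * exp (- \<beta>)"

lemma geometric_ratio_pos: "det A \<noteq> 0 \<Longrightarrow> 0 < geometric_ratio A \<beta>"
  by (simp add: geometric_ratio_def)

lemma geometric_ratio_less_1:
  assumes "det A \<noteq> 0" "\<beta> > ln (real_of_int \<bar>det A\<bar>)"
  shows "geometric_ratio A \<beta> < 1"
proof -
  have "real_of_int \<bar>det A\<bar> = exp (ln (real_of_int \<bar>det A\<bar>))" using assms(1) by simp
  also have "\<dots> < exp \<beta>" using assms(2) by simp
  finally show ?thesis by (simp add: geometric_ratio_def exp_minus field_simps)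
qed

locale dynamical_representation = bimodule_representation A iM iC
  for A :: "int ^ 'n ^ 'n::finite" and iM iC :: "('n torus \<Rightarrow> complex) \<Rightarrow> 'a::cstar_algebra" +
  fixes \<sigma> :: "real \<Rightarrow> 'a \<Rightarrow> 'a"
  assumes dynamics: "toeplitz_dynamics iM iC \<sigma>"
begin

lemma \<sigma>_hom:
  shows "\<sigma> t (x + y) = \<sigma> t x + \<sigma> t y" "\<sigma> t (x * y) = \<sigma> t x * \<sigma> t y" "\<sigma> t 1 = 1"
    "\<sigma> t (a *\<^sub>C x) = a *\<^sub>C \<sigma> t x" "\<sigma> t (star x) = star (\<sigma> t x)"
  using dynamics by (auto simp: toeplitz_dynamics_def cstar_dynamics_def star_hom_def ring_hom_def)

text \<open>
  The spectral subspaces of the dynamics: on these elements \<open>\<sigma>\<^sub>t\<close> is multiplication by \<open>e\<^bsup>ist\<^esup>\<close>, so \<open>\<sigma>\<^bsub>i\<beta>\<^esub>\<close>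
  is multiplication by \<open>e\<^bsup>-s\<beta>\<^esup>\<close>.
\<close>

definition homogeneous :: "int \<Rightarrow> 'a \<Rightarrow> bool" where
  "homogeneous s c \<longleftrightarrow> (\<forall>t. \<sigma> t c = cis (of_int s * t) *\<^sub>C c)"

lemma homogeneous_U: "homogeneous 0 (U m)"
  using dynamics by (simp add: homogeneous_def U_def toeplitz_dynamics_def)

lemma homogeneous_V: "homogeneous 1 V"
  using dynamics by (simp add: homogeneous_def V_def toeplitz_dynamics_def)

lemma homogeneous_one: "homogeneous 0 1"
  by (simp add: homogeneous_def \<sigma>_hom)

lemma homogeneous_add: "homogeneous s x \<Longrightarrow> homogeneous s y \<Longrightarrow> homogeneous s (x + y)"
  by (simp add: homogeneous_def \<sigma>_hom scaleC_add_right)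

lemma homogeneous_scale: "homogeneous s x \<Longrightarrow> homogeneous s (a *\<^sub>C x)"
  by (simp add: homogeneous_def \<sigma>_hom scaleC_scaleC mult.commute)

lemma homogeneous_zero: "homogeneous s 0"
  using \<sigma>_hom(4)[of _ 0 0] by (simp add: homogeneous_def)

lemma homogeneous_sum: "(\<And>i. i \<in> I \<Longrightarrow> homogeneous s (f i)) \<Longrightarrow> homogeneous s (\<Sum>i\<in>I. f i)"
proof (induction I rule: infinite_finite_induct)
  case (insert i I)
  then show ?case by (simp add: homogeneous_add)
qed (simp_all add: homogeneous_zero)

lemma homogeneous_mult: "homogeneous s x \<Longrightarrow> homogeneous s' y \<Longrightarrow> homogeneous (s + s') (x * y)"
  by (simp add: homogeneous_def \<sigma>_hom mult_scaleC_left mult_scaleC_right scaleC_scaleC cis_mult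
      algebra_simps)

lemma homogeneous_star: "homogeneous s x \<Longrightarrow> homogeneous (- s) (star x)"
  by (simp add: homogeneous_def \<sigma>_hom star_scaleC cis_cnj)

lemma homogeneous_power: "homogeneous s x \<Longrightarrow> homogeneous (int k * s) (x ^ k)"
proof (induction k)
  case (Suc k)
  then show ?case using homogeneous_mult[of s x "int k * s" "x ^ k"] by (simp add: algebra_simps)
qed (simp add: homogeneous_one)

lemma homogeneous_entire:
  assumes "homogeneous s c"
  shows "entire_extension \<sigma> c (\<lambda>z. exp (\<i> * of_int s * z) *\<^sub>C c)"
  unfolding entire_extension_def
  using entire_exponential assms by (simp add: homogeneous_def cis_conv_exp mult.assoc)

lemma KMS_swap:
  assumes "KMS_functional \<sigma> \<beta> \<phi>" "homogeneous s d" "homogeneous s' c"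
  shows "\<phi> (d * c) = of_real (exp (- (of_int s * \<beta>))) * \<phi> (c * d)"
proof -
  have "\<phi> (d * c) = \<phi> (c * (exp (\<i> * of_int s * (\<i> * of_real \<beta>)) *\<^sub>C d))"
    using assms homogeneous_entire[OF assms(2)] homogeneous_entire[OF assms(3)]
    unfolding KMS_functional_def analytic_element_def by blast
  also have "\<i> * of_int s * (\<i> * of_real \<beta>) = complex_of_real (- (of_int s * \<beta>))"
    by (simp add: complex_eq_iff)
  finally show ?thesis
    by (simp only: mult_scaleC_right KMS_functional_scaleC[OF assms(1)] exp_of_real)
qed

lemma KMS_homogeneous_zero:
  assumes "KMS_functional \<sigma> \<beta> \<phi>" "homogeneous s x" "s \<noteq> 0" "\<beta> \<noteq> 0"
  shows "\<phi> x = 0"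
proof -
  have "\<phi> x = of_real (exp (- (of_int s * \<beta>))) * \<phi> x"
    using KMS_swap[OF assms(1,2) homogeneous_one] by simp
  moreover have "exp (- (of_int s * \<beta>)) \<noteq> 1" using assms(3,4) by simp
  then have "complex_of_real (exp (- (of_int s * \<beta>))) \<noteq> 1" by (metis of_real_1 of_real_eq_iff)
  ultimately show ?thesis by (metis mult_cancel_right1)
qed

lemma KMS_V_star_V:
  assumes "KMS_functional \<sigma> \<beta> \<phi>"
  shows "\<phi> (V * star V) = of_real (exp (- \<beta>)) * \<phi> (star V * V)"
  using KMS_swap[OF assms homogeneous_V homogeneous_star[OF homogeneous_V]] by simp

end

locale toeplitz_system = dynamical_representation A iM iC \<sigma> + isometric_representation A iM iC
  for A :: "int ^ 'n ^ 'n::finite" and iM iC :: "('n torus \<Rightarrow> complex) \<Rightarrow> 'a::cstar_algebra"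
    and \<sigma> :: "real \<Rightarrow> 'a \<Rightarrow> 'a" +
  fixes \<beta> :: real
  assumes generates: "generates_cstar (iM ` carrier C_torus \<union> iC ` carrier C_torus)"
    and \<beta>: "\<beta> > ln (real_of_int \<bar>det A\<bar>)"
begin

abbreviation r :: real where "r \<equiv> geometric_ratio A \<beta>"

lemma \<beta>_pos: "0 < \<beta>"
proof -
  have "1 \<le> real_of_int \<bar>det A\<bar>" using det by linarith
  then show ?thesis using \<beta> ln_ge_zero[of "real_of_int \<bar>det A\<bar>"] by linarith
qed

lemma r_pos: "0 < r"
  using det by (rule geometric_ratio_pos)

lemma r_less_1: "r < 1"
  using det \<beta> by (rule geometric_ratio_less_1)

definition descend :: "('a \<Rightarrow> complex) \<Rightarrow> int ^ 'n \<Rightarrow> complex" where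
  "descend \<phi> p = (if p \<in> range (dual A) then \<phi> (U (inv_into UNIV (dual A) p)) else 0)"

text \<open>
  For \<open>\<phi> = \<psi>\<^sub>\<mu>\<close> the value at \<open>U p\<close> is \<open>(1 - r)\<close> times the sum of the \<open>r\<^sup>j \<integral> z\<^bsup>B\<^sup>-\<^sup>jp\<^esup> d\<mu>\<close>. One step with \<open>B\<^sup>-\<^sup>1\<close>
  shifts this series, so the difference below isolates the term of index \<open>0\<close>.
\<close>

definition fourier :: "('a \<Rightarrow> complex) \<Rightarrow> int ^ 'n \<Rightarrow> complex" where
  "fourier \<phi> p = (\<phi> (U p) - of_real r * descend \<phi> p) / of_real (1 - r)"

lemma descend_dual: "descend \<phi> (dual A q) = \<phi> (U q)"
  using inv_f_f[OF inj_dual[OF det], of q] by (simp only: descend_def rangeI if_True)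

lemma descend_not: "p \<notin> range (dual A) \<Longrightarrow> descend \<phi> p = 0"
  by (simp only: descend_def if_False)

lemma fourier_recursion: "\<phi> (U p) = of_real (1 - r) * fourier \<phi> p + of_real r * descend \<phi> p"
  using r_less_1 by (simp add: fourier_def)

lemma fourier_combination:
  "fourier (\<lambda>x. a * \<phi> x + b * \<phi>' x) p = a * fourier \<phi> p + b * fourier \<phi>' p"
proof -
  have "descend (\<lambda>x. a * \<phi> x + b * \<phi>' x) p = a * descend \<phi> p + b * descend \<phi>' p"
    by (cases "p \<in> range (dual A)") (simp_all only: descend_def if_True if_False mult_zero_right add_0)
  then show ?thesis by (simp add: fourier_def add_divide_distrib[symmetric] algebra_simps)
qed

lemma fourier_zero: "KMS_functional \<sigma> \<beta> \<phi> \<Longrightarrow> fourier \<phi> 0 = \<phi> 1"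
  using descend_dual[of \<phi> 0] r_less_1
  by (simp only: dual_zero) (simp add: fourier_def U_zero divide_simps, simp add: algebra_simps)

lemma KMS_compress:
  assumes "KMS_functional \<sigma> \<beta> \<phi>"
  shows "\<phi> (star V * U p * V) = descend \<phi> p"
proof (cases "p \<in> range (dual A)")
  case True
  then obtain q where q: "p = dual A q" by blast
  show ?thesis unfolding q descend_dual star_V_U
    by (simp add: mult.assoc isometry)
next
  case False
  show ?thesis
    unfolding star_V_U_V_zero[OF False] descend_not[OF False] by (rule KMS_functional_linear(3)[OF assms])
qed

text \<open>
  Move \<open>U m V\<^sup>k\<close> past the rest of the product with the KMS condition.
\<close>

lemma KMS_monomial:
  assumes \<phi>: "KMS_functional \<sigma> \<beta> \<phi>"
  shows "\<phi> (monomial m k l n) =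
    (if k = l then of_real (exp (- (real k * \<beta>))) * \<phi> (star V ^ k * U (m - n) * V ^ k) else 0)"
proof -
  have h1: "homogeneous (int k) (U m * V ^ k)"
    using homogeneous_mult[OF homogeneous_U homogeneous_power[OF homogeneous_V]] by simp
  have h2: "homogeneous (- int l) (star V ^ l * star (U n))"
    using homogeneous_mult[OF homogeneous_power[OF homogeneous_star[OF homogeneous_V]]
        homogeneous_star[OF homogeneous_U]] by simp
  have eq: "monomial m k l n = (U m * V ^ k) * (star V ^ l * star (U n))"
    by (simp add: monomial_def mult.assoc)
  show ?thesis
  proof (cases "k = l")
    case True
    have "star (U n) * U m = U (m - n)" using U_add[of "- n" m] by (simp add: star_U)
    then have "star V ^ l * star (U n) * (U m * V ^ k) = star V ^ k * U (m - n) * V ^ k"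
      using True by (metis mult.assoc)
    then show ?thesis using KMS_swap[OF \<phi> h1 h2] True eq by simp
  next
    case False
    then show ?thesis
      using KMS_homogeneous_zero[OF \<phi> homogeneous_mult[OF h1 h2]] \<beta>_pos eq by simp
  qed
qed

lemma bounded_linear_eqI_polys:
  fixes \<phi> \<phi>' :: "'a \<Rightarrow> complex"
  assumes "bounded_linear \<phi>" "bounded_linear \<phi>'" "\<And>x. x \<in> polys \<Longrightarrow> \<phi> x = \<phi>' x"
  shows "\<phi> = \<phi>'"
proof -
  have "closed {x. \<phi> x = \<phi>' x}"
    using assms(1,2) by (intro closed_Collect_eq linear_continuous_on)
  moreover have "polys \<subseteq> {x. \<phi> x = \<phi>' x}" using assms(3) by blast
  ultimately have "closure polys \<subseteq> {x. \<phi> x = \<phi>' x}" by (simp add: closure_minimal)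
  then show ?thesis using polys_dense[OF generates] by auto
qed

lemma KMS_eqI_U:
  assumes \<phi>: "KMS_functional \<sigma> \<beta> \<phi>" and \<phi>': "KMS_functional \<sigma> \<beta> \<phi>'"
    and eq: "\<And>p. \<phi> (U p) = \<phi>' (U p)"
  shows "\<phi> = \<phi>'"
proof (rule bounded_linear_eqI_polys)
  have compress: "\<phi> (star V ^ k * U p * V ^ k) = \<phi>' (star V ^ k * U p * V ^ k)" for k p
  proof (cases "p \<in> range (dual_pow A k)")
    case True
    then show ?thesis using eq compress_U by auto
  next
    case False
    then show ?thesis
      by (simp add: compress_U_zero KMS_functional_linear(3)[OF \<phi>] KMS_functional_linear(3)[OF \<phi>'])
  qed
  show "\<phi> x = \<phi>' x" if "x \<in> polys" for x
    using that
  proof induction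
    case (monomial m k l n)
    show ?case by (simp add: KMS_monomial[OF \<phi>] KMS_monomial[OF \<phi>'] compress)
  qed (auto simp: KMS_functional_linear[OF \<phi>] KMS_functional_linear[OF \<phi>']
      KMS_functional_scaleC[OF \<phi>] KMS_functional_scaleC[OF \<phi>'])
qed (use \<phi> \<phi>' in \<open>auto intro: KMS_functional_bounded_linear\<close>)

lemma KMS_bound_U:
  assumes "KMS_functional \<sigma> \<beta> \<phi>"
  shows "cmod (\<phi> (U p)) \<le> onorm \<phi>"
proof -
  have "cmod (\<phi> (U p)) \<le> onorm \<phi> * norm (U p)"
    by (rule onorm[OF KMS_functional_bounded_linear[OF assms]])
  also have "\<dots> \<le> onorm \<phi> * 1"
    by (intro mult_left_mono norm_U onorm_pos_le[OF KMS_functional_bounded_linear[OF assms]])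
  finally show ?thesis by simp
qed

text \<open>
  The difference \<open>\<phi>(U p) - \<phi>'(U p)\<close> is \<open>r\<close> times the same difference at \<open>B\<^sup>-\<^sup>1 p\<close>, or is \<open>0\<close>. Iterating \<open>k\<close>
  times bounds it by \<open>r\<^sup>k\<close> times a constant.
\<close>

theorem KMS_eqI_fourier:
  assumes \<phi>: "KMS_functional \<sigma> \<beta> \<phi>" and \<phi>': "KMS_functional \<sigma> \<beta> \<phi>'"
    and eq: "\<And>p. fourier \<phi> p = fourier \<phi>' p"
  shows "\<phi> = \<phi>'"
proof (rule KMS_eqI_U[OF \<phi> \<phi>'])
  let ?C = "onorm \<phi> + onorm \<phi>'"
  have C: "0 \<le> ?C"
    using onorm_pos_le[OF KMS_functional_bounded_linear[OF \<phi>]]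
      onorm_pos_le[OF KMS_functional_bounded_linear[OF \<phi>']] by simp
  fix p
  have "cmod (\<phi> (U p) - \<phi>' (U p)) \<le> r ^ k * ?C" for k
  proof (induction k arbitrary: p)
    case 0
    show ?case using norm_triangle_ineq4[of "\<phi> (U p)" "\<phi>' (U p)"] KMS_bound_U[OF \<phi>, of p]
        KMS_bound_U[OF \<phi>', of p] by simp
  next
    case (Suc k)
    have d: "\<phi> (U p) - \<phi>' (U p) = of_real r * (descend \<phi> p - descend \<phi>' p)"
      by (subst (1 2) fourier_recursion) (simp add: eq algebra_simps)
    have "cmod (descend \<phi> p - descend \<phi>' p) \<le> r ^ k * ?C"
    proof (cases "p \<in> range (dual A)")
      case True
      show ?thesis unfolding descend_def if_P[OF True] by (rule Suc.IH)
    next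
      case False
      show ?thesis using C r_pos by (simp only: descend_not[OF False]) simp
    qed
    then show ?case unfolding d norm_mult using r_pos by (simp add: mult.assoc mult_left_mono)
  qed
  moreover have "(\<lambda>k. r ^ k * ?C) \<longlonglongrightarrow> 0 * ?C"
    using r_pos r_less_1 by (intro tendsto_intros LIMSEQ_power_zero) auto
  ultimately have "cmod (\<phi> (U p) - \<phi>' (U p)) \<le> 0 * ?C"
    by (intro LIMSEQ_le_const) auto
  then show "\<phi> (U p) = \<phi>' (U p)" by simp
qed

text \<open>
  \<open>Q\<close> is \<open>1 - P\<close>, where \<open>P\<close> is the sum of the projections \<open>U q V V\<^sup>* U(-q)\<close> over representatives \<open>q\<close> of the
  cosets of \<open>B \<int>\<^sup>d\<close>. They are orthogonal since \<open>V\<^sup>* U m V = 0\<close> outside the range of \<open>B\<close>. Each of the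
  \<open>\<bar>det A\<bar>\<close> summands contributes \<open>exp (- \<beta>) \<phi>(V\<^sup>* U p V)\<close> to \<open>\<phi>(U p P)\<close>, whence the factor \<open>r\<close>.
\<close>

lemma complementary_projection:
  obtains Q where "star Q = Q" "Q * Q = Q" "homogeneous 0 Q"
    "\<forall>\<phi> p. KMS_functional \<sigma> \<beta> \<phi> \<longrightarrow> \<phi> (U p * Q) = of_real (1 - r) * fourier \<phi> p"
proof -
  have "card (covering_kernel A) \<noteq> 0" using degree det by auto
  then have fin: "finite (covering_kernel A)" by (simp add: card_ge_0_finite)
  then obtain R where R: "finite R" "card R = card (covering_kernel A)"
    "\<And>p q. p \<in> R \<Longrightarrow> q \<in> R \<Longrightarrow> p - q \<in> range (dual A) \<Longrightarrow> p = q"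
    using coset_representatives[OF det fin] by blast
  define e where "e q = U q * V * (star V * U (- q))" for q
  define P where "P = (\<Sum>q\<in>R. e q)"
  have star_e: "star (e q) = e q" for q
    by (simp add: e_def star_mult star_star star_U mult.assoc)
  have ee: "e p * e q = (if p = q then e p else 0)" if "p \<in> R" "q \<in> R" for p q
  proof -
    have eq: "e p * e q = U p * V * (star V * U (q - p) * V) * (star V * U (- q))"
      using U_add[of "- p" q] by (simp add: e_def mult.assoc)
    show ?thesis
    proof (cases "p = q")
      case True
      then show ?thesis unfolding eq by (simp add: U_zero isometry) (simp add: e_def)
    next
      case False
      then have "q - p \<notin> range (dual A)" using R(3)[of q p] that by blast
      then show ?thesis unfolding eq star_V_U_V_zero[OF \<open>q - p \<notin> range (dual A)\<close>] using False by simp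
    qed
  qed
  have PP: "P * P = P"
  proof -
    have "P * P = (\<Sum>p\<in>R. \<Sum>q\<in>R. if p = q then e p else 0)"
      unfolding P_def sum_product by (intro sum.cong refl ee)
    then show ?thesis using R(1) by (simp add: P_def)
  qed
  have hom: "homogeneous 1 (U q * V)" for q
    using homogeneous_mult[OF homogeneous_U homogeneous_V] by simp
  have hom': "homogeneous (- 1) (star V * U q)" for q
    using homogeneous_mult[OF homogeneous_star[OF homogeneous_V] homogeneous_U] by simp
  have "homogeneous 0 (e q)" for q
    using homogeneous_mult[OF hom hom'] by (simp add: e_def)
  then have homP: "homogeneous 0 P" unfolding P_def by (intro homogeneous_sum)
  have val: "\<phi> (U p * P) = of_real r * descend \<phi> p" if \<phi>: "KMS_functional \<sigma> \<beta> \<phi>" for \<phi> p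
  proof -
    have "\<phi> (U p * e q) = of_real (exp (- \<beta>)) * descend \<phi> p" for q
    proof -
      have "\<phi> (U p * e q) = \<phi> ((U (p + q) * V) * (star V * U (- q)))"
        by (simp add: e_def U_add mult.assoc)
      also have "\<dots> = of_real (exp (- \<beta>)) * \<phi> ((star V * U (- q)) * (U (p + q) * V))"
        using KMS_swap[OF \<phi> hom hom'] by simp
      also have "(star V * U (- q)) * (U (p + q) * V) = star V * U p * V"
        using U_add[of "- q" "p + q"] by (simp add: mult.assoc)
      finally show ?thesis by (simp only: KMS_compress[OF \<phi>])
    qed
    then have "\<phi> (U p * P) = of_nat (card R) * of_real (exp (- \<beta>)) * descend \<phi> p"
      by (simp add: P_def sum_distrib_left KMS_functional_linear[OF \<phi>])
    also have "complex_of_nat (card R) = of_real (real_of_int \<bar>det A\<bar>)"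
      using arg_cong[OF degree, of complex_of_int] by (simp only: R(2) of_real_of_int_eq of_int_of_nat_eq)
    finally show ?thesis by (simp only: geometric_ratio_def of_real_mult)
  qed
  show ?thesis
  proof (rule that[of "1 - P"])
    show "star (1 - P) = 1 - P" by (simp add: star_diff P_def star_sum star_e)
    show "(1 - P) * (1 - P) = 1 - P" by (simp add: algebra_simps PP)
    show "homogeneous 0 (1 - P)"
      using homogeneous_add[OF homogeneous_one homogeneous_scale[OF homP, of "- 1"]]
      by (simp add: scaleC_minus_one)
    have "\<phi> (U p * (1 - P)) = of_real (1 - r) * fourier \<phi> p" if "KMS_functional \<sigma> \<beta> \<phi>" for \<phi> p
      using fourier_recursion[of \<phi> p] val[OF that, of p]
      by (simp add: right_diff_distrib KMS_functional_linear[OF that])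
    then show "\<forall>\<phi> p. KMS_functional \<sigma> \<beta> \<phi> \<longrightarrow> \<phi> (U p * (1 - P)) = of_real (1 - r) * fourier \<phi> p"
      by blast
  qed
qed

text \<open>
  The functional \<open>f \<mapsto> \<phi>(Q f Q)\<close> is positive because \<open>Q g\<^sup>2 Q = (g Q)\<^sup>* (g Q)\<close> for real \<open>g\<close>; its value at a character is \<open>\<phi>(U p Q)\<close> because \<open>Q\<close> is fixed by the dynamics.
\<close>

theorem KMS_fourier_measure:
  assumes \<phi>: "KMS_functional \<sigma> \<beta> \<phi>" and pos: "\<And>x. \<phi> (star x * x) \<in> \<real>\<^sub>\<ge>\<^sub>0"
  obtains \<nu> :: "'n torus measure" where "finite_measure \<nu>" "sets \<nu> = sets borel"
    "\<And>p. (LINT z|\<nu>. torus_char p z) = fourier \<phi> p"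
proof -
  obtain Q where Q: "star Q = Q" "Q * Q = Q" "homogeneous 0 Q" and
    "\<forall>\<phi> p. KMS_functional \<sigma> \<beta> \<phi> \<longrightarrow> \<phi> (U p * Q) = of_real (1 - r) * fourier \<phi> p"
    by (rule complementary_projection)
  then have \<phi>Q: "\<phi> (U p * Q) = of_real (1 - r) * fourier \<phi> p" for p using \<phi> by simp
  define G where "G f = \<phi> (Q * iC f * Q) / of_real (1 - r)" for f
  have G_add: "G (\<lambda>z. f z + g z) = G f + G g" if "continuous_on UNIV f" "continuous_on UNIV g" for f g
    using that by (simp add: G_def iC_add algebra_simps KMS_functional_linear[OF \<phi>] add_divide_distrib)
  have G_scale: "G (\<lambda>z. c * f z) = c * G f" if "continuous_on UNIV f" for c f
    using that by (simp add: G_def iC_scale mult_scaleC_left mult_scaleC_right KMS_functional_scaleC[OF \<phi>])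
  have G_char: "G (torus_char p) = fourier \<phi> p" for p
  proof -
    have "homogeneous 0 (U p * Q)" using homogeneous_mult[OF homogeneous_U Q(3)] by simp
    then have "\<phi> (Q * (U p * Q)) = \<phi> ((U p * Q) * Q)" using KMS_swap[OF \<phi> Q(3)] by simp
    also have "\<dots> = of_real (1 - r) * fourier \<phi> p" by (simp only: mult.assoc Q \<phi>Q)
    finally show ?thesis using r_less_1 by (simp add: G_def U_def[symmetric] mult.assoc)
  qed
  have G_nonneg: "G (\<lambda>z. of_real (f z)) \<in> \<real>\<^sub>\<ge>\<^sub>0"
    if f: "continuous_on UNIV f" "\<And>z. 0 \<le> f z" for f :: "'n torus \<Rightarrow> real"
  proof -
    define g where "g z = complex_of_real (sqrt (f z))" for z
    have g: "continuous_on UNIV g" unfolding g_def by (intro continuous_intros f)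
    have "(\<lambda>z. complex_of_real (f z)) = (\<lambda>z. g z * g z)"
      using f(2) by (simp add: g_def fun_eq_iff of_real_mult[symmetric] del: of_real_mult)
    then have eq: "iC (\<lambda>z. complex_of_real (f z)) = iC g * iC g" by (simp add: iC_mult[OF g g])
    have "star (iC g) = iC g" using iC_star[OF g] by (simp add: g_def[abs_def])
    then have "Q * iC (\<lambda>z. complex_of_real (f z)) * Q = star (iC g * Q) * (iC g * Q)"
      by (simp add: eq star_mult Q mult.assoc)
    then have "\<phi> (Q * iC (\<lambda>z. complex_of_real (f z)) * Q) \<in> \<real>\<^sub>\<ge>\<^sub>0" using pos by simp
    then show ?thesis unfolding G_def using r_less_1
      by (intro nonneg_Reals_divide_I) (auto simp del: of_real_diff)
  qed
  define M where "M f = Re (G (\<lambda>z. of_real (f z)))" for f :: "'n torus \<Rightarrow> real"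
  interpret M: positive_functional M
  proof
    show "M (\<lambda>z. f z + g z) = M f + M g" if "continuous_on UNIV f" "continuous_on UNIV g" for f g
      using G_add[of "\<lambda>z. of_real (f z)" "\<lambda>z. of_real (g z)"] that
      by (simp add: M_def continuous_on_of_real)
    show "M (\<lambda>z. c * f z) = c * M f" if "continuous_on UNIV f" for c f
      using G_scale[of "\<lambda>z. of_real (f z)" "of_real c"] that by (simp add: M_def continuous_on_of_real)
    show "0 \<le> M f" if "continuous_on UNIV f" "\<And>z. 0 \<le> f z" for f
      using G_nonneg[OF that] by (auto simp: M_def nonneg_Reals_def)
  qed (rule compact_torus)
  have G_real: "G (\<lambda>z. of_real (f z)) = of_real (integral\<^sup>L M.rep_measure f)"
    if f: "continuous_on UNIV f" for f
  proof -
    have r: "G (\<lambda>z. of_real (g z)) = of_real (M g)" if "continuous_on UNIV g" "\<And>z. 0 \<le> g z" for g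
      using G_nonneg[OF that] by (auto simp: M_def nonneg_Reals_def)
    have c: "continuous_on UNIV (\<lambda>z. max 0 (f z))" "continuous_on UNIV (\<lambda>z. max 0 (- f z))"
      by (intro continuous_intros f)+
    have fd: "f = (\<lambda>z. max 0 (f z) + - 1 * max 0 (- f z))" by (auto simp: fun_eq_iff max_def)
    have "G (\<lambda>z. of_real (f z)) =
        G (\<lambda>z. of_real (max 0 (f z)) + - 1 * of_real (max 0 (- f z)))"
      by (subst fd) simp
    also have "\<dots> = G (\<lambda>z. of_real (max 0 (f z))) + - 1 * G (\<lambda>z. of_real (max 0 (- f z)))"
    proof -
      have n: "G (\<lambda>z. - 1 * complex_of_real (max 0 (- f z))) = - 1 * G (\<lambda>z. of_real (max 0 (- f z)))"
        by (intro G_scale continuous_intros f)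
      show ?thesis unfolding n[symmetric] by (intro G_add continuous_intros f)
    qed
    also have "\<dots> = of_real (M (\<lambda>z. max 0 (f z)) + - 1 * M (\<lambda>z. max 0 (- f z)))"
      using r c by simp
    also have "M (\<lambda>z. max 0 (f z)) + - 1 * M (\<lambda>z. max 0 (- f z)) = M f"
      using c by (subst (3) fd) (simp add: M.diff)
    finally show ?thesis using M.integral_rep[OF f] by simp
  qed
  have "(LINT z|M.rep_measure. torus_char p z) = fourier \<phi> p" for p
  proof -
    have c: "continuous_on UNIV (\<lambda>z. Re (torus_char p z))" "continuous_on UNIV (\<lambda>z. Im (torus_char p z))"
      by (intro continuous_intros continuous_torus_char)+
    have eq: "torus_char p = (\<lambda>z. of_real (Re (torus_char p z)) + \<i> * of_real (Im (torus_char p z)))"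
      by (simp add: fun_eq_iff complex_eq_iff)
    have "fourier \<phi> p = G (\<lambda>z. of_real (Re (torus_char p z)) + \<i> * of_real (Im (torus_char p z)))"
      using G_char eq by metis
    also have "\<dots> = G (\<lambda>z. of_real (Re (torus_char p z))) + \<i> * G (\<lambda>z. of_real (Im (torus_char p z)))"
      using c by (subst G_add) (auto intro!: continuous_intros G_scale)
    also have "\<dots> = (LINT z|M.rep_measure. of_real (Re (torus_char p z))) +
        \<i> * (LINT z|M.rep_measure. of_real (Im (torus_char p z)))"
      using c by (simp add: G_real)
    also have "\<dots> = (LINT z|M.rep_measure. of_real (Re (torus_char p z)) + \<i> * of_real (Im (torus_char p z)))"
      using M.integrable_rep[OF c(1)] M.integrable_rep[OF c(2)] by simp
    also have "\<dots> = (LINT z|M.rep_measure. torus_char p z)" using eq by metis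
    finally show ?thesis by simp
  qed
  then show ?thesis using that M.finite_rep M.sets_rep by blast
qed

end

section \<open>Probability measures on the torus\<close>

lemma prob_measures_measurable:
  fixes f :: "'n::finite torus \<Rightarrow> 'b::topological_space"
  assumes "\<mu> \<in> prob_measures" "continuous_on UNIV f" shows "f \<in> measurable \<mu> borel"
  using assms borel_measurable_continuous_onI[of f]
  by (subst measurable_cong_sets[of \<mu> borel borel borel]) (simp_all add: prob_measures_def)

lemma torus_continuous_bounded:
  fixes f :: "'n::finite torus \<Rightarrow> 'b::real_normed_vector"
  assumes "continuous_on UNIV f"
  obtains B where "0 \<le> B" "\<And>z. norm (f z) \<le> B"
proof -
  have "bounded (range f)" using assms compact_torus by (intro compact_imp_bounded compact_continuous_image)
  then obtain B where B: "\<And>z. norm (f z) \<le> B" by (auto simp: bounded_iff)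
  then have "0 \<le> B" using norm_ge_zero order.trans by blast
  with B show ?thesis using that by blast
qed

lemma prob_measures_integrable:
  fixes f :: "'n::finite torus \<Rightarrow> 'b::{banach, second_countable_topology}"
  assumes "\<mu> \<in> prob_measures" "continuous_on UNIV f" shows "integrable \<mu> f"
proof -
  interpret prob_space \<mu> using assms by (simp add: prob_measures_def)
  obtain B where "\<And>z. norm (f z) \<le> B" using torus_continuous_bounded[OF assms(2)] by blast
  then show ?thesis
    by (intro integrable_const_bound[where B=B] prob_measures_measurable assms) auto
qed

lemma prob_measures_integral_bound:
  fixes f :: "'n::finite torus \<Rightarrow> 'b::{banach, second_countable_topology}"
  assumes "\<mu> \<in> prob_measures" "continuous_on UNIV f" "\<And>z. norm (f z) \<le> e"
  shows "norm (integral\<^sup>L \<mu> f) \<le> e"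
proof -
  interpret prob_space \<mu> using assms by (simp add: prob_measures_def)
  have "norm (integral\<^sup>L \<mu> f) \<le> integral\<^sup>L \<mu> (\<lambda>z. norm (f z))" by (rule integral_norm_bound)
  also have "\<dots> \<le> integral\<^sup>L \<mu> (\<lambda>_. e)"
    using assms prob_measures_integrable[OF assms(1,2)] by (intro integral_mono) auto
  finally show ?thesis by (simp add: prob_space)
qed

lemma prob_measures_integral_close:
  fixes f g :: "'n::finite torus \<Rightarrow> 'b::{banach, second_countable_topology}"
  assumes "\<mu> \<in> prob_measures" "continuous_on UNIV f" "continuous_on UNIV g" "\<And>z. norm (f z - g z) \<le> e"
  shows "norm (integral\<^sup>L \<mu> f - integral\<^sup>L \<mu> g) \<le> e"
  using prob_measures_integral_bound[OF assms(1) continuous_on_diff[OF assms(2,3)] assms(4)]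
    prob_measures_integrable[OF assms(1,2)] prob_measures_integrable[OF assms(1,3)] by simp

text \<open>
  Equal Fourier coefficients give equal integrals of trigonometric polynomials, and these are uniformly
  dense.
\<close>

theorem prob_measures_eqI_fourier:
  assumes \<mu>: "\<mu> \<in> prob_measures" and \<nu>: "\<nu> \<in> prob_measures"
    and eq: "\<And>p. (LINT z|\<mu>. torus_char p z) = (LINT z|\<nu>. torus_char p z)"
  shows "\<mu> = \<nu>"
proof (rule borel_measure_eqI_integral)
  have trig: "integral\<^sup>L \<mu> g = integral\<^sup>L \<nu> g" if "g \<in> trig_polys" for g
    using that
    by induction (auto simp: eq prob_measures_integrable[OF \<mu>] prob_measures_integrable[OF \<nu>] trig_polys_continuous)
  fix f :: "'a torus \<Rightarrow> real" assume f: "continuous_on UNIV f"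
  have cf: "continuous_on UNIV (\<lambda>z. complex_of_real (f z))" by (intro continuous_intros f)
  have "norm (complex_of_real (integral\<^sup>L \<mu> f) - of_real (integral\<^sup>L \<nu> f)) \<le> e" if e: "0 < e" for e :: real
  proof -
    obtain g where g: "g \<in> trig_polys" "\<And>z. cmod (of_real (f z) - g z) < e / 2"
      using trig_polys_dense[OF cf, of "e / 2"] e by auto
    have "norm ((LINT z|\<rho>. complex_of_real (f z)) - integral\<^sup>L \<rho> g) \<le> e / 2" if "\<rho> \<in> prob_measures" for \<rho>
      by (intro prob_measures_integral_close[OF that cf trig_polys_continuous[OF g(1)]] less_imp_le g(2))
    from this[OF \<mu>] this[OF \<nu>] show ?thesis
      using trig[OF g(1)] norm_triangle_ineq4[of "(LINT z|\<mu>. complex_of_real (f z)) - integral\<^sup>L \<mu> g"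
        "(LINT z|\<nu>. complex_of_real (f z)) - integral\<^sup>L \<nu> g"] by simp
  qed
  then have "norm (complex_of_real (integral\<^sup>L \<mu> f) - of_real (integral\<^sup>L \<nu> f)) \<le> 0"
    by - (rule field_le_epsilon, simp)
  then show "integral\<^sup>L \<mu> f = integral\<^sup>L \<nu> f" by simp
qed (use \<mu> \<nu> in \<open>auto simp: prob_measures_def prob_space_def\<close>)

lemma mixture_prob_measures:
  assumes \<mu>: "\<mu> \<in> prob_measures" and \<nu>: "\<nu> \<in> prob_measures" and t: "t \<in> {0..1}"
  shows "mixture t \<mu> \<nu> \<in> prob_measures"
proof -
  have sp: "space \<rho> = UNIV" if "sets \<rho> = sets borel" for \<rho> :: "'a torus measure"
    using sets_eq_imp_space_eq[OF that] by simp
  have "emeasure \<rho> UNIV = 1" if "\<rho> \<in> prob_measures" for \<rho> :: "'a torus measure"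
    using that sp[of \<rho>] prob_space.emeasure_space_1[of \<rho>] by (simp add: prob_measures_def)
  then have "emeasure (mixture t \<mu> \<nu>) UNIV = ennreal t + ennreal (1 - t)"
    using emeasure_mixture[OF \<mu> \<nu>, of UNIV t] \<mu> \<nu> by simp
  also have "\<dots> = 1" using t by (simp add: ennreal_plus[symmetric] del: ennreal_plus)
  finally show ?thesis
    using sp[OF sets_mixture] by (auto simp: prob_measures_def sets_mixture intro!: prob_spaceI)
qed

lemma nn_integral_mixture:
  fixes f :: "'n::finite torus \<Rightarrow> ennreal"
  assumes \<mu>: "\<mu> \<in> prob_measures" and \<nu>: "\<nu> \<in> prob_measures" and f: "f \<in> borel_measurable borel"
  shows "nn_integral (mixture t \<mu> \<nu>) f =
    ennreal t * nn_integral \<mu> f + ennreal (1 - t) * nn_integral \<nu> f"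
proof -
  have m: "g \<in> borel_measurable \<mu>" "g \<in> borel_measurable \<nu>" "g \<in> borel_measurable (mixture t \<mu> \<nu>)"
    if "g \<in> borel_measurable borel" for g :: "'n torus \<Rightarrow> ennreal"
    using that \<mu> \<nu> by (auto simp: prob_measures_def sets_mixture cong: measurable_cong_sets)
  show ?thesis
    using f
  proof (induction rule: borel_measurable_induct)
    case (cong f g)
    then have "f = g" by auto
    then show ?case using cong by simp
  next
    case (set E)
    then show ?case using emeasure_mixture[OF \<mu> \<nu> set] \<mu> \<nu> by (simp add: sets_mixture prob_measures_def)
  next
    case (mult u c)
    then show ?case by (simp add: nn_integral_cmult m algebra_simps)
  next
    case (add u v)
    then show ?case by (simp add: nn_integral_add m algebra_simps)
  next
    case (seq W)
    have c: "nn_integral \<rho> (SUP i. W i) = (SUP i. nn_integral \<rho> (W i))"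
      if "\<And>i. W i \<in> borel_measurable \<rho>" for \<rho>
      using nn_integral_monotone_convergence_SUP[OF seq(3) that] by (simp add: SUP_apply[abs_def])
    have inc: "incseq (\<lambda>i. nn_integral \<rho> (W i))" for \<rho>
      using seq(3) by (auto simp: incseq_def le_fun_def intro!: nn_integral_mono)
    have "(SUP i. nn_integral (mixture t \<mu> \<nu>) (W i)) =
        (SUP i. ennreal t * nn_integral \<mu> (W i) + ennreal (1 - t) * nn_integral \<nu> (W i))"
      by (simp only: seq.IH)
    also have "\<dots> = (SUP i. ennreal t * nn_integral \<mu> (W i)) + (SUP i. ennreal (1 - t) * nn_integral \<nu> (W i))"
      using inc by (intro ennreal_SUP_add) (auto simp: incseq_def intro!: mult_left_mono)
    finally show ?case using seq(1) by (simp only: c m SUP_mult_left_ennreal)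
  qed
qed

lemma integral_mixture_real:
  fixes f :: "'n::finite torus \<Rightarrow> real"
  assumes \<mu>: "\<mu> \<in> prob_measures" and \<nu>: "\<nu> \<in> prob_measures" and t: "t \<in> {0..1}"
    and f: "continuous_on UNIV f"
  shows "integral\<^sup>L (mixture t \<mu> \<nu>) f = t * integral\<^sup>L \<mu> f + (1 - t) * integral\<^sup>L \<nu> f"
proof -
  note \<kappa> = mixture_prob_measures[OF \<mu> \<nu> t]
  obtain B where B: "\<And>z. norm (f z) \<le> B" using torus_continuous_bounded[OF f] by blast
  define g where "g z = f z + B" for z
  have g: "continuous_on UNIV g" unfolding g_def by (intro continuous_intros f)
  have g0: "0 \<le> g z" for z using B[of z] by (simp add: g_def abs_le_iff)
  have nn: "nn_integral \<rho> (\<lambda>z. ennreal (g z)) = ennreal (integral\<^sup>L \<rho> g)" if "\<rho> \<in> prob_measures" for \<rho>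
    using prob_measures_integrable[OF that g] g0 by (intro nn_integral_eq_integral) auto
  have ge: "0 \<le> integral\<^sup>L \<rho> g" for \<rho> using g0 by (intro Bochner_Integration.integral_nonneg)
  have fg: "integral\<^sup>L \<rho> g = integral\<^sup>L \<rho> f + B" if "\<rho> \<in> prob_measures" for \<rho>
  proof -
    interpret prob_space \<rho> using that by (simp add: prob_measures_def)
    show ?thesis using prob_measures_integrable[OF that f] by (simp add: g_def[abs_def] prob_space)
  qed
  have "ennreal (integral\<^sup>L (mixture t \<mu> \<nu>) g) =
      ennreal t * ennreal (integral\<^sup>L \<mu> g) + ennreal (1 - t) * ennreal (integral\<^sup>L \<nu> g)"
    unfolding nn[OF \<mu>, symmetric] nn[OF \<nu>, symmetric] nn[OF \<kappa>, symmetric]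
    using g by (intro nn_integral_mixture \<mu> \<nu>) (auto intro: borel_measurable_continuous_onI measurable_compose)
  also have "\<dots> = ennreal (t * integral\<^sup>L \<mu> g + (1 - t) * integral\<^sup>L \<nu> g)"
    using t ge by (simp add: ennreal_mult ennreal_plus)
  finally have "integral\<^sup>L (mixture t \<mu> \<nu>) g = t * integral\<^sup>L \<mu> g + (1 - t) * integral\<^sup>L \<nu> g"
    using t ge by (subst (asm) ennreal_inj) auto
  then show ?thesis by (simp add: fg[OF \<mu>] fg[OF \<nu>] fg[OF \<kappa>] algebra_simps)
qed

lemma integral_complex_parts:
  assumes "\<mu> \<in> prob_measures" "continuous_on UNIV f"
  shows "integral\<^sup>L \<mu> f = of_real (LINT z|\<mu>. Re (f z)) + \<i> * of_real (LINT z|\<mu>. Im (f z))"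
  using prob_measures_integrable[OF assms] by (simp add: complex_eq_iff)

lemma integral_mixture:
  assumes \<mu>: "\<mu> \<in> prob_measures" and \<nu>: "\<nu> \<in> prob_measures" and t: "t \<in> {0..1}"
    and f: "continuous_on UNIV f"
  shows "(LINT z|mixture t \<mu> \<nu>. f z) =
    complex_of_real t * (LINT z|\<mu>. f z) + complex_of_real (1 - t) * (LINT z|\<nu>. f z)"
proof -
  have "continuous_on UNIV (\<lambda>z. Re (f z))" "continuous_on UNIV (\<lambda>z. Im (f z))"
    by (intro continuous_intros f)+
  note parts = this[THEN integral_mixture_real[OF \<mu> \<nu> t]]
  show ?thesis
    unfolding integral_complex_parts[OF \<mu> f] integral_complex_parts[OF \<nu> f]
      integral_complex_parts[OF mixture_prob_measures[OF \<mu> \<nu> t] f] parts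
    by (simp add: algebra_simps)
qed

lemma topspace_prob_topology: "topspace prob_topology = prob_measures"
  by (auto simp: prob_topology_def topspace_pullback_topology)

lemma continuous_map_integral:
  fixes f :: "'n::finite torus \<Rightarrow> complex"
  assumes "continuous_on UNIV f"
  shows "continuous_map prob_topology euclidean (\<lambda>\<mu>. LINT z|\<mu>. f z)"
proof -
  have f: "f \<in> carrier C_torus" using assms by (simp add: carrier_C_torus)
  then have "continuous_map (product_topology (\<lambda>_. euclidean :: complex topology) (carrier C_torus)) euclidean (\<lambda>x. x f)"
    by (rule continuous_map_product_projection)
  from continuous_map_pullback[OF this, of prob_measures "\<lambda>\<mu>. \<lambda>f\<in>carrier C_torus. LINT z|\<mu>. f z"]
  show ?thesis using f by (simp add: prob_topology_def o_def)
qed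

lemma continuous_map_cmult:
  fixes f :: "'a \<Rightarrow> 'b::real_normed_algebra"
  assumes "continuous_map X euclidean f" shows "continuous_map X euclidean (\<lambda>x. c * f x)"
proof -
  have "continuous_map euclidean euclidean (\<lambda>y :: 'b. c * y)"
    by (simp add: continuous_intros)
  from continuous_map_compose[OF assms this] show ?thesis by (simp add: o_def)
qed

lemma continuous_map_uniform_approximation:
  fixes f :: "'a \<Rightarrow> 'b::real_normed_vector"
  assumes "\<And>e. 0 < e \<Longrightarrow> \<exists>g. continuous_map X euclidean g \<and> (\<forall>x\<in>topspace X. norm (f x - g x) \<le> e)"
  shows "continuous_map X euclidean f"
proof -
  have "\<forall>n. \<exists>g. continuous_map X euclidean g \<and> (\<forall>x\<in>topspace X. norm (f x - g x) \<le> inverse (real (Suc n)))"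
    using assms by (intro allI) (simp add: inverse_positive_iff_positive)
  then obtain g where g: "\<And>n. continuous_map X euclidean (g n)"
    "\<And>n x. x \<in> topspace X \<Longrightarrow> norm (f x - g n x) \<le> inverse (real (Suc n))" by metis
  have "continuous_map X Met_TC.mtopology f"
  proof (rule Met_TC.continuous_map_uniform_limit[where F=sequentially and f=g])
    show "\<forall>\<^sub>F n in sequentially. continuous_map X Met_TC.mtopology (g n)" using g(1) by simp
    fix e :: real assume "0 < e"
    then have "\<forall>\<^sub>F n in sequentially. inverse (real (Suc n)) < e"
      using LIMSEQ_inverse_real_of_nat order_tendstoD(2) by blast
    then show "\<forall>\<^sub>F n in sequentially. \<forall>x\<in>topspace X. f x \<in> UNIV \<and> dist (g n x) (f x) < e"
    proof eventually_elim
      case (elim n)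
      show ?case
      proof (intro ballI conjI UNIV_I)
        fix x assume "x \<in> topspace X"
        from g(2)[OF this, of n] elim show "dist (g n x) (f x) < e"
          by (simp only: dist_norm norm_minus_commute[of "g n x"])
      qed
    qed
  qed simp
  then show ?thesis by simp
qed

section \<open>The parametrisation of the KMS states\<close>

locale KMS_parametrisation = toeplitz_system A iM iC \<sigma> \<beta>
  for A :: "int ^ 'n ^ 'n::finite" and iM iC :: "('n torus \<Rightarrow> complex) \<Rightarrow> 'a::cstar_algebra"
    and \<sigma> :: "real \<Rightarrow> 'a \<Rightarrow> 'a" and \<beta> :: real +
  fixes \<psi> :: "'n torus measure \<Rightarrow> 'a \<Rightarrow> complex"
  assumes KMS: "\<mu> \<in> prob_measures \<Longrightarrow> \<psi> \<mu> \<in> KMS_states \<sigma> \<beta>"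
    and fourier_\<psi>: "\<mu> \<in> prob_measures \<Longrightarrow> fourier (\<psi> \<mu>) p = (LINT z|\<mu>. torus_char p z)"
begin

lemma \<psi>_functional: "\<mu> \<in> prob_measures \<Longrightarrow> KMS_functional \<sigma> \<beta> (\<psi> \<mu>)"
  by (intro KMS_states_functional KMS)

lemma \<psi>_inj: "inj_on \<psi> prob_measures"
proof (rule inj_onI)
  fix \<mu> \<nu> assume "\<mu> \<in> prob_measures" "\<nu> \<in> prob_measures" "\<psi> \<mu> = \<psi> \<nu>"
  then show "\<mu> = \<nu>" by (intro prob_measures_eqI_fourier) (auto simp: fourier_\<psi>[symmetric])
qed

theorem \<psi>_affine:
  assumes \<mu>: "\<mu> \<in> prob_measures" and \<nu>: "\<nu> \<in> prob_measures" and t: "t \<in> {0..1}"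
  shows "\<psi> (mixture t \<mu> \<nu>) = (\<lambda>c. complex_of_real t * \<psi> \<mu> c + complex_of_real (1 - t) * \<psi> \<nu> c)"
proof (rule KMS_eqI_fourier)
  show "KMS_functional \<sigma> \<beta> (\<psi> (mixture t \<mu> \<nu>))"
    by (intro \<psi>_functional mixture_prob_measures \<mu> \<nu> t)
  show "KMS_functional \<sigma> \<beta> (\<lambda>c. complex_of_real t * \<psi> \<mu> c + complex_of_real (1 - t) * \<psi> \<nu> c)"
    by (intro KMS_functional_combination \<psi>_functional \<mu> \<nu>)
  show "fourier (\<psi> (mixture t \<mu> \<nu>)) p =
      fourier (\<lambda>c. complex_of_real t * \<psi> \<mu> c + complex_of_real (1 - t) * \<psi> \<nu> c) p" for p
    unfolding fourier_combination fourier_\<psi>[OF \<mu>] fourier_\<psi>[OF \<nu>]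
      fourier_\<psi>[OF mixture_prob_measures[OF \<mu> \<nu> t]]
    by (rule integral_mixture[OF \<mu> \<nu> t continuous_torus_char])
qed

lemma KMS_state_bound: "\<phi> \<in> KMS_states \<sigma> \<beta> \<Longrightarrow> cmod (\<phi> x) \<le> norm x"
  using onorm[of \<phi> x] by (simp add: KMS_states_def cstar_state_def)

text \<open>
  The measure obtained from \<open>\<phi>\<close> has total mass \<open>s = \<phi>(1)\<close>. If it is \<open>0\<close>, then so are the measure and
  \<open>\<phi>\<close>, against \<open>onorm \<phi> = 1\<close>. Otherwise \<open>\<phi> / s\<close> is \<open>\<psi> \<mu>\<close> for a probability measure \<open>\<mu>\<close>, and comparing the norms
  of the functionals \<open>\<phi> = s \<psi> \<mu>\<close> and \<open>\<psi> \<mu>\<close>, both \<open>1\<close>, gives \<open>s = 1\<close>.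
\<close>

theorem \<psi>_surj:
  assumes \<phi>: "\<phi> \<in> KMS_states \<sigma> \<beta>"
  shows "\<exists>\<mu>\<in>prob_measures. \<psi> \<mu> = \<phi>"
proof -
  have \<phi>K: "KMS_functional \<sigma> \<beta> \<phi>" by (rule KMS_states_functional[OF \<phi>])
  have pos: "\<phi> (star x * x) \<in> \<real>\<^sub>\<ge>\<^sub>0" for x using \<phi> by (simp add: KMS_states_def cstar_state_def)
  have on: "onorm \<phi> = 1" using \<phi> by (simp add: KMS_states_def cstar_state_def)
  define s where "s = Re (\<phi> 1)"
  have s: "\<phi> 1 = of_real s" "0 \<le> s" using pos[of 1] by (auto simp: s_def nonneg_Reals_def)
  have measure_UNIV: "complex_of_real (measure \<nu> UNIV) = fourier \<phi>' 0"
    if "sets \<nu> = sets borel" "\<And>p. (LINT z|\<nu>. torus_char p z) = fourier \<phi>' p" for \<nu> :: "'n torus measure" and \<phi>'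
    using that(2)[of 0] sets_eq_imp_space_eq[OF that(1)] by (simp add: torus_char_zero scaleR_conv_of_real)
  have "s \<noteq> 0"
  proof
    assume s0: "s = 0"
    obtain \<nu> :: "'n torus measure" where \<nu>: "finite_measure \<nu>" "sets \<nu> = sets borel"
      "\<And>p. (LINT z|\<nu>. torus_char p z) = fourier \<phi> p"
      using KMS_fourier_measure[OF \<phi>K pos] by blast
    have "measure \<nu> UNIV = 0"
      using measure_UNIV[OF \<nu>(2,3)] fourier_zero[OF \<phi>K] s s0 by simp
    then have "emeasure \<nu> (space \<nu>) = 0"
      using \<nu>(1) sets_eq_imp_space_eq[OF \<nu>(2)] by (simp add: finite_measure.emeasure_eq_measure)
    then have "AE z in \<nu>. False" by (intro AE_I[of _ _ "space \<nu>"]) auto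
    then have "(LINT z|\<nu>. torus_char p z) = 0" for p
      by (intro integral_eq_zero_AE) auto
    then have "fourier \<phi> p = fourier (\<lambda>x. 0 * \<phi> x + 0 * \<phi> x) p" for p
      using \<nu>(3)[of p] unfolding fourier_combination by simp
    then have "\<phi> = (\<lambda>x. 0 * \<phi> x + 0 * \<phi> x)"
      by (intro KMS_eqI_fourier \<phi>K KMS_functional_combination)
    then have "\<phi> = (\<lambda>x. 0)" by simp
    then show False using on by (simp add: onorm_zero)
  qed
  with s have s: "\<phi> 1 = of_real s" "0 < s" by auto
  define \<phi>' where "\<phi>' = (\<lambda>x. of_real (1 / s) * \<phi> x + 0 * \<phi> x)"
  have \<phi>'K: "KMS_functional \<sigma> \<beta> \<phi>'" unfolding \<phi>'_def by (intro KMS_functional_combination \<phi>K)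
  have "\<phi>' (star x * x) \<in> \<real>\<^sub>\<ge>\<^sub>0" for x
    using s pos[of x] by (auto simp: \<phi>'_def simp del: of_real_divide intro!: nonneg_Reals_mult_I)
  then obtain \<mu> :: "'n torus measure" where \<mu>: "finite_measure \<mu>" "sets \<mu> = sets borel"
    "\<And>p. (LINT z|\<mu>. torus_char p z) = fourier \<phi>' p"
    using KMS_fourier_measure[OF \<phi>'K] by blast
  have "measure \<mu> UNIV = 1"
    using measure_UNIV[OF \<mu>(2,3)] fourier_zero[OF \<phi>'K] s by (simp add: \<phi>'_def)
  then have prob: "\<mu> \<in> prob_measures"
    using \<mu> sets_eq_imp_space_eq[OF \<mu>(2)]
    by (auto simp: prob_measures_def finite_measure.emeasure_eq_measure intro!: prob_spaceI)
  have eq: "\<psi> \<mu> = \<phi>'"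
    using \<mu>(3) by (intro KMS_eqI_fourier \<psi>_functional[OF prob] \<phi>'K) (simp add: fourier_\<psi>[OF prob])
  have "onorm (\<lambda>x. (1 / s) *\<^sub>R \<phi> x) = \<bar>1 / s\<bar> * onorm \<phi>"
    by (rule onorm_scaleR[OF KMS_functional_bounded_linear[OF \<phi>K]])
  moreover have "(\<lambda>x. (1 / s) *\<^sub>R \<phi> x) = \<psi> \<mu>" by (simp add: eq \<phi>'_def scaleR_conv_of_real)
  moreover have "onorm (\<psi> \<mu>) = 1" using KMS[OF prob] by (simp add: KMS_states_def cstar_state_def)
  ultimately have "s = 1" using on s by simp
  then show ?thesis using eq prob by (auto simp: \<phi>'_def)
qed

lemma topspace_KMS_topology: "topspace (KMS_topology \<sigma> \<beta>) = KMS_states \<sigma> \<beta>"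
  by (simp add: KMS_topology_def)

text \<open>
  Unrolling \<open>fourier_recursion\<close> \<open>k\<close> times leaves a finite combination of Fourier coefficients and a
  remainder of norm at most \<open>r\<^sup>k\<close>.
\<close>

lemma continuous_map_\<psi>_U: "continuous_map prob_topology euclidean (\<lambda>\<mu>. \<psi> \<mu> (U p))"
proof (rule continuous_map_uniform_approximation)
  have approx: "\<exists>g. continuous_map prob_topology euclidean g \<and>
      (\<forall>\<mu>\<in>prob_measures. cmod (\<psi> \<mu> (U p) - g \<mu>) \<le> r ^ k)" for k p
  proof (induction k arbitrary: p)
    case 0
    have "cmod (\<psi> \<mu> (U p)) \<le> 1" if "\<mu> \<in> prob_measures" for \<mu>
      using KMS_state_bound[OF KMS[OF that], of "U p"] norm_U[of p] by simp
    then show ?case by (intro exI[of _ "\<lambda>_. 0"]) simp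
  next
    case (Suc k)
    obtain h where h: "continuous_map prob_topology euclidean h"
      "\<And>\<mu>. \<mu> \<in> prob_measures \<Longrightarrow> cmod (descend (\<psi> \<mu>) p - h \<mu>) \<le> r ^ k"
    proof (cases "p \<in> range (dual A)")
      case True
      then show ?thesis using that Suc.IH[of "inv_into UNIV (dual A) p"] by (simp only: descend_def if_True) blast
    next
      case False
      have "cmod (descend (\<psi> \<mu>) p - 0) \<le> r ^ k" for \<mu>
        unfolding descend_not[OF False] using r_pos by simp
      then show ?thesis using that[of "\<lambda>_. 0"] by simp
    qed
    let ?g = "\<lambda>\<mu>. of_real (1 - r) * (LINT z|\<mu>. torus_char p z) + of_real r * h \<mu>"
    have "continuous_map prob_topology euclidean ?g"
      by (intro continuous_map_add continuous_map_cmult continuous_map_integral continuous_torus_char h)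
    moreover have "cmod (\<psi> \<mu> (U p) - ?g \<mu>) \<le> r ^ Suc k" if \<mu>: "\<mu> \<in> prob_measures" for \<mu>
    proof -
      have "\<psi> \<mu> (U p) - ?g \<mu> = of_real r * (descend (\<psi> \<mu>) p - h \<mu>)"
        by (subst fourier_recursion) (simp add: fourier_\<psi>[OF \<mu>] algebra_simps)
      then show ?thesis using h(2)[OF \<mu>] r_pos by (simp add: norm_mult mult_left_mono)
    qed
    ultimately show ?case by blast
  qed
  fix e :: real assume "0 < e"
  then obtain k where "r ^ k < e" using real_arch_pow_inv r_less_1 by blast
  then show "\<exists>g. continuous_map prob_topology euclidean g \<and>
      (\<forall>\<mu>\<in>topspace prob_topology. cmod (\<psi> \<mu> (U p) - g \<mu>) \<le> e)"
    using approx[of p k] by (force simp: topspace_prob_topology)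
qed

lemma continuous_map_\<psi>_polys:
  assumes "x \<in> polys" shows "continuous_map prob_topology euclidean (\<lambda>\<mu>. \<psi> \<mu> x)"
  using assms
proof induction
  case (monomial m k l n)
  have compress: "continuous_map prob_topology euclidean (\<lambda>\<mu>. \<psi> \<mu> (star V ^ k * U p * V ^ k))" for p
  proof (cases "p \<in> range (dual_pow A k)")
    case True
    then obtain q where q: "p = dual_pow A k q" by blast
    show ?thesis unfolding q compress_U by (rule continuous_map_\<psi>_U)
  next
    case False
    have "continuous_map prob_topology euclidean (\<lambda>\<mu>. \<psi> \<mu> 0)"
      by (rule continuous_map_eq[where f="\<lambda>_. 0"])
        (auto simp: topspace_prob_topology KMS_functional_linear(3)[OF \<psi>_functional])
    then show ?thesis by (simp add: compress_U_zero[OF False])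
  qed
  have "continuous_map prob_topology euclidean
      (\<lambda>\<mu>. if k = l then of_real (exp (- (real k * \<beta>))) * \<psi> \<mu> (star V ^ k * U (m - n) * V ^ k) else 0)"
    using continuous_map_cmult[OF compress[of "m - n"]] by (cases "k = l") auto
  then show ?case
    by (rule continuous_map_eq) (simp add: topspace_prob_topology KMS_monomial[OF \<psi>_functional])
next
  case (add x y)
  have "continuous_map prob_topology euclidean (\<lambda>\<mu>. \<psi> \<mu> x + \<psi> \<mu> y)" by (intro continuous_map_add add.IH)
  then show ?case
    by (rule continuous_map_eq) (simp add: topspace_prob_topology KMS_functional_linear[OF \<psi>_functional])
next
  case (scale x c)
  have "continuous_map prob_topology euclidean (\<lambda>\<mu>. c * \<psi> \<mu> x)" by (intro continuous_map_cmult scale.IH)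
  then show ?case
    by (rule continuous_map_eq) (simp add: topspace_prob_topology KMS_functional_scaleC[OF \<psi>_functional])
qed

lemma continuous_map_\<psi>: "continuous_map prob_topology (KMS_topology \<sigma> \<beta>) \<psi>"
proof -
  have "continuous_map prob_topology euclidean (\<lambda>\<mu>. \<psi> \<mu> c)" for c
  proof (rule continuous_map_uniform_approximation)
    fix e :: real assume e: "0 < e"
    have "c \<in> closure polys" using polys_dense[OF generates] by simp
    then obtain x where x: "x \<in> polys" "dist x c < e" using e unfolding closure_approachable by blast
    have "cmod (\<psi> \<mu> c - \<psi> \<mu> x) \<le> e" if \<mu>: "\<mu> \<in> prob_measures" for \<mu>
      using KMS_state_bound[OF KMS[OF \<mu>], of "c - x"] x(2)
      by (simp add: KMS_functional_linear[OF \<psi>_functional[OF \<mu>]] dist_norm norm_minus_commute)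
    then show "\<exists>g. continuous_map prob_topology euclidean g \<and>
        (\<forall>\<mu>\<in>topspace prob_topology. cmod (\<psi> \<mu> c - g \<mu>) \<le> e)"
      using continuous_map_\<psi>_polys[OF x(1)] by (auto simp: topspace_prob_topology)
  qed
  then show ?thesis using KMS
    by (auto simp: KMS_topology_def continuous_map_in_subtopology continuous_map_componentwise_UNIV
        topspace_prob_topology)
qed

text \<open>
  Fourier coefficients of \<open>g \<phi>\<close> are combinations of two values of \<open>\<phi>\<close>; integrals of other functions are
  uniform limits of combinations of these.
\<close>

lemma continuous_map_inverse:
  assumes g: "\<And>\<phi>. \<phi> \<in> KMS_states \<sigma> \<beta> \<Longrightarrow> g \<phi> \<in> prob_measures \<and> \<psi> (g \<phi>) = \<phi>"
  shows "continuous_map (KMS_topology \<sigma> \<beta>) prob_topology g"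
proof -
  have eval: "continuous_map (KMS_topology \<sigma> \<beta>) euclidean (\<lambda>\<phi>. \<phi> x)" for x
    unfolding KMS_topology_def
    by (intro continuous_map_from_subtopology continuous_map_product_projection) simp
  have desc: "continuous_map (KMS_topology \<sigma> \<beta>) euclidean (\<lambda>\<phi>. descend \<phi> p)" for p
    by (cases "p \<in> range (dual A)") (simp_all only: descend_def if_True if_False eval continuous_map_const, simp)
  have trig: "continuous_map (KMS_topology \<sigma> \<beta>) euclidean (\<lambda>\<phi>. LINT z|g \<phi>. f z)" if "f \<in> trig_polys" for f
    using that
  proof induction
    case (char p)
    have "continuous_map (KMS_topology \<sigma> \<beta>) euclidean
        (\<lambda>\<phi>. inverse (of_real (1 - r)) * (\<phi> (U p) - of_real r * descend \<phi> p))"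
      by (intro continuous_map_cmult continuous_map_diff eval desc)
    then show ?case
    proof (rule continuous_map_eq)
      fix \<phi> assume "\<phi> \<in> topspace (KMS_topology \<sigma> \<beta>)"
      then have "g \<phi> \<in> prob_measures" "\<psi> (g \<phi>) = \<phi>" using g by (auto simp: topspace_KMS_topology)
      then have "fourier \<phi> p = (LINT z|g \<phi>. torus_char p z)" using fourier_\<psi> by metis
      then show "inverse (of_real (1 - r)) * (\<phi> (U p) - of_real r * descend \<phi> p) =
          (LINT z|g \<phi>. torus_char p z)"
        by (simp add: fourier_def divide_inverse mult.commute)
    qed
  next
    case (add f h)
    have "continuous_map (KMS_topology \<sigma> \<beta>) euclidean (\<lambda>\<phi>. (LINT z|g \<phi>. f z) + (LINT z|g \<phi>. h z))"
      by (intro continuous_map_add add.IH)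
    then show ?case
      by (rule continuous_map_eq)
        (use g add in \<open>auto simp: topspace_KMS_topology prob_measures_integrable trig_polys_continuous\<close>)
  next
    case (scale f c)
    have "continuous_map (KMS_topology \<sigma> \<beta>) euclidean (\<lambda>\<phi>. c * (LINT z|g \<phi>. f z))"
      by (intro continuous_map_cmult scale.IH)
    then show ?case by simp
  qed
  have int: "continuous_map (KMS_topology \<sigma> \<beta>) euclidean (\<lambda>\<phi>. LINT z|g \<phi>. f z)"
    if f: "continuous_on UNIV f" for f :: "'n torus \<Rightarrow> complex"
  proof (rule continuous_map_uniform_approximation)
    fix e :: real assume e: "0 < e"
    obtain h where h: "h \<in> trig_polys" "\<And>z. cmod (f z - h z) < e" using trig_polys_dense[OF f e] by blast
    have "cmod ((LINT z|g \<phi>. f z) - (LINT z|g \<phi>. h z)) \<le> e" if "\<phi> \<in> KMS_states \<sigma> \<beta>" for \<phi>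
      using g[OF that] f trig_polys_continuous[OF h(1)] h(2)
      by (intro prob_measures_integral_close) (auto intro: less_imp_le)
    then show "\<exists>h. continuous_map (KMS_topology \<sigma> \<beta>) euclidean h \<and>
        (\<forall>\<phi>\<in>topspace (KMS_topology \<sigma> \<beta>). cmod ((LINT z|g \<phi>. f z) - h \<phi>) \<le> e)"
      using trig[OF h(1)] by (auto simp: topspace_KMS_topology)
  qed
  show ?thesis unfolding prob_topology_def
  proof (rule continuous_map_pullback')
    show "topspace (KMS_topology \<sigma> \<beta>) \<subseteq> g -` prob_measures" using g by (auto simp: topspace_KMS_topology)
    show "continuous_map (KMS_topology \<sigma> \<beta>) (product_topology (\<lambda>_. euclidean) (carrier C_torus))
        ((\<lambda>\<mu>. \<lambda>f\<in>carrier C_torus. LINT z|\<mu>. f z) \<circ> g)"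
      using int by (auto simp: continuous_map_componentwise carrier_C_torus)
  qed
qed

theorem homeomorphic_map_\<psi>: "homeomorphic_map prob_topology (KMS_topology \<sigma> \<beta>) \<psi>"
proof -
  define g where "g = inv_into prob_measures \<psi>"
  have g: "g \<phi> \<in> prob_measures \<and> \<psi> (g \<phi>) = \<phi>" if "\<phi> \<in> KMS_states \<sigma> \<beta>" for \<phi>
  proof -
    have "\<phi> \<in> \<psi> ` prob_measures" using \<psi>_surj[OF that] by blast
    then show ?thesis unfolding g_def by (simp add: inv_into_into f_inv_into_f)
  qed
  have "homeomorphic_maps prob_topology (KMS_topology \<sigma> \<beta>) \<psi> g"
    unfolding homeomorphic_maps_def
    using continuous_map_\<psi> continuous_map_inverse[OF g] g inv_into_f_f[OF \<psi>_inj]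
    by (simp add: topspace_prob_topology topspace_KMS_topology g_def)
  then show ?thesis unfolding homeomorphic_map_maps by blast
qed

end

lemma geometric_dominated_summable:
  fixes a :: "nat \<Rightarrow> complex"
  assumes "0 \<le> r" "r < 1" "\<And>j. cmod (a j) \<le> r ^ j"
  shows "a summable_on J"
proof -
  have "summable (\<lambda>j. norm (a j))"
  proof (rule summable_comparison_test')
    show "summable (\<lambda>j. r ^ j)" using assms by (intro summable_geometric) simp
    show "norm (norm (a j)) \<le> r ^ j" if "0 \<le> j" for j using assms(3) by simp
  qed
  then have "a summable_on UNIV" by (rule norm_summable_imp_summable_on)
  then show ?thesis using summable_on_subset_banach by blast
qed

section \<open>From the series to its parameter\<close>

text \<open>
  The states given by the series. It remains to read off their \<open>fourier\<close> values and the degree of the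
  covering.
\<close>

locale KMS_series_family = dynamical_representation A iM iC \<sigma>
  for A :: "int ^ 'n ^ 'n::finite" and iM iC :: "('n torus \<Rightarrow> complex) \<Rightarrow> 'a::cstar_algebra"
    and \<sigma> :: "real \<Rightarrow> 'a \<Rightarrow> 'a" +
  fixes \<beta> :: real and \<psi> :: "'n torus measure \<Rightarrow> 'a \<Rightarrow> complex"
  assumes \<beta>: "\<beta> > ln (real_of_int \<bar>det A\<bar>)"
    and KMS: "\<mu> \<in> prob_measures \<Longrightarrow> \<psi> \<mu> \<in> KMS_states \<sigma> \<beta>"
    and series: "\<mu> \<in> prob_measures \<Longrightarrow>
      \<psi> \<mu> (U m * V ^ k * star V ^ l * star (U n)) =
        (if k = l \<and> m - n \<in> range (dual_pow A k)
         then complex_of_real (1 - real_of_int \<bar>det A\<bar> * exp (- \<beta>)) *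
           (\<Sum>\<^sub>\<infinity>j\<in>{j. k \<le> j \<and> m - n \<in> range (dual_pow A j)}.
              complex_of_real (real_of_int \<bar>det A\<bar> ^ (j - k) * exp (- (real j * \<beta>))) *
              (LINT z|\<mu>. torus_char (inv_into UNIV (dual_pow A j) (m - n)) z))
         else 0)"
begin

definition r :: real where "r = geometric_ratio A \<beta>"

lemma r: "0 < r" "r < 1"
  using geometric_ratio_pos[OF det] geometric_ratio_less_1[OF det \<beta>] by (simp_all add: r_def)

lemma power_exp_eq: "real_of_int \<bar>det A\<bar> ^ j * exp (- (real j * \<beta>)) = r ^ j"
  by (simp add: r_def geometric_ratio_def power_mult_distrib exp_of_nat_mult[symmetric])

definition summand :: "'n torus measure \<Rightarrow> int ^ 'n \<Rightarrow> nat \<Rightarrow> complex" where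
  "summand \<mu> p j = of_real (r ^ j) * (LINT z|\<mu>. torus_char (inv_into UNIV (dual_pow A j) p) z)"

text \<open>
  The index set of the series for \<open>\<psi> \<mu> (U p)\<close>.
\<close>

definition depths :: "int ^ 'n \<Rightarrow> nat set" where
  "depths p = {j. p \<in> range (dual_pow A j)}"

lemma \<psi>_U:
  assumes "\<mu> \<in> prob_measures"
  shows "\<psi> \<mu> (U p) = of_real (1 - r) * (\<Sum>\<^sub>\<infinity>j\<in>depths p. summand \<mu> p j)"
  using series[OF assms, of p 0 0 0, folded geometric_ratio_def, folded r_def]
  by (simp add: U_zero dual_pow_simps(1)[abs_def] power_exp_eq summand_def depths_def
      del: of_real_mult of_real_power of_real_diff of_int_abs)

lemma zero_depths: "0 \<in> range (dual_pow A j)"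
  using dual_pow_zero[of A j] by (metis rangeI)

text \<open>
  Any one of the states sees the degree of the covering: for the point mass at the trivial point, the
  series give \<open>\<psi>(1) = 1\<close> and \<open>\<psi>(V V\<^sup>*) = exp (- \<beta>)\<close>, so the KMS condition gives \<open>\<psi>(V\<^sup>* V) = 1\<close>, while \<open>V\<^sup>* V\<close> is
  the degree divided by \<open>\<bar>det A\<bar>\<close>.
\<close>

theorem card_covering_kernel: "int (card (covering_kernel A)) = \<bar>det A\<bar>"
proof -
  define \<delta> :: "'n torus measure" where "\<delta> = return borel torus_one"
  have \<delta>: "\<delta> \<in> prob_measures" by (simp add: \<delta>_def prob_measures_def prob_space_return)
  let ?r = "complex_of_real r"
  have K: "KMS_functional \<sigma> \<beta> (\<psi> \<delta>)" by (intro KMS_states_functional KMS \<delta>)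
  have nr: "cmod ?r < 1" using r by simp
  have total: "(LINT z|\<delta>. torus_char (inv_into UNIV (dual_pow A j) 0) z) = 1" for j
  proof -
    have "inv_into UNIV (dual_pow A j) 0 = 0"
      using inv_f_f[OF inj_dual_pow[OF det], of j 0] by (simp only: dual_pow_zero)
    then show ?thesis
      using prob_space.prob_space[OF prob_space_return[of "torus_one :: 'n torus" borel]]
      by (simp add: torus_char_zero[abs_def] \<delta>_def)
  qed
  have "((\<lambda>j. ?r ^ j) has_sum 1 / (1 - ?r)) UNIV"
    using nr by (intro norm_summable_imp_has_sum geometric_sums) (simp_all add: norm_power summable_geometric)
  moreover have "depths 0 = UNIV" using zero_depths by (auto simp: depths_def)
  moreover have "summand \<delta> 0 = (\<lambda>j. ?r ^ j)" by (rule ext) (simp add: summand_def total)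
  ultimately have "\<psi> \<delta> (U 0) = 1"
    using r unfolding \<psi>_U[OF \<delta>] by (simp add: infsumI)
  then have one: "\<psi> \<delta> 1 = 1" by (simp add: U_zero)
  define d where "d = real_of_int \<bar>det A\<bar>"
  have d: "d \<noteq> 0" using det by (simp add: d_def)
  \<comment> \<open>The term of index \<open>j\<close> in the series for \<open>V V\<^sup>*\<close> is \<open>d\<^bsup>j-1\<^esup> exp (- j \<beta>) = r\<^sup>j / d\<close>.\<close>
  have "((\<lambda>j. inverse (of_real d) * ?r ^ j) has_sum inverse (of_real d) * (?r / (1 - ?r))) {1..}"
    using has_sum_geometric_from_1[OF nr] by (rule has_sum_cmult_right)
  also have "?this \<longleftrightarrow> ((\<lambda>j. complex_of_real (d ^ (j - 1) * exp (- (real j * \<beta>)))) has_sum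
      inverse (of_real d) * (?r / (1 - ?r))) {1..}"
  proof (rule has_sum_cong)
    fix j :: nat assume "j \<in> {1..}"
    then have "d ^ j = d * d ^ (j - 1)" by (simp add: power_eq_if)
    then have "d ^ (j - 1) * exp (- (real j * \<beta>)) = inverse d * r ^ j"
      using d power_exp_eq[of j, folded d_def] by (simp add: field_simps)
    then show "inverse (of_real d) * ?r ^ j = complex_of_real (d ^ (j - 1) * exp (- (real j * \<beta>)))"
      by simp
  qed
  finally have sum: "(\<Sum>\<^sub>\<infinity>j\<in>{1..}. complex_of_real (d ^ (j - 1) * exp (- (real j * \<beta>)))) =
      inverse (of_real d) * (?r / (1 - ?r))" by (rule infsumI)
  have "\<psi> \<delta> (V * star V) = of_real (1 - r) * (inverse (of_real d) * (?r / (1 - ?r)))"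
    using series[OF \<delta>, of 0 1 1 0, folded geometric_ratio_def, folded r_def d_def] sum
    by (simp add: U_zero total zero_depths atLeast_def del: of_real_mult of_real_power of_real_diff)
  also have "\<dots> = of_real (exp (- \<beta>))"
  proof -
    have "exp (- \<beta>) = r / d" using d by (simp add: r_def geometric_ratio_def d_def)
    then show ?thesis using r by (simp add: divide_inverse)
  qed
  finally have "of_real (exp (- \<beta>)) = of_real (exp (- \<beta>)) * \<psi> \<delta> (star V * V)"
    using KMS_V_star_V[OF K] by simp
  then have "\<psi> \<delta> (star V * V) = 1" by simp
  then have "complex_of_nat (card (covering_kernel A)) = of_int \<bar>det A\<bar>"
    using det by (simp add: star_V_V KMS_functional_scaleC[OF K] one)
  then have "complex_of_int (int (card (covering_kernel A))) = of_int \<bar>det A\<bar>" by simp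
  then show ?thesis by (simp only: of_int_eq_iff)
qed

lemma summand_summable:
  assumes "\<mu> \<in> prob_measures" shows "summand \<mu> p summable_on J"
proof (rule geometric_dominated_summable)
  fix j
  have "cmod (LINT z|\<mu>. torus_char (inv_into UNIV (dual_pow A j) p) z) \<le> 1"
    by (rule prob_measures_integral_bound[OF assms continuous_torus_char]) simp
  then show "cmod (summand \<mu> p j) \<le> r ^ j"
    using r by (simp add: summand_def norm_mult norm_power mult_left_le)
qed (use r in simp_all)

lemma summand_0: "summand \<mu> p 0 = (LINT z|\<mu>. torus_char p z)"
  by (simp add: summand_def dual_pow_simps(1)[abs_def])

lemma depths_dual: "depths (dual A q) = insert 0 (Suc ` depths q)"
proof -
  have "Suc j \<in> depths (dual A q) \<longleftrightarrow> j \<in> depths q" for j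
    using inj_eq[OF inj_dual[OF det]] unfolding depths_def
    by (simp only: mem_Collect_eq image_iff dual_pow_simps)
  moreover have "0 \<in> depths (dual A q)" by (simp add: depths_def dual_pow_simps(1)[abs_def])
  ultimately show ?thesis by (auto simp: image_iff) (metis not0_implies_Suc)
qed

lemma depths_not: "p \<notin> range (dual A) \<Longrightarrow> depths p = {0}"
proof (intro equalityI subsetI)
  fix j assume p: "p \<notin> range (dual A)" and "j \<in> depths p"
  then obtain s where s: "p = dual_pow A j s" by (auto simp: depths_def)
  show "j \<in> {0}"
  proof (cases j)
    case (Suc i)
    then have "p = dual A (dual_pow A i s)" using s by (simp only: dual_pow_simps)
    then show ?thesis using p by blast
  qed simp
qed (simp add: depths_def dual_pow_simps(1)[abs_def])

lemma summand_dual: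
  assumes "j \<in> depths q" shows "summand \<mu> (dual A q) (Suc j) = of_real r * summand \<mu> q j"
proof -
  obtain s where s: "q = dual_pow A j s" using assms by (auto simp: depths_def)
  then have "dual A q = dual_pow A (Suc j) s" by (simp only: dual_pow_simps)
  then have "inv_into UNIV (dual_pow A (Suc j)) (dual A q) = inv_into UNIV (dual_pow A j) q"
    using inv_f_f[OF inj_dual_pow[OF det]] s by metis
  then show ?thesis by (simp add: summand_def del: transpose_matrix_vector)
qed

text \<open>
  The terms of index \<open>j + 1\<close> at \<open>B q\<close> are \<open>r\<close> times the terms of index \<open>j\<close> at \<open>q\<close>.
\<close>

lemma \<psi>_U_dual:
  assumes \<mu>: "\<mu> \<in> prob_measures"
  shows "\<psi> \<mu> (U (dual A q)) = of_real (1 - r) * (LINT z|\<mu>. torus_char (dual A q) z) + of_real r * \<psi> \<mu> (U q)"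
proof -
  let ?p = "dual A q"
  have "(\<Sum>\<^sub>\<infinity>j\<in>depths ?p. summand \<mu> ?p j) = summand \<mu> ?p 0 + (\<Sum>\<^sub>\<infinity>j\<in>depths q. summand \<mu> ?p (Suc j))"
    unfolding depths_dual
    by (subst infsum_insert) (auto simp: summand_summable[OF \<mu>] infsum_reindex o_def simp del: transpose_matrix_vector)
  also have "(\<Sum>\<^sub>\<infinity>j\<in>depths q. summand \<mu> ?p (Suc j)) = (\<Sum>\<^sub>\<infinity>j\<in>depths q. of_real r * summand \<mu> q j)"
    by (intro infsum_cong summand_dual)
  also have "\<dots> = of_real r * (\<Sum>\<^sub>\<infinity>j\<in>depths q. summand \<mu> q j)"
    by (rule infsum_cmult_right) (rule summand_summable[OF \<mu>])
  finally show ?thesis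
    by (simp only: \<psi>_U[OF \<mu>] summand_0) (simp add: algebra_simps del: transpose_matrix_vector)
qed

lemma \<psi>_U_not:
  assumes "\<mu> \<in> prob_measures" "p \<notin> range (dual A)"
  shows "\<psi> \<mu> (U p) = of_real (1 - r) * (LINT z|\<mu>. torus_char p z)"
  unfolding \<psi>_U[OF assms(1)] depths_not[OF assms(2)] by (simp add: summand_0)

end

theorem proposition7p1:
  fixes A :: "int ^ 'n ^ 'n::finite"
    and \<beta> :: real
    and iM iC :: "('n torus \<Rightarrow> complex) \<Rightarrow> 'a::cstar_algebra"
    and \<sigma> :: "real \<Rightarrow> 'a \<Rightarrow> 'a"
    and \<psi> :: "'n torus measure \<Rightarrow> 'a \<Rightarrow> complex"
    and u :: "int ^ 'n \<Rightarrow> 'a" and v :: 'a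
  assumes "det A \<noteq> 0"
    and "toeplitz_algebra A iM iC"
    and "toeplitz_dynamics iM iC \<sigma>"
    and "\<And>m. u m = iC (torus_char m)"
    and "v = iM (\<lambda>_. 1)"
    and "\<beta> > ln (real_of_int \<bar>det A\<bar>)"
    and "\<And>\<mu>. \<mu> \<in> prob_measures \<Longrightarrow> \<psi> \<mu> \<in> KMS_states \<sigma> \<beta>"
    and "\<And>\<mu> m n k l. \<mu> \<in> prob_measures \<Longrightarrow>
      \<psi> \<mu> (u m * v ^ k * star v ^ l * star (u n)) =
        (if k = l \<and> m - n \<in> range (dual_pow A k)
         then complex_of_real (1 - real_of_int \<bar>det A\<bar> * exp (- \<beta>)) *
           (\<Sum>\<^sub>\<infinity>j\<in>{j. k \<le> j \<and> m - n \<in> range (dual_pow A j)}.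
              complex_of_real (real_of_int \<bar>det A\<bar> ^ (j - k) * exp (- (real j * \<beta>))) *
              (LINT z|\<mu>. torus_char (inv_into UNIV (dual_pow A j) (m - n)) z))
         else 0)"
  shows "homeomorphic_map prob_topology (KMS_topology \<sigma> \<beta>) \<psi> \<and>
    (\<forall>\<mu>\<in>prob_measures. \<forall>\<nu>\<in>prob_measures. \<forall>t\<in>{0..1}.
       \<psi> (mixture t \<mu> \<nu>) = (\<lambda>c. complex_of_real t * \<psi> \<mu> c + complex_of_real (1 - t) * \<psi> \<nu> c))"
proof -
  have rep: "bimodule_rep A type_cstar iM iC"
    and gen: "generates_cstar (iM ` carrier C_torus \<union> iC ` carrier C_torus)"
    using assms(2) by (simp_all add: toeplitz_algebra_def)
  interpret D: dynamical_representation A iM iC \<sigma>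
    by unfold_locales (use assms(1,3) rep in auto)
  have u: "u m = D.U m" and v: "v = D.V" for m
    using assms(4,5) by (simp_all add: D.U_def D.V_def)
  interpret F: KMS_series_family A iM iC \<sigma> \<beta> \<psi>
    by unfold_locales (use assms(6,7) assms(8)[unfolded u v] in auto)
  interpret T: toeplitz_system A iM iC \<sigma> \<beta>
    by unfold_locales (use F.card_covering_kernel gen assms(6) in auto)
  have "T.fourier (\<psi> \<mu>) p = (LINT z|\<mu>. torus_char p z)" if \<mu>: "\<mu> \<in> prob_measures" for \<mu> p
  proof (cases "p \<in> range (dual A)")
    case True
    then obtain q where q: "p = dual A q" by blast
    show ?thesis unfolding q T.fourier_def T.descend_dual F.\<psi>_U_dual[OF \<mu>]
      using T.r_less_1 by (simp add: F.r_def del: transpose_matrix_vector)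
  next
    case False
    show ?thesis unfolding T.fourier_def T.descend_not[OF False] F.\<psi>_U_not[OF \<mu> False]
      using T.r_less_1 by (simp add: F.r_def)
  qed
  then interpret P: KMS_parametrisation A iM iC \<sigma> \<beta> \<psi>
    by unfold_locales (use assms(7) in auto)
  show ?thesis using P.homeomorphic_map_\<psi> P.\<psi>_affine by blast
qed

end
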